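(* Let $b$ be a prime. There exist constants $C_{\alpha,\beta,b,t,u}>0$, depending only on $\alpha,\beta,b,t,u$, such that the following holds. Let $s,\alpha,\beta,m\in\mathbb{N}$ and $t\in\mathbb{N}_0$ with $\alpha\ge 2$, $\beta\ge 2\alpha$ and $0\le t\le \beta m$, let $P\subset[0,1)^s$ be an order $\beta$ digital $(t,m,s)$-net over $\mathbb{F}_b$, and let $\boldsymbol{\gamma}=(\gamma_u)_{u\subseteq\{1,\ldots,s\}}$ be a set of non-negative real weights. Then, with $N=|P|=b^m$, the root mean square worst-case error of quasi-Monte Carlo integration over the randomly digitally shifted point set $P\oplus\boldsymbol{\sigma}$ in $\mathcal{H}_{\alpha,\boldsymbol{\gamma}}$ (with respect to $\boldsymbol{\sigma}$ chosen uniformly at random in $[0,1)^s$) satisfies $$e^{\mathrm{rms}\text{-}\mathrm{wor}}(\mathcal{H}_{\alpha,\boldsymbol{\gamma}};P)\le \frac{1}{N^{\alpha}}\sum_{\emptyset\ne u\subseteq\{1,\ldots,s\}}\gamma_u^{1/2}\,C_{\alpha,\beta,b,t,u}\,(\log N)^{(|u|-1)/2}.$$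
   Context: Notation: $\mathbb{N}=\{1,2,\ldots\}$, $\mathbb{N}_0=\mathbb{N}\cup\{0\}$, $b$ is a prime, $\mathbb{F}_b$ is the field with $b$ elements, identified with $\{0,1,\ldots,b-1\}$ with arithmetic modulo $b$. Point sets are finite multisets (elements counted with multiplicity). Digital net: for $m,n,s\in\mathbb{N}$ and matrices $C_1,\ldots,C_s\in\mathbb{F}_b^{n\times m}$, for each integer $0\le h<b^m$ with $b$-adic expansion $h=\sum_{i=0}^{m-1}\eta_i b^i$ put $(\xi_{1,h,j},\ldots,\xi_{n,h,j})^{\top}=C_j(\eta_0,\ldots,\eta_{m-1})^{\top}$ and $x_{h,j}=\sum_{i=1}^n\xi_{i,h,j}b^{-i}$ for $1\le j\le s$. The multiset $P=\{\boldsymbol{x}_0,\ldots,\boldsymbol{x}_{b^m-1}\}\subset[0,1)^s$, $\boldsymbol{x}_h=(x_{h,1},\ldots,x_{h,s})$, is the digital net over $\mathbb{F}_b$ with generating matrices $C_1,\ldots,C_s$. Order $\beta$ digital $(t,m,s)$-net: let $n\ge\beta m$ and let $P$ be a digital net over $\mathbb{F}_b$ with generating matrices $C_1,\ldots,C_s\in\mathbb{F}_b^{n\times m}$; let $\boldsymbol{c}_{i,j}\in\mathbb{F}_b^m$ be the $i$-th row of $C_j$. Let $t$ be an integer with $0\le t\le\beta m$. $P$ is an order $\beta$ digital $(t,m,s)$-net over $\mathbb{F}_b$ if for all choices of integers $v_j\ge 0$ and $1\le i_{j,v_j}<\cdots<i_{j,1}\le n$ ($1\le j\le s$) with $\sum_{j=1}^s\sum_{l=1}^{\min(\beta,v_j)}i_{j,l}\le\beta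 m-t$, the vectors $\boldsymbol{c}_{i_{1,v_1},1},\ldots,\boldsymbol{c}_{i_{1,1},1},\ldots,\boldsymbol{c}_{i_{s,v_s},s},\ldots,\boldsymbol{c}_{i_{s,1},s}$ are linearly independent over $\mathbb{F}_b$. Digital shift: for $x=\sum_{i\ge1}\xi_ib^{-i}$, $x'=\sum_{i\ge1}\xi_i'b^{-i}$ in $[0,1)$ (unique $b$-adic expansions with infinitely many digits different from $b-1$), $x\oplus x':=\sum_{i\ge1}\eta_ib^{-i}$ with $\eta_i\in\{0,\ldots,b-1\}$, $\eta_i\equiv\xi_i+\xi_i'\pmod b$; applied componentwise to vectors. $P\oplus\boldsymbol{\sigma}:=\{\boldsymbol{x}\oplus\boldsymbol{\sigma}:\boldsymbol{x}\in P\}$ for $\boldsymbol{\sigma}\in[0,1)^s$ (well defined in $[0,1)^s$ since points of $P$ have finite $b$-adic expansions). Errors: $I(f)=\int_{[0,1)^s}f(\boldsymbol{x})\,d\boldsymbol{x}$, $I(f;P)=\frac1{|P|}\sum_{\boldsymbol{x}\in P}f(\boldsymbol{x})$. For a normed function space $V$, $e^{\mathrm{wor}}(V;P)=\sup_{f\in V,\ \|f\|_V\le1}|I(f;P)-I(f)|$ and $e^{\mathrm{rms}\text{-}\mathrm{wor}}(V;P)=\left(\int_{[0,1)^s}\left(e^{\mathrm{wor}}(V;P\oplus\boldsymbol{\sigma})\right)^2d\boldsymbol{\sigma}\right)^{1/2}$. Weighted Sobolev space: for an integer $\alpha\ge2$ and non-negative weights $\boldsymbol{\gamma}=(\gamma_u)_{u\subseteq\{1,\ldots,s\}}$,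 $\mathcal{H}_{\alpha,\boldsymbol{\gamma}}$ is the reproducing kernel Hilbert space of real functions on $[0,1)^s$ with reproducing kernel $$\mathcal{K}_{\alpha,\boldsymbol{\gamma}}(\boldsymbol{x},\boldsymbol{y})=\sum_{u\subseteq\{1,\ldots,s\}}\gamma_u\prod_{j\in u}\left\{\sum_{r=1}^{\alpha}\frac{B_r(x_j)B_r(y_j)}{(r!)^2}+(-1)^{\alpha+1}\frac{B_{2\alpha}(|x_j-y_j|)}{(2\alpha)!}\right\},$$ where $B_r$ is the Bernoulli polynomial of degree $r$ and the empty product is $1$. Its inner product is $$\langle f,g\rangle_{\alpha,\boldsymbol{\gamma}}=\sum_{u\subseteq\{1,\ldots,s\}}\gamma_u^{-1}\sum_{v\subseteq u}\ \sum_{\boldsymbol{r}_{u\setminus v}\in\{1,\ldots,\alpha-1\}^{|u\setminus v|}}\int_{[0,1)^{|v|}}\left(\int_{[0,1)^{s-|v|}}f^{(\boldsymbol{r}_{u\setminus v},\boldsymbol{\alpha}_v,\boldsymbol{0})}d\boldsymbol{x}_{\{1,\ldots,s\}\setminus v}\right)\left(\int_{[0,1)^{s-|v|}}g^{(\boldsymbol{r}_{u\setminus v},\boldsymbol{\alpha}_v,\boldsymbol{0})}d\boldsymbol{x}_{\{1,\ldots,s\}\setminus v}\right)d\boldsymbol{x}_v,$$ where $(\boldsymbol{r}_{u\setminus v},\boldsymbol{\alpha}_v,\boldsymbol{0})$ is the vector of derivative orders with $j$-th component $r_j$ if $j\in u\setminus v$, $\alpha$ if $j\in v$, and $0$ otherwise;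 for $u$ with $\gamma_u=0$ the corresponding inner double sum is assumed to be $0$, and $0/0:=0$. *)

theory Defs
  imports
    "HOL-Analysis.Analysis"
    "HOL-Library.Multiset"
    "HOL-Number_Theory.Cong"
begin

section \<open>The half-open unit cube\<close>

text \<open>
  The dimension \<open>s\<close> is a number, not a type: a point of \<open>[0,1)\<^sup>s\<close> is a function on \<open>{1..s}\<close>
  (extensional, i.e. \<^const>\<open>undefined\<close> outside of \<open>{1..s}\<close>).
\<close>

definition cube :: "nat \<Rightarrow> (nat \<Rightarrow> real) set" where
  "cube s = (\<Pi>\<^sub>E j\<in>{1..s}. {0..<1})"

definition cube_measure :: "nat \<Rightarrow> (nat \<Rightarrow> real) measure" where
  "cube_measure s = (\<Pi>\<^sub>M j\<in>{1..s}. restrict_space lborel {0..<1})"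

lemma space_cube_measure: "space (cube_measure s) = cube s"
  by (simp add: cube_measure_def cube_def space_PiM space_restrict_space)


section \<open>Digital nets\<close>

text \<open>
  The field with \<open>b\<close> elements is \<open>{0..<b}\<close> with arithmetic modulo \<open>b\<close>.
  \<open>C j i k\<close> is the entry of the matrix \<open>C\<^sub>j\<close> in row \<open>i \<in> {1..n}\<close> and column
  \<open>k \<in> {0..<m}\<close>; columns are numbered like the digits \<open>\<eta>\<^sub>0, \<dots>, \<eta>\<^sub>m\<^sub>-\<^sub>1\<close> they are multiplied with.
\<close>

definition net_digit :: "nat \<Rightarrow> nat \<Rightarrow> (nat \<Rightarrow> nat \<Rightarrow> nat \<Rightarrow> nat) \<Rightarrow> nat \<Rightarrow> nat \<Rightarrow> nat \<Rightarrow> nat" where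
  "net_digit b m C j i h = (\<Sum>k<m. C j i k * (h div b ^ k mod b)) mod b"

definition net_point :: "nat \<Rightarrow> nat \<Rightarrow> nat \<Rightarrow> nat \<Rightarrow> (nat \<Rightarrow> nat \<Rightarrow> nat \<Rightarrow> nat) \<Rightarrow> nat \<Rightarrow> (nat \<Rightarrow> real)" where
  "net_point b n m s C h = (\<lambda>j\<in>{1..s}. \<Sum>i=1..n. real (net_digit b m C j i h) / real b ^ i)"

definition digital_net :: "nat \<Rightarrow> nat \<Rightarrow> nat \<Rightarrow> nat \<Rightarrow> (nat \<Rightarrow> nat \<Rightarrow> nat \<Rightarrow> nat) \<Rightarrow> (nat \<Rightarrow> real) multiset" where
  "digital_net b n m s C = image_mset (net_point b n m s C) (mset_set {0..<b ^ m})"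

text \<open>
  Linear independence over the field with \<open>b\<close> elements of the \<^emph>\<open>family\<close> \<open>(c p)\<close>, \<open>p \<in> I\<close>, of
  vectors \<open>c p = (c p 0, \<dots>, c p (m - 1))\<close>; equal vectors at different indices are dependent.
\<close>

definition lin_indep_mod :: "nat \<Rightarrow> nat \<Rightarrow> 'i set \<Rightarrow> ('i \<Rightarrow> nat \<Rightarrow> nat) \<Rightarrow> bool" where
  "lin_indep_mod b m I c \<longleftrightarrow>
     (\<forall>a :: 'i \<Rightarrow> nat. (\<forall>p\<in>I. a p < b) \<and> (\<forall>k<m. [(\<Sum>p\<in>I. a p * c p k) = 0] (mod b))
        \<longrightarrow> (\<forall>p\<in>I. a p = 0))"

text \<open>
  In the row condition \<open>i j l\<close> is \<open>i\<^bsub>j,l\<^esub>\<close>, for \<open>1 \<le> l \<le> v j\<close>, and is decreasing in \<open>l\<close>.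
\<close>

definition order_digital_net ::
  "nat \<Rightarrow> nat \<Rightarrow> nat \<Rightarrow> nat \<Rightarrow> nat \<Rightarrow> (nat \<Rightarrow> real) multiset \<Rightarrow> bool" where
  "order_digital_net \<beta> b t m s P \<longleftrightarrow> t \<le> \<beta> * m \<and>
     (\<exists>n C. n \<ge> 1 \<and> n \<ge> \<beta> * m \<and>
        (\<forall>j\<in>{1..s}. \<forall>i\<in>{1..n}. \<forall>k<m. C j i k < b) \<and>
        P = digital_net b n m s C \<and>
        (\<forall>v i.
           (\<forall>j\<in>{1..s}. (\<forall>l\<in>{1..v j}. i j l \<in> {1..n}) \<and>
                        (\<forall>l l'. 1 \<le> l \<and> l < l' \<and> l' \<le> v j \<longrightarrow> i j l' < i j l)) \<and>
           (\<Sum>j=1..s. \<Sum>l=1..min \<beta> (v j). i j l) \<le> \<beta> * m - t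
           \<longrightarrow> lin_indep_mod b m (SIGMA j:{1..s}. {1..v j}) (\<lambda>(j, l). C j (i j l))))"


section \<open>Digital shifts\<close>

text \<open>
  For \<open>x \<in> [0,1)\<close>, \<open>digit b x i\<close> is the \<open>i\<close>-th digit (\<open>i \<ge> 1\<close>) of the \<open>b\<close>-adic expansion of \<open>x\<close>
  with infinitely many digits different from \<open>b - 1\<close>; see \<open>digit_sums\<close> and
  \<open>digit_neq_infinitely_often\<close>.
\<close>

definition digit :: "nat \<Rightarrow> real \<Rightarrow> nat \<Rightarrow> nat" where
  "digit b x i = nat (\<lfloor>x * real b ^ i\<rfloor> mod int b)"

lemma digit_less: "b > 0 \<Longrightarrow> digit b x i < b"
  by (simp add: digit_def nat_less_iff)

lemma floor_digit_Suc:
  assumes "b > 0"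
  shows "\<lfloor>x * real b ^ Suc n\<rfloor> = int b * \<lfloor>x * real b ^ n\<rfloor> + int (digit b x (Suc n))"
proof -
  have "\<lfloor>x * real b ^ Suc n\<rfloor> div int b = \<lfloor>x * real b ^ Suc n / real_of_int (int b)\<rfloor>"
    by (rule floor_divide_real_eq_div[symmetric]) simp
  also have "x * real b ^ Suc n / real_of_int (int b) = x * real b ^ n"
    using assms by simp
  finally have "\<lfloor>x * real b ^ Suc n\<rfloor> div int b = \<lfloor>x * real b ^ n\<rfloor>" .
  moreover have "int (digit b x (Suc n)) = \<lfloor>x * real b ^ Suc n\<rfloor> mod int b"
    using assms by (simp add: digit_def)
  ultimately show ?thesis
    by (metis mult_div_mod_eq)
qed

lemma digit_sums:
  assumes b: "b \<ge> 2" and x: "x \<in> {0..<1}"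
  shows "(\<lambda>i. real (digit b x (Suc i)) / real b ^ Suc i) sums x"
proof -
  have eq: "(\<Sum>i<n. real (digit b x (Suc i)) / real b ^ Suc i) = \<lfloor>x * real b ^ n\<rfloor> / real b ^ n" for n
  proof (induction n)
    case 0
    have "\<lfloor>x\<rfloor> = 0" using x by (auto simp: floor_eq_iff)
    then show ?case by simp
  next
    case (Suc n)
    have "real_of_int \<lfloor>x * real b ^ Suc n\<rfloor> / real b ^ Suc n
        = \<lfloor>x * real b ^ n\<rfloor> / real b ^ n + real (digit b x (Suc n)) / real b ^ Suc n"
      using b by (subst floor_digit_Suc) (auto simp: field_simps)
    then show ?case using Suc by simp
  qed
  have lim0: "(\<lambda>n. (1 / real b) ^ n) \<longlonglongrightarrow> 0"
    using b by (intro LIMSEQ_power_zero) auto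
  have "(\<lambda>n. x - \<lfloor>x * real b ^ n\<rfloor> / real b ^ n) \<longlonglongrightarrow> 0"
  proof (rule tendsto_sandwich[OF _ _ tendsto_const lim0])
    show "\<forall>\<^sub>F n in sequentially. 0 \<le> x - \<lfloor>x * real b ^ n\<rfloor> / real b ^ n"
      using b by (intro always_eventually allI) (simp add: pos_divide_le_eq)
    have "x - \<lfloor>x * real b ^ n\<rfloor> / real b ^ n \<le> (1 / real b) ^ n" for n
    proof -
      have "x * real b ^ n \<le> \<lfloor>x * real b ^ n\<rfloor> + 1" by linarith
      then have "x \<le> (\<lfloor>x * real b ^ n\<rfloor> + 1) / real b ^ n"
        using b by (simp add: pos_le_divide_eq)
      then show ?thesis by (simp add: add_divide_distrib power_one_over algebra_simps)
    qed
    then show "\<forall>\<^sub>F n in sequentially. x - \<lfloor>x * real b ^ n\<rfloor> / real b ^ n \<le> (1 / real b) ^ n"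
      by simp
  qed
  from tendsto_diff[OF tendsto_const[of x] this]
  show ?thesis unfolding sums_def eq by simp
qed

lemma digit_neq_infinitely_often:
  assumes b: "b \<ge> 2"
  shows "\<exists>\<^sub>\<infinity>i. digit b x i \<noteq> b - 1"
proof (rule ccontr)
  assume "\<not> ?thesis"
  then obtain N where N: "\<And>i. i > N \<Longrightarrow> digit b x i = b - 1"
    unfolding INFM_nat by auto
  define z where "z = \<lfloor>x * real b ^ N\<rfloor>"
  have eq: "\<lfloor>x * real b ^ (N + k)\<rfloor> + 1 = int b ^ k * (z + 1)" for k
  proof (induction k)
    case (Suc k)
    have "\<lfloor>x * real b ^ (N + Suc k)\<rfloor> = int b * \<lfloor>x * real b ^ (N + k)\<rfloor> + int (b - 1)"
      using floor_digit_Suc[of b x "N + k"] N[of "Suc (N + k)"] b by simp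
    then have "\<lfloor>x * real b ^ (N + Suc k)\<rfloor> + 1 = int b * (\<lfloor>x * real b ^ (N + k)\<rfloor> + 1)"
      using b by (simp add: algebra_simps of_nat_diff)
    then show ?case using Suc by simp
  qed (simp add: z_def)
  have "z + 1 - x * real b ^ N \<le> (1 / real b) ^ k" for k
  proof -
    have "real_of_int (\<lfloor>x * real b ^ (N + k)\<rfloor> + 1) \<le> x * real b ^ (N + k) + 1" by simp
    then have "real b ^ k * (z + 1) \<le> x * real b ^ N * real b ^ k + 1"
      by (simp only: eq) (simp add: power_add mult.assoc)
    then have "real b ^ k * (z + 1 - x * real b ^ N) \<le> 1"
      by (simp add: algebra_simps)
    then show ?thesis using b by (simp add: power_one_over field_simps)
  qed
  moreover have "(\<lambda>k. (1 / real b) ^ k) \<longlonglongrightarrow> 0"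
    using b by (intro LIMSEQ_power_zero) auto
  ultimately have "z + 1 - x * real b ^ N \<le> 0"
    by (intro tendsto_lowerbound[where F = sequentially]) auto
  then show False unfolding z_def by linarith
qed

definition digital_add :: "nat \<Rightarrow> real \<Rightarrow> real \<Rightarrow> real" where
  "digital_add b x y = (\<Sum>i. real ((digit b x (Suc i) + digit b y (Suc i)) mod b) / real b ^ Suc i)"

definition digital_shift ::
  "nat \<Rightarrow> nat \<Rightarrow> (nat \<Rightarrow> real) multiset \<Rightarrow> (nat \<Rightarrow> real) \<Rightarrow> (nat \<Rightarrow> real) multiset" where
  "digital_shift b s P \<sigma> = image_mset (\<lambda>x. \<lambda>j\<in>{1..s}. digital_add b (x j) (\<sigma> j)) P"


section \<open>Integration errors\<close>

definition qmc :: "(nat \<Rightarrow> real) multiset \<Rightarrow> ((nat \<Rightarrow> real) \<Rightarrow> real) \<Rightarrow> real" where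
  "qmc P f = (\<Sum>x\<in>#P. f x) / real (size P)"

text \<open>
  A normed function space is given by its set \<open>V\<close> of functions and its norm \<open>nrm\<close>.
  Both errors are extended nonnegative reals, so that an infinite supremum or integral
  is really infinite.
\<close>

definition wor_error ::
  "nat \<Rightarrow> ((nat \<Rightarrow> real) \<Rightarrow> real) set \<Rightarrow> (((nat \<Rightarrow> real) \<Rightarrow> real) \<Rightarrow> real) \<Rightarrow>
   (nat \<Rightarrow> real) multiset \<Rightarrow> ennreal" where
  "wor_error s V nrm P =
     (SUP f\<in>{f \<in> V. nrm f \<le> 1}. ennreal \<bar>qmc P f - integral\<^sup>L (cube_measure s) f\<bar>)"

definition ennreal_sqrt :: "ennreal \<Rightarrow> ennreal" where
  "ennreal_sqrt x = (if x = top then top else ennreal (sqrt (enn2real x)))"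

definition rms_wor_error ::
  "nat \<Rightarrow> nat \<Rightarrow> ((nat \<Rightarrow> real) \<Rightarrow> real) set \<Rightarrow> (((nat \<Rightarrow> real) \<Rightarrow> real) \<Rightarrow> real) \<Rightarrow>
   (nat \<Rightarrow> real) multiset \<Rightarrow> ennreal" where
  "rms_wor_error b s V nrm P =
     ennreal_sqrt (\<integral>\<^sup>+ \<sigma>. (wor_error s V nrm (digital_shift b s P \<sigma>))\<^sup>2 \<partial>cube_measure s)"


section \<open>Reproducing kernel Hilbert spaces\<close>

text \<open>
  \<open>rkhs D K H ip\<close>: the set \<open>H\<close> of real functions on \<open>D\<close> (extensional, so that a function is
  determined by its values on \<open>D\<close>) with inner product \<open>ip\<close> is a Hilbert space with reproducing
  kernel \<open>K\<close>. By the theorem of Moore and Aronszajn, a positive semidefinite \<open>K\<close> determines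
  \<open>H\<close>, and \<open>ip\<close> on \<open>H\<close>, uniquely.
\<close>

locale rkhs =
  fixes D :: "'a set"
    and K :: "'a \<Rightarrow> 'a \<Rightarrow> real"
    and H :: "('a \<Rightarrow> real) set"
    and ip :: "('a \<Rightarrow> real) \<Rightarrow> ('a \<Rightarrow> real) \<Rightarrow> real"
  assumes extensional: "H \<subseteq> extensional D"
    and zero: "(\<lambda>x\<in>D. 0) \<in> H"
    and add: "f \<in> H \<Longrightarrow> g \<in> H \<Longrightarrow> (\<lambda>x\<in>D. f x + g x) \<in> H"
    and scale: "f \<in> H \<Longrightarrow> (\<lambda>x\<in>D. c * f x) \<in> H"
    and ip_commute: "f \<in> H \<Longrightarrow> g \<in> H \<Longrightarrow> ip f g = ip g f"
    and ip_add: "f \<in> H \<Longrightarrow> g \<in> H \<Longrightarrow> h \<in> H \<Longrightarrow> ip (\<lambda>x\<in>D. f x + g x) h = ip f h + ip g h"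
    and ip_scale: "f \<in> H \<Longrightarrow> g \<in> H \<Longrightarrow> ip (\<lambda>x\<in>D. c * f x) g = c * ip f g"
    and ip_nonneg: "f \<in> H \<Longrightarrow> ip f f \<ge> 0"
    and ip_eq_0: "f \<in> H \<Longrightarrow> ip f f = 0 \<Longrightarrow> f = (\<lambda>x\<in>D. 0)"
    and complete: "Metric_space.mcomplete H
                     (\<lambda>f g. sqrt (ip (\<lambda>x\<in>D. f x - g x) (\<lambda>x\<in>D. f x - g x)))"
    and kernel: "y \<in> D \<Longrightarrow> (\<lambda>x\<in>D. K x y) \<in> H"
    and reproducing: "f \<in> H \<Longrightarrow> y \<in> D \<Longrightarrow> ip f (\<lambda>x\<in>D. K x y) = f y"


section \<open>The weighted Sobolev kernel\<close>

fun bernoulli :: "nat \<Rightarrow> real" where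
  "bernoulli n = (if n = 0 then 1
     else - (\<Sum>k<n. real (Suc n choose k) * bernoulli k) / real (Suc n))"

declare bernoulli.simps [simp del]

definition bernpoly :: "nat \<Rightarrow> real \<Rightarrow> real" where
  "bernpoly n x = (\<Sum>k\<le>n. real (n choose k) * bernoulli k * x ^ (n - k))"

definition sobolev_kernel ::
  "nat \<Rightarrow> nat \<Rightarrow> (nat set \<Rightarrow> real) \<Rightarrow> (nat \<Rightarrow> real) \<Rightarrow> (nat \<Rightarrow> real) \<Rightarrow> real" where
  "sobolev_kernel \<alpha> s \<gamma> x y =
     (\<Sum>u\<in>Pow {1..s}. \<gamma> u *
        (\<Prod>j\<in>u. (\<Sum>r=1..\<alpha>. bernpoly r (x j) * bernpoly r (y j) / (fact r)\<^sup>2)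
               + (-1) ^ (\<alpha> + 1) * bernpoly (2 * \<alpha>) \<bar>x j - y j\<bar> / fact (2 * \<alpha>)))"

end

theory Submission
  imports Defs "HOL-Probability.Infinite_Product_Measure"
begin

text \<open>
  By Cauchy-Schwarz the squared worst-case error is a double average of the kernel over the point
  set, without the term for \<open>u = {}\<close>. Averaging over the digital shift turns every one-dimensional
  kernel into a nonnegative combination of diagonal products of characters of the group of \<open>n\<close>-digit
  numbers under digitwise addition, so only frequencies \<open>k\<close> in the dual net survive. All of this
  takes place on the finite grid \<open>{X / b ^ n}\<close>, up to a common offset \<open>\<tau> / b ^ n\<close>; no infinite Walsh
  series is needed.

  The coefficient at \<open>k\<close> is \<open>O(b ^ (- 2 \<mu>))\<close>, where \<open>\<mu>\<close> is the sum of the \<open>\<alpha>\<close> largest positions of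
  nonzero digits of \<open>k\<close>: for the polynomial part of the kernel by expanding around coarser grid
  points, and for \<open>B\<^sub>2\<^sub>\<alpha>(\<bar>x - y\<bar>)\<close> by summation by parts, since characters have small \<open>\<alpha>\<close>-fold
  antiderivatives and the differences of order \<open>2 \<alpha>\<close> of the periodic \<open>B\<^sub>2\<^sub>\<alpha>\<close> are summable.
  Finally, the net property bounds the number of elements of the dual net with prescribed leading
  digits, and it forces \<open>2 \<mu>\<close> to be essentially at least \<open>2 \<alpha> m\<close>. Only \<open>m ^ (\<bar>u\<bar> - 1)\<close> configurations
  attain this; the others decay geometrically.
\<close>

section \<open>Bernoulli polynomials\<close>

text \<open>The hypothesis \<open>\<beta> \<ge> 2 * \<alpha>\<close> enters through one trade-off.
  The coefficients decay with the sum \<open>A\<close> of the \<open>\<alpha>\<close> largest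
  positions, while the net property speaks about the \<open>\<beta>\<close> largest ones. Let
  \<open>L\<close> be the sum over the coordinates of the \<open>\<alpha>\<close>-th largest
  position. The \<open>\<beta>\<close> largest positions sum to at most
  \<open>A + (\<beta> - \<alpha>) * L\<close>, and \<open>\<alpha> * L \<le> A\<close>. For
  \<open>L < m\<close> the net property therefore forces \<open>A\<close> well beyond
  \<open>\<alpha> * L\<close>. For \<open>L > m\<close> the \<open>b ^ (L + t - m)\<close>
  frequencies with the same leading digits cost less than \<open>A \<ge> \<alpha> * L\<close> gains.
  In both cases a factor that decays in \<open>\<bar>L - m\<bar>\<close> and in
  \<open>A - \<alpha> * L\<close> is left over; it ties one position to the others, hence the
  exponent |u| - 1. The finite grid has a price: the coefficient at the zero frequency does not
  vanish but is a quadrature error \<open>O(b ^ (- n))\<close>, harmless because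
  \<open>n \<ge> \<beta> * m \<ge> 2 * \<alpha> * m\<close>. As \<open>n\<close> is not bounded in
  terms of \<open>m\<close>, no constant may depend on it.\<close>

lemma bernoulli_0 [simp]: "bernoulli 0 = 1"
  by (simp add: bernoulli.simps)

text \<open>The defining recursion in homogeneous form. The excluded \<open>n = 1\<close> gives
  \<open>bernoulli 0 = 1\<close>, and exactly this term survives in
  \<open>bernpoly_diff\<close>.\<close>

lemma bernoulli_sum:
  assumes "n \<noteq> 1"
  shows "(\<Sum>k<n. real (n choose k) * bernoulli k) = 0"
proof (cases n)
  case 0
  then show ?thesis by simp
next
  case (Suc p)
  with assms have p: "p \<noteq> 0" by simp
  have "bernoulli p = - (\<Sum>k<p. real (Suc p choose k) * bernoulli k) / real (Suc p)"
    using p by (subst bernoulli.simps) simp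
  then have "real (Suc p) * bernoulli p = - (\<Sum>k<p. real (Suc p choose k) * bernoulli k)"
    by (simp add: field_simps del: of_nat_Suc)
  then show ?thesis
    by (simp add: Suc lessThan_Suc del: of_nat_Suc)
qed

lemma bernpoly_0 [simp]: "bernpoly 0 x = 1"
  by (simp add: bernpoly_def)

text \<open>After expanding \<open>(x + 1) ^ (n - k)\<close> and exchanging the sums, the symmetry
  \<open>(n choose k) * ((n - k) choose i) = (n choose i) * ((n - i) choose k)\<close> puts the
  Bernoulli recursion of index \<open>n - i\<close> inside; it vanishes unless
  \<open>i = n - 1\<close>.\<close>

lemma bernpoly_diff:
  "bernpoly n (x + 1) - bernpoly n x = real n * x ^ (n - 1)"
proof -
  have binom: "(x + 1) ^ p - x ^ p = (\<Sum>i<p. real (p choose i) * x ^ i)" for p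
    by (simp add: binomial_ring lessThan_Suc_atMost[symmetric])
  have "bernpoly n (x + 1) - bernpoly n x
      = (\<Sum>k\<le>n. real (n choose k) * bernoulli k * ((x + 1) ^ (n - k) - x ^ (n - k)))"
    by (simp add: bernpoly_def sum_subtractf[symmetric] algebra_simps)
  also have "\<dots> = (\<Sum>k\<le>n. \<Sum>i<n-k. real (n choose k) * bernoulli k * (real ((n - k) choose i) * x ^ i))"
    by (simp add: binom sum_distrib_left)
  also have "\<dots> = (\<Sum>(k,i)\<in>(SIGMA k:{..n}. {..<n-k}). real (n choose k) * bernoulli k * (real ((n - k) choose i) * x ^ i))"
    by (rule sum.Sigma) auto
  also have "(SIGMA k:{..n}. {..<n-k}) = (\<lambda>(i,k). (k,i)) ` (SIGMA i:{..n}. {..<n-i})"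
    by (auto simp: image_iff)
  also have "(\<Sum>(k,i)\<in>(\<lambda>(i,k). (k,i)) ` (SIGMA i:{..n}. {..<n-i}). real (n choose k) * bernoulli k * (real ((n - k) choose i) * x ^ i))
     = (\<Sum>(i,k)\<in>(SIGMA i:{..n}. {..<n-i}). real (n choose k) * bernoulli k * (real ((n - k) choose i) * x ^ i))"
    by (subst sum.reindex) (auto simp: inj_on_def case_prod_unfold)
  also have "\<dots> = (\<Sum>i\<le>n. \<Sum>k<n-i. real (n choose k) * bernoulli k * (real ((n - k) choose i) * x ^ i))"
    by (rule sum.Sigma[symmetric]) auto
  also have "\<dots> = (\<Sum>i\<le>n. real (n choose i) * x ^ i * (\<Sum>k<n-i. real ((n - i) choose k) * bernoulli k))"
  proof (rule sum.cong[OF refl])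
    fix i assume "i \<in> {..n}"
    have "real (n choose k) * bernoulli k * (real ((n - k) choose i) * x ^ i) =
        real (n choose i) * x ^ i * (real ((n - i) choose k) * bernoulli k)" if "k < n - i" for k
    proof -
      have "(n choose k) * ((n - k) choose i) = (n choose i) * ((n - i) choose k)"
        using that choose_mult[of k "k + i" n] choose_mult[of i "k + i" n]
          binomial_symmetric[of k "k + i"] by simp
      then have "real (n choose k) * real ((n - k) choose i) = real (n choose i) * real ((n - i) choose k)"
        by (metis of_nat_mult)
      then have "(real (n choose k) * real ((n - k) choose i)) * (bernoulli k * x ^ i)
          = (real (n choose i) * real ((n - i) choose k)) * (bernoulli k * x ^ i)"
        by (simp only:)
      then show ?thesis by (simp only: mult_ac)
    qed
    then show "(\<Sum>k<n-i. real (n choose k) * bernoulli k * (real ((n - k) choose i) * x ^ i)) =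
      real (n choose i) * x ^ i * (\<Sum>k<n-i. real ((n - i) choose k) * bernoulli k)"
      unfolding sum_distrib_left by (intro sum.cong refl) simp
  qed
  also have "\<dots> = (\<Sum>i\<le>n. if n = Suc i then real n * x ^ i else 0)"
  proof (rule sum.cong[OF refl])
    fix i assume "i \<in> {..n}"
    show "real (n choose i) * x ^ i * (\<Sum>k<n-i. real ((n - i) choose k) * bernoulli k) =
       (if n = Suc i then real n * x ^ i else 0)"
      using bernoulli_sum[of "n - i"] by auto
  qed
  also have "\<dots> = real n * x ^ (n - 1)"
    by (cases n) auto
  finally show ?thesis .
qed

lemma bernpoly_deriv:
  "(bernpoly (Suc n) has_real_derivative real (Suc n) * bernpoly n x) (at x)"
proof -
  have "((\<lambda>x. \<Sum>k\<le>Suc n. real (Suc n choose k) * bernoulli k * x ^ (Suc n - k)) has_real_derivative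
     (\<Sum>k\<le>Suc n. real (Suc n choose k) * bernoulli k * (real (Suc n - k) * x ^ (Suc n - k - 1)))) (at x)"
  proof (intro DERIV_sum DERIV_cmult)
    fix k
    show "((\<lambda>x. x ^ (Suc n - k)) has_real_derivative real (Suc n - k) * x ^ (Suc n - k - 1)) (at x)"
      using DERIV_pow[of "Suc n - k" x UNIV] by (simp only: One_nat_def)
  qed
  also have "(\<Sum>k\<le>Suc n. real (Suc n choose k) * bernoulli k * (real (Suc n - k) * x ^ (Suc n - k - 1)))
     = (\<Sum>k\<le>n. real (Suc n) * (real (n choose k) * bernoulli k * x ^ (n - k)))"
  proof -
    have "real (Suc n choose k) * bernoulli k * (real (Suc n - k) * x ^ (Suc n - k - 1)) =
       real (Suc n) * (real (n choose k) * bernoulli k * x ^ (n - k))" if "k \<le> n" for k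
    proof -
      have "real (Suc n choose k) * real (Suc n - k) = real (Suc n) * real (n choose k)"
        using binomial_absorb_comp[of "Suc n" k] by (metis diff_Suc_1 mult.commute of_nat_mult)
      then have "(real (Suc n choose k) * real (Suc n - k)) * (bernoulli k * x ^ (n - k))
        = (real (Suc n) * real (n choose k)) * (bernoulli k * x ^ (n - k))"
        by (simp only:)
      moreover have "Suc n - k - 1 = n - k" using that by simp
      ultimately show ?thesis by (simp only: mult_ac)
    qed
    then have "(\<Sum>k\<le>n. real (Suc n choose k) * bernoulli k * (real (Suc n - k) * x ^ (Suc n - k - 1)))
      = (\<Sum>k\<le>n. real (Suc n) * (real (n choose k) * bernoulli k * x ^ (n - k)))"
      by (intro sum.cong refl) simp
    then show ?thesis
      unfolding sum.atMost_Suc by simp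
  qed
  also have "\<dots> = real (Suc n) * bernpoly n x"
    by (simp add: bernpoly_def sum_distrib_left)
  also have "(\<lambda>x. \<Sum>k\<le>Suc n. real (Suc n choose k) * bernoulli k * x ^ (Suc n - k)) = bernpoly (Suc n)"
    by (auto simp: bernpoly_def)
  finally show ?thesis .
qed

lemma bernpoly_reflect_deriv:
  "((\<lambda>x. bernpoly (Suc n) (1 - x)) has_real_derivative - (real (Suc n) * bernpoly n (1 - x))) (at x)"
proof -
  have "((\<lambda>x. 1 - x) has_real_derivative -1) (at x)"
    by (auto intro!: derivative_eq_intros)
  from DERIV_chain2[where f = "bernpoly (Suc n)" and g = "\<lambda>x. 1 - x", OF bernpoly_deriv this]
  show ?thesis by simp
qed

lemma bernpoly_1_eq_0: "n \<noteq> 1 \<Longrightarrow> bernpoly n 1 = bernpoly n 0"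
  using bernpoly_diff[of n 0] by (cases n; cases "n - 1") auto

lemma continuous_on_bernpoly [continuous_intros]:
  "continuous_on S f \<Longrightarrow> continuous_on S (\<lambda>x. bernpoly n (f x))"
  unfolding bernpoly_def by (intro continuous_intros)

lemma isCont_bernpoly: "isCont (bernpoly n) x"
  using continuous_on_bernpoly[OF continuous_on_id, of UNIV n]
  by (simp add: continuous_on_eq_continuous_at)

lemma borel_measurable_bernpoly [measurable]: "bernpoly n \<in> borel_measurable borel"
  unfolding bernpoly_def by measurable

text \<open>
  Two degrees at a time: \<open>q\<^sub>2\<^sub>n = 0\<close> makes \<open>q\<^sub>2\<^sub>n\<^sub>+\<^sub>1\<close> constant and \<open>q\<^sub>2\<^sub>n\<^sub>+\<^sub>2\<close> affine, and an affine
  function that vanishes at both ends of the unit interval is zero.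
\<close>

lemma bernpoly_even_reflect: "bernpoly (2 * n) (1 - x) = bernpoly (2 * n) x"
proof (induction n arbitrary: x)
  case 0
  then show ?case by simp
next
  case (Suc n)
  define q1 where "q1 x = bernpoly (2 * n + 1) (1 - x) + bernpoly (2 * n + 1) x" for x
  define q2 where "q2 x = bernpoly (2 * n + 2) (1 - x) - bernpoly (2 * n + 2) x" for x
  have d1: "(q1 has_real_derivative 0) (at x)" for x
    using DERIV_add[OF bernpoly_reflect_deriv[of "2 * n" x] bernpoly_deriv[of "2 * n" x]]
    by (simp add: q1_def[abs_def] Suc)
  then obtain c where c: "\<And>x. q1 x = c"
    using DERIV_isconst_all[of q1] by metis
  have d2: "(q2 has_real_derivative - (2 * n + 2) * c) (at x)" for x
  proof -
    have "(q2 has_real_derivative - (real (Suc (2 * n + 1)) * bernpoly (2 * n + 1) (1 - x)) - real (Suc (2 * n + 1)) * bernpoly (2 * n + 1) x) (at x)"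
      using DERIV_diff[OF bernpoly_reflect_deriv[of "2 * n + 1" x] bernpoly_deriv[of "2 * n + 1" x]]
      by (simp add: q2_def[abs_def])
    also have "- (real (Suc (2 * n + 1)) * bernpoly (2 * n + 1) (1 - x)) - real (Suc (2 * n + 1)) * bernpoly (2 * n + 1) x = - (2 * n + 2) * c"
      unfolding c[of x, symmetric] q1_def by (simp add: algebra_simps)
    finally show ?thesis .
  qed
  have "((\<lambda>x. q2 x + (2 * n + 2) * c * x) has_real_derivative 0) (at x)" for x
    by (auto intro!: derivative_eq_intros d2 simp: algebra_simps)
  then obtain e where e: "\<And>x. q2 x + (2 * n + 2) * c * x = e"
    using DERIV_isconst_all[of "\<lambda>x. q2 x + (2 * n + 2) * c * x"] by metis
  have "q2 0 = 0" "q2 1 = 0"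
    using bernpoly_1_eq_0[of "2 * n + 2"] by (auto simp: q2_def)
  then have "e = 0" "c = 0"
    using e[of 0] e[of 1] by auto
  then have "q2 x = 0" using e[of x] by simp
  then show ?case by (simp add: q2_def)
qed

text \<open>For \<open>t < 0\<close> reflection gives the value at \<open>t + 1\<close>, and the
  difference equation leads back to \<open>t\<close>. Writing the kink as a truncated power gives an
  antiderivative valid on both sides of \<open>0\<close>, which \<open>kern_quadrature\<close>
  needs.\<close>

lemma bernpoly_even_abs:
  "bernpoly (2 * a) \<bar>t\<bar> = bernpoly (2 * a) t + real (2 * a) * min t 0 ^ (2 * a - 1)"
proof (cases "t < 0")
  case True
  have "bernpoly (2 * a) (- t) = bernpoly (2 * a) (t + 1)"
    using bernpoly_even_reflect[of a "-t"] by (simp add: add.commute)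
  with True show ?thesis
    using bernpoly_diff[of "2 * a" t] by (simp add: min_def)
next
  case False
  then show ?thesis by (cases "a = 0") (auto simp: min_def)
qed

text \<open>The offset cancels in the difference and reflection turns
  \<open>1 - \<bar>d\<bar>\<close> into \<open>\<bar>d\<bar>\<close>. Hence the term lives on the
  cyclic group of residues modulo \<open>M\<close>, where summation by parts has no boundary
  terms.\<close>

lemma bernpoly_even_abs_mod:
  assumes "X < M" "Y < M"
  shows "bernpoly (2 * a) \<bar>(real X + \<tau>) / real M - (real Y + \<tau>) / real M\<bar>
     = bernpoly (2 * a) (real_of_int ((int X - int Y) mod int M) / real M)"
proof (cases "Y \<le> X")
  case True
  then have "(int X - int Y) mod int M = int X - int Y"
    using assms by (intro mod_pos_pos_trivial) auto
  moreover have "(real X + \<tau>) / real M - (real Y + \<tau>) / real M = (real X - real Y) / real M"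
    by (simp add: diff_divide_distrib[symmetric])
  ultimately show ?thesis using True by simp
next
  case False
  have "(int X - int Y + int M) mod int M = int X - int Y + int M"
    using assms False by (intro mod_pos_pos_trivial) auto
  then have "(int X - int Y) mod int M = int X - int Y + int M" by simp
  then have "real_of_int ((int X - int Y) mod int M) / real M = 1 - (real Y - real X) / real M"
    using assms by (simp add: field_simps)
  moreover have "\<bar>(real X + \<tau>) / real M - (real Y + \<tau>) / real M\<bar> = (real Y - real X) / real M"
    using False by (simp add: diff_divide_distrib[symmetric])
  ultimately show ?thesis by (simp add: bernpoly_even_reflect)
qed

text \<open>\<open>p \<ge> 1\<close> excludes the corner of \<open>min t 0\<close>; at
  \<open>0\<close> the difference quotient is bounded by \<open>\<bar>h\<bar> ^ p\<close>.\<close>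

lemma truncated_power_deriv:
  assumes "p \<ge> 1"
  shows "((\<lambda>t. min t 0 ^ Suc p) has_real_derivative real (Suc p) * min t 0 ^ p) (at (t::real))"
proof -
  consider "t < 0" | "t > 0" | "t = 0" by linarith
  then show ?thesis
  proof cases
    case 1
    have "((\<lambda>t. t ^ Suc p) has_real_derivative real (Suc p) * t ^ p) (at t)"
      using DERIV_pow[of "Suc p" t UNIV] by simp
    then have "((\<lambda>t. min t 0 ^ Suc p) has_real_derivative real (Suc p) * t ^ p) (at t)"
      by (rule has_field_derivative_transform_within_open[of _ _ _ "{..<0}"]) (use 1 in \<open>auto simp: min_def\<close>)
    with 1 show ?thesis by (simp add: min_def)
  next
    case 2
    have "((\<lambda>t. 0) has_real_derivative 0) (at t)" by simp
    then have "((\<lambda>t. min t 0 ^ Suc p) has_real_derivative 0) (at t)"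
      by (rule has_field_derivative_transform_within_open[of _ _ _ "{0<..}"]) (use 2 in \<open>auto simp: min_def\<close>)
    moreover have "real (Suc p) * min t 0 ^ p = 0"
      using 2 assms by (simp add: min_def)
    ultimately show ?thesis by (simp only:)
  next
    case 3
    have "((\<lambda>h. min h 0 ^ Suc p / h) \<longlongrightarrow> 0) (at (0::real))"
    proof (rule tendsto_0_le[where f = "\<lambda>h. h ^ p" and K = 1])
      have "((\<lambda>h. h ^ p) \<longlongrightarrow> 0 ^ p) (at (0::real))"
        by (intro tendsto_intros)
      then show "((\<lambda>h. h ^ p) \<longlongrightarrow> 0) (at (0::real))"
        using assms by simp
      have bound: "norm (min h 0 ^ Suc p / h) \<le> norm (h ^ p) * 1" for h :: real
        by (cases "h < 0") (auto simp: min_def)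
      show "\<forall>\<^sub>F h in at (0::real). norm (min h 0 ^ Suc p / h) \<le> norm (h ^ p) * 1"
        by (rule always_eventually, rule allI, rule bound)
    qed
    then have "((\<lambda>t. min t 0 ^ Suc p) has_real_derivative 0) (at t)"
      using 3 by (simp add: DERIV_def)
    moreover have "real (Suc p) * min t 0 ^ p = 0"
      using 3 assms by simp
    ultimately show ?thesis by (simp only:)
  qed
qed

section \<open>The one-dimensional kernel\<close>

definition kern :: "nat \<Rightarrow> real \<Rightarrow> real \<Rightarrow> real" where
  "kern \<alpha> x y = (\<Sum>r=1..\<alpha>. bernpoly r x * bernpoly r y / (fact r)\<^sup>2)
     + (-1) ^ (\<alpha> + 1) * bernpoly (2 * \<alpha>) \<bar>x - y\<bar> / fact (2 * \<alpha>)"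

lemma sobolev_kernel_eq:
  "sobolev_kernel \<alpha> s \<gamma> x y = (\<Sum>u\<in>Pow {1..s}. \<gamma> u * (\<Prod>j\<in>u. kern \<alpha> (x j) (y j)))"
  by (simp add: sobolev_kernel_def kern_def)

lemma kern_commute: "kern \<alpha> x y = kern \<alpha> y x"
  by (simp add: kern_def abs_minus_commute mult.commute)

lemma borel_measurable_kern [measurable]:
  assumes [measurable]: "f \<in> borel_measurable N" "g \<in> borel_measurable N"
  shows "(\<lambda>x. kern \<alpha> (f x) (g x)) \<in> borel_measurable N"
  unfolding kern_def by measurable

lemma tendsto_bernpoly:
  "(f \<longlongrightarrow> l) F \<Longrightarrow> ((\<lambda>x. bernpoly n (f x)) \<longlongrightarrow> bernpoly n l) F"
  using isCont_tendsto_compose[OF isCont_bernpoly] .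

lemma tendsto_kern:
  assumes "(f \<longlongrightarrow> l) F" "(g \<longlongrightarrow> l') F"
  shows "((\<lambda>x. kern \<alpha> (f x) (g x)) \<longlongrightarrow> kern \<alpha> l l') F"
  unfolding kern_def using assms
  by (intro tendsto_add tendsto_sum tendsto_mult tendsto_divide tendsto_bernpoly tendsto_rabs tendsto_diff tendsto_const) auto

lemma bernpoly_bounded: "\<exists>C>0. \<forall>x\<in>{0..1}. \<bar>bernpoly n x\<bar> \<le> C"
proof -
  have "compact (bernpoly n ` {0..1})"
    by (intro compact_continuous_image continuous_on_bernpoly continuous_on_id compact_Icc)
  then have "bounded (bernpoly n ` {0..1})" by (rule compact_imp_bounded)
  then show ?thesis unfolding bounded_pos by auto
qed

lemma bernpoly_lipschitz:
  "\<exists>C>0. \<forall>x\<in>{0..1}. \<forall>y\<in>{0..1}. \<bar>bernpoly n x - bernpoly n y\<bar> \<le> C * \<bar>x - y\<bar>"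
proof (cases n)
  case 0
  then show ?thesis by (intro exI[of _ 1]) auto
next
  case (Suc p)
  obtain C where C: "C > 0" "\<And>x. x \<in> {0..1} \<Longrightarrow> \<bar>bernpoly p x\<bar> \<le> C"
    using bernpoly_bounded by metis
  have "\<bar>bernpoly n x - bernpoly n y\<bar> \<le> real n * C * \<bar>x - y\<bar>" if "x \<in> {0..1}" "y \<in> {0..1}" for x y
  proof -
    have "norm (bernpoly n x - bernpoly n y) \<le> real n * C * norm (x - y)"
    proof (rule field_differentiable_bound[where S = "{0..1}" and f' = "\<lambda>x. real n * bernpoly p x"])
      show "(bernpoly n has_real_derivative real n * bernpoly p z) (at z within {0..1})" for z
        using bernpoly_deriv[of p z] by (simp add: Suc has_field_derivative_at_within del: of_nat_Suc)
      show "norm (real n * bernpoly p z) \<le> real n * C" if "z \<in> {0..1}" for z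
        using C that by (simp add: abs_mult mult_left_mono)
    qed (use that in auto)
    then show ?thesis by simp
  qed
  moreover have "real n * C > 0" using C Suc by simp
  ultimately show ?thesis by blast
qed

lemma kern_bounded: "\<exists>C>0. \<forall>x\<in>{0..1}. \<forall>y\<in>{0..1}. \<bar>kern \<alpha> x y\<bar> \<le> C"
proof -
  obtain C where C: "\<And>n. C n > 0" "\<And>n x. x \<in> {0..1} \<Longrightarrow> \<bar>bernpoly n x\<bar> \<le> C n"
    using bernpoly_bounded by metis
  define B where "B = (\<Sum>r=1..\<alpha>. C r * C r / (fact r)\<^sup>2) + C (2 * \<alpha>) / fact (2 * \<alpha>)"
  have "\<bar>kern \<alpha> x y\<bar> \<le> B" if x: "x \<in> {0..1}" and y: "y \<in> {0..1}" for x y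
  proof -
    have "\<bar>kern \<alpha> x y\<bar> \<le> \<bar>\<Sum>r=1..\<alpha>. bernpoly r x * bernpoly r y / (fact r)\<^sup>2\<bar>
       + \<bar>(-1) ^ (\<alpha> + 1) * bernpoly (2 * \<alpha>) \<bar>x - y\<bar> / fact (2 * \<alpha>)\<bar>"
      unfolding kern_def by (rule abs_triangle_ineq)
    also have "\<bar>\<Sum>r=1..\<alpha>. bernpoly r x * bernpoly r y / (fact r)\<^sup>2\<bar> \<le> (\<Sum>r=1..\<alpha>. C r * C r / (fact r)\<^sup>2)"
      by (rule order_trans[OF sum_abs sum_mono])
        (auto simp: abs_mult intro!: divide_right_mono mult_mono C(2) x y order_less_imp_le[OF C(1)])
    also have "\<bar>(-1) ^ (\<alpha> + 1) * bernpoly (2 * \<alpha>) \<bar>x - y\<bar> / fact (2 * \<alpha>)\<bar> \<le> C (2 * \<alpha>) / fact (2 * \<alpha>)"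
      using C(2)[of "\<bar>x - y\<bar>" "2 * \<alpha>"] x y by (auto simp: abs_mult intro!: divide_right_mono)
    finally show ?thesis unfolding B_def by simp
  qed
  moreover have "B > 0" unfolding B_def
    by (intro add_nonneg_pos sum_nonneg divide_pos_pos) (auto intro!: divide_nonneg_pos mult_nonneg_nonneg order_less_imp_le[OF C(1)] C(1))
  ultimately show ?thesis by blast
qed

lemma kern_lipschitz:
  "\<exists>C>0. \<forall>x\<in>{0..1}. \<forall>y\<in>{0..1}. \<forall>z\<in>{0..1}. \<bar>kern \<alpha> x y - kern \<alpha> x z\<bar> \<le> C * \<bar>y - z\<bar>"
proof -
  obtain C where C: "\<And>n. C n > 0" "\<And>n x. x \<in> {0..1} \<Longrightarrow> \<bar>bernpoly n x\<bar> \<le> C n"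
    using bernpoly_bounded by metis
  obtain L where L: "\<And>n. L n > 0"
    "\<And>n x y. x \<in> {0..1} \<Longrightarrow> y \<in> {0..1} \<Longrightarrow> \<bar>bernpoly n x - bernpoly n y\<bar> \<le> L n * \<bar>x - y\<bar>"
    using bernpoly_lipschitz by metis
  define B where "B = (\<Sum>r=1..\<alpha>. C r * L r / (fact r)\<^sup>2) + L (2 * \<alpha>) / fact (2 * \<alpha>)"
  have "\<bar>kern \<alpha> x y - kern \<alpha> x z\<bar> \<le> B * \<bar>y - z\<bar>"
    if x: "x \<in> {0..1}" and y: "y \<in> {0..1}" and z: "z \<in> {0..1}" for x y z
  proof -
    have "kern \<alpha> x y - kern \<alpha> x z = (\<Sum>r=1..\<alpha>. bernpoly r x * (bernpoly r y - bernpoly r z) / (fact r)\<^sup>2)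
       + (-1) ^ (\<alpha> + 1) * (bernpoly (2 * \<alpha>) \<bar>x - y\<bar> - bernpoly (2 * \<alpha>) \<bar>x - z\<bar>) / fact (2 * \<alpha>)"
      unfolding kern_def by (simp add: sum_subtractf algebra_simps diff_divide_distrib)
    also have "\<bar>\<dots>\<bar> \<le> \<bar>\<Sum>r=1..\<alpha>. bernpoly r x * (bernpoly r y - bernpoly r z) / (fact r)\<^sup>2\<bar>
       + \<bar>(-1) ^ (\<alpha> + 1) * (bernpoly (2 * \<alpha>) \<bar>x - y\<bar> - bernpoly (2 * \<alpha>) \<bar>x - z\<bar>) / fact (2 * \<alpha>)\<bar>"
      by (rule abs_triangle_ineq)
    also have "\<bar>\<Sum>r=1..\<alpha>. bernpoly r x * (bernpoly r y - bernpoly r z) / (fact r)\<^sup>2\<bar>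
       \<le> (\<Sum>r=1..\<alpha>. C r * (L r * \<bar>y - z\<bar>) / (fact r)\<^sup>2)"
      by (rule order_trans[OF sum_abs sum_mono])
        (auto simp: abs_mult intro!: divide_right_mono mult_mono C(2) L(2) x y z order_less_imp_le[OF C(1)])
    also have "\<bar>(-1) ^ (\<alpha> + 1) * (bernpoly (2 * \<alpha>) \<bar>x - y\<bar> - bernpoly (2 * \<alpha>) \<bar>x - z\<bar>) / fact (2 * \<alpha>)\<bar>
       \<le> L (2 * \<alpha>) * \<bar>y - z\<bar> / fact (2 * \<alpha>)"
    proof -
      have "\<bar>bernpoly (2 * \<alpha>) \<bar>x - y\<bar> - bernpoly (2 * \<alpha>) \<bar>x - z\<bar>\<bar> \<le> L (2 * \<alpha>) * \<bar>\<bar>x - y\<bar> - \<bar>x - z\<bar>\<bar>"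
        by (rule L(2)) (use x y z in auto)
      also have "\<dots> \<le> L (2 * \<alpha>) * \<bar>y - z\<bar>"
        by (intro mult_left_mono order_less_imp_le[OF L(1)]) linarith
      finally show ?thesis by (auto simp: abs_mult intro!: divide_right_mono)
    qed
    finally show ?thesis
      unfolding B_def by (simp add: sum_distrib_right distrib_right mult.assoc)
  qed
  moreover have "B > 0" unfolding B_def
    by (intro add_nonneg_pos sum_nonneg divide_pos_pos)
      (auto intro!: divide_nonneg_pos mult_nonneg_nonneg order_less_imp_le[OF C(1)] order_less_imp_le[OF L(1)] L(1))
  ultimately show ?thesis by blast
qed

text \<open>On each cell the mean value theorem replaces the increment of \<open>F\<close> by a
  value of \<open>f\<close> at distance at most \<open>1 / M\<close> from the node, and the
  increments telescope to \<open>F 1 - F 0 = 0\<close>. First order accuracy is enough: it is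
  applied with \<open>M = b ^ n\<close>, where \<open>1 / M\<close> is already within the final
  bound, or with \<open>M\<close> tending to infinity.\<close>

lemma quadrature_lipschitz:
  fixes F f :: "real \<Rightarrow> real"
  assumes deriv: "\<And>y. y \<in> {0..1} \<Longrightarrow> (F has_real_derivative f y) (at y)"
    and lip: "\<And>y z. y \<in> {0..1} \<Longrightarrow> z \<in> {0..1} \<Longrightarrow> \<bar>f y - f z\<bar> \<le> C * \<bar>y - z\<bar>"
    and ends: "F 1 = F 0" and C: "C \<ge> 0"
    and M: "M > 0" and \<theta>: "\<theta> \<in> {0..1}"
  shows "\<bar>(\<Sum>y<M. f ((real y + \<theta>) / real M)) / real M\<bar> \<le> C / real M"
proof -
  have cell: "\<bar>f ((real y + \<theta>) / real M) / real M - (F (real (Suc y) / real M) - F (real y / real M))\<bar> \<le> C / real M / real M"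
    if "y < M" for y
  proof -
    have in01: "(real y + x) / real M \<in> {0..1}" if "x \<in> {0..1}" for x
      using \<open>y < M\<close> that by (auto simp: divide_le_eq)
    have "\<exists>z. z > real y / real M \<and> z < real (Suc y) / real M \<and>
       F (real (Suc y) / real M) - F (real y / real M) = (real (Suc y) / real M - real y / real M) * f z"
    proof (rule MVT2)
      show "real y / real M < real (Suc y) / real M" using M by (simp add: divide_strict_right_mono)
      fix x assume "real y / real M \<le> x" "x \<le> real (Suc y) / real M"
      moreover from calculation have "0 \<le> x" by (meson divide_nonneg_nonneg of_nat_0_le_iff order_trans)
      moreover have "real (Suc y) / real M \<le> 1" using \<open>y < M\<close> by (simp add: divide_le_eq)
      ultimately show "(F has_real_derivative f x) (at x)" by (intro deriv) auto
    qed
    then obtain z where z: "z > real y / real M" "z < real (Suc y) / real M"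
      "F (real (Suc y) / real M) - F (real y / real M) = f z / real M"
      by (auto simp: diff_divide_distrib[symmetric])
    have "\<bar>f ((real y + \<theta>) / real M) - f z\<bar> \<le> C * \<bar>(real y + \<theta>) / real M - z\<bar>"
    proof (rule lip)
      have "0 \<le> real y / real M" by simp
      with z(1) have "0 \<le> z" by linarith
      then show "z \<in> {0..1}" using z(2) in01[of 1] by (auto simp: add.commute)
    qed (use in01 \<theta> in auto)
    also have "\<dots> \<le> C * (1 / real M)"
    proof (intro mult_left_mono C)
      have "(real y + \<theta>) / real M \<le> (real y + 1) / real M" "real y / real M \<le> (real y + \<theta>) / real M"
        using \<theta> by (auto intro!: divide_right_mono)
      moreover have "(real y + 1) / real M = real y / real M + 1 / real M"
        by (simp add: add_divide_distrib)
      ultimately show "\<bar>(real y + \<theta>) / real M - z\<bar> \<le> 1 / real M"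
        using z(1,2) by (simp add: abs_le_iff algebra_simps)
    qed
    finally have "\<bar>f ((real y + \<theta>) / real M) - f z\<bar> / real M \<le> C * (1 / real M) / real M"
      by (intro divide_right_mono) auto
    then show ?thesis using z(3) M by (simp add: diff_divide_distrib[symmetric] del: of_nat_Suc)
  qed
  have "(\<Sum>y<M. F (real (Suc y) / real M) - F (real y / real M)) = 0"
    using M ends by (subst sum_lessThan_telescope) auto
  then have "\<bar>(\<Sum>y<M. f ((real y + \<theta>) / real M)) / real M\<bar> =
     \<bar>\<Sum>y<M. (f ((real y + \<theta>) / real M) / real M - (F (real (Suc y) / real M) - F (real y / real M)))\<bar>"
    by (simp add: sum_subtractf sum_divide_distrib del: of_nat_Suc)
  also have "\<dots> \<le> (\<Sum>y<M. C / real M / real M)"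
    by (rule order_trans[OF sum_abs sum_mono]) (use cell in auto)
  also have "\<dots> = C / real M" using M by simp
  finally show ?thesis .
qed

text \<open>Bernoulli polynomials of positive degree have mean zero, so
  \<open>kern \<alpha> x\<close> integrates to zero over its second argument and the rectangle rule
  returns only its own error. The offset \<open>\<theta>\<close> covers shifted grids.\<close>

lemma kern_quadrature:
  assumes \<alpha>: "\<alpha> \<ge> 1"
  shows "\<exists>C>0. \<forall>M>0. \<forall>\<theta>\<in>{0..1}. \<forall>x\<in>{0..1}.
     \<bar>(\<Sum>y<M. kern \<alpha> x ((real y + \<theta>) / real M)) / real M\<bar> \<le> C / real M"
proof -
  obtain C where C: "C > 0"
    "\<And>x y z. x \<in> {0..1} \<Longrightarrow> y \<in> {0..1} \<Longrightarrow> z \<in> {0..1} \<Longrightarrow> \<bar>kern \<alpha> x y - kern \<alpha> x z\<bar> \<le> C * \<bar>y - z\<bar>"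
    using kern_lipschitz by metis
  have "\<bar>(\<Sum>y<M. kern \<alpha> x ((real y + \<theta>) / real M)) / real M\<bar> \<le> C / real M"
    if M: "M > 0" and \<theta>: "\<theta> \<in> {0..1}" and x: "x \<in> {0..1}" for M \<theta> x
  proof -
    \<comment> \<open>A termwise antiderivative of \<open>kern \<alpha> x\<close>; the truncated
      power accounts for the absolute value, by \<open>bernpoly_even_abs\<close>.\<close>
    define F where "F y = (\<Sum>r=1..\<alpha>. bernpoly r x * (bernpoly (Suc r) y / real (Suc r)) / (fact r)\<^sup>2)
       + (-1) ^ (\<alpha> + 1) * (bernpoly (Suc (2 * \<alpha>)) (y - x) / real (Suc (2 * \<alpha>)) + min (y - x) 0 ^ (2 * \<alpha>)) / fact (2 * \<alpha>)" for y
    have dB: "((\<lambda>y. bernpoly (Suc r) y / real (Suc r)) has_real_derivative bernpoly r y) (at y)" for r y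
      using DERIV_cdivide[OF bernpoly_deriv[of r y], of "real (Suc r)"] by (simp del: of_nat_Suc)
    have dB': "((\<lambda>y. bernpoly (Suc r) (y - x) / real (Suc r)) has_real_derivative bernpoly r (y - x)) (at y)" for r y
    proof -
      have "((\<lambda>y. y - x) has_real_derivative 1) (at y)"
        by (auto intro!: derivative_eq_intros)
      from DERIV_chain2[where f = "\<lambda>y. bernpoly (Suc r) y / real (Suc r)", OF dB this]
      show ?thesis by simp
    qed
    have dT: "((\<lambda>y. min (y - x) 0 ^ (2 * \<alpha>)) has_real_derivative real (2 * \<alpha>) * min (y - x) 0 ^ (2 * \<alpha> - 1)) (at y)" for y
    proof -
      have "((\<lambda>t. min t 0 ^ Suc (2 * \<alpha> - 1)) has_real_derivative real (Suc (2 * \<alpha> - 1)) * min (y - x) 0 ^ (2 * \<alpha> - 1)) (at (y - x))"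
        by (rule truncated_power_deriv) (use \<alpha> in simp)
      then have "((\<lambda>t. min t 0 ^ (2 * \<alpha>)) has_real_derivative real (2 * \<alpha>) * min (y - x) 0 ^ (2 * \<alpha> - 1)) (at (y - x))"
        using \<alpha> by (simp del: of_nat_Suc power_Suc add: Suc_diff_le)
      moreover have "((\<lambda>y. y - x) has_real_derivative 1) (at y)"
        by (auto intro!: derivative_eq_intros)
      ultimately have "((\<lambda>y. min (y - x) 0 ^ (2 * \<alpha>)) has_real_derivative real (2 * \<alpha>) * min (y - x) 0 ^ (2 * \<alpha> - 1) * 1) (at y)"
        by (rule DERIV_chain2[where f = "\<lambda>t. min t 0 ^ (2 * \<alpha>)"])
      then show ?thesis by simp
    qed
    have dF: "(F has_real_derivative kern \<alpha> x y) (at y)" for y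
    proof -
      have "(F has_real_derivative (\<Sum>r=1..\<alpha>. bernpoly r x * bernpoly r y / (fact r)\<^sup>2)
       + (-1) ^ (\<alpha> + 1) * (bernpoly (2 * \<alpha>) (y - x) + real (2 * \<alpha>) * min (y - x) 0 ^ (2 * \<alpha> - 1)) / fact (2 * \<alpha>)) (at y)"
        unfolding F_def
        by (intro DERIV_add DERIV_sum DERIV_cdivide DERIV_cmult dB dB' dT)
      then show ?thesis
        by (simp add: kern_def abs_minus_commute[of x] bernpoly_even_abs)
    qed
    have "bernpoly (Suc r) 1 = bernpoly (Suc r) 0" if "r \<in> {1..\<alpha>}" for r
      using that by (intro bernpoly_1_eq_0) auto
    \<comment> \<open>Between \<open>y = 0\<close> and \<open>y = 1\<close> the polynomial term
      grows by \<open>(- x) ^ (2 * \<alpha>)\<close>, by the difference equation, and the truncated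
      power loses exactly that.\<close>
    moreover have "bernpoly (Suc (2 * \<alpha>)) (1 - x) / real (Suc (2 * \<alpha>)) + min (1 - x) 0 ^ (2 * \<alpha>)
       = bernpoly (Suc (2 * \<alpha>)) (0 - x) / real (Suc (2 * \<alpha>)) + min (0 - x) 0 ^ (2 * \<alpha>)"
    proof -
      have "bernpoly (Suc (2 * \<alpha>)) (1 - x) = bernpoly (Suc (2 * \<alpha>)) (0 - x) + real (Suc (2 * \<alpha>)) * (- x) ^ (2 * \<alpha>)"
        using bernpoly_diff[of "Suc (2 * \<alpha>)" "- x"] by (simp add: algebra_simps)
      then show ?thesis using x \<alpha> by (simp add: field_simps del: of_nat_Suc)
    qed
    ultimately have ends: "F 1 = F 0" by (simp add: F_def)
    show ?thesis
      by (rule quadrature_lipschitz[OF dF _ ends]) (use C M \<theta> x in auto)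
  qed
  with C(1) show ?thesis by blast
qed

section \<open>Finite differences\<close>

definition fdiff :: "(int \<Rightarrow> 'a::ab_group_add) \<Rightarrow> int \<Rightarrow> 'a" where
  "fdiff f x = f (x + 1) - f x"

lemma fdiff_pow_Suc: "(fdiff ^^ Suc r) f x = (fdiff ^^ r) f (x + 1) - (fdiff ^^ r) f x"
  unfolding funpow.simps o_apply by (rule fdiff_def)

lemma fdiff_pow_linear:
  fixes f g :: "int \<Rightarrow> 'a::comm_ring"
  shows "(fdiff ^^ r) (\<lambda>x. f x + c * g x) = (\<lambda>x. (fdiff ^^ r) f x + c * (fdiff ^^ r) g x)"
  by (induction r) (auto simp: fdiff_def algebra_simps)

lemma fdiff_pow_zero: "(fdiff ^^ r) (\<lambda>x. 0) = (\<lambda>x. 0)"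
  by (induction r) (auto simp: fdiff_def)

lemma fdiff_pow_sum:
  fixes f :: "'i \<Rightarrow> int \<Rightarrow> 'a::comm_ring"
  assumes "finite I"
  shows "(fdiff ^^ r) (\<lambda>x. \<Sum>i\<in>I. c i * f i x) = (\<lambda>x. \<Sum>i\<in>I. c i * (fdiff ^^ r) (f i) x)"
  using assms
proof (induction I)
  case empty
  then show ?case by (simp add: fdiff_pow_zero)
next
  case (insert i I)
  have "(fdiff ^^ r) (\<lambda>x. \<Sum>i\<in>insert i I. c i * f i x) = (fdiff ^^ r) (\<lambda>x. (\<Sum>i\<in>I. c i * f i x) + c i * f i x)"
    using insert by (simp add: add.commute[of "c i * f i _" for i])
  also have "\<dots> = (\<lambda>x. \<Sum>i\<in>insert i I. c i * (fdiff ^^ r) (f i) x)"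
    using insert by (subst fdiff_pow_linear) (simp add: add.commute)
  finally show ?case .
qed

lemma fdiff_pow_shift: "(fdiff ^^ r) (\<lambda>x. f (x + c)) = (\<lambda>x. (fdiff ^^ r) f (x + c))"
  by (induction r) (auto simp: fdiff_def algebra_simps)

lemma fdiff_pow_cong:
  "(\<And>e. d \<le> e \<Longrightarrow> e \<le> d + int r \<Longrightarrow> f e = g e) \<Longrightarrow> (fdiff ^^ r) f d = (fdiff ^^ r) g d"
proof (induction r arbitrary: d)
  case (Suc r)
  have "(fdiff ^^ r) f d = (fdiff ^^ r) g d" "(fdiff ^^ r) f (d + 1) = (fdiff ^^ r) g (d + 1)"
    using Suc by auto
  then show ?case by (simp only: fdiff_pow_Suc)
qed simp

lemma fdiff_pow_bound:
  fixes f :: "int \<Rightarrow> real"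
  shows "(\<And>e. d \<le> e \<Longrightarrow> e \<le> d + int r \<Longrightarrow> \<bar>f e\<bar> \<le> B) \<Longrightarrow> \<bar>(fdiff ^^ r) f d\<bar> \<le> 2 ^ r * B"
proof (induction r arbitrary: d)
  case (Suc r)
  have "\<bar>(fdiff ^^ r) f d\<bar> \<le> 2 ^ r * B" "\<bar>(fdiff ^^ r) f (d + 1)\<bar> \<le> 2 ^ r * B"
    using Suc by auto
  then show ?case unfolding fdiff_pow_Suc by (simp add: abs_le_iff)
qed simp

text \<open>Both cases go through one induction, because a single difference of \<open>x ^ k\<close>
  involves all lower powers. Of these only the top one, \<open>k * x ^ (k - 1)\<close>, survives
  when \<open>k\<close> equals the order.\<close>

lemma fdiff_pow_monomial:
  "(k < r \<longrightarrow> (fdiff ^^ r) (\<lambda>x. real_of_int x ^ k) = (\<lambda>x. 0)) \<and>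
   (k = r \<longrightarrow> (fdiff ^^ r) (\<lambda>x. real_of_int x ^ k) = (\<lambda>x. fact r))"
proof (induction r arbitrary: k)
  case 0
  then show ?case by auto
next
  case (Suc r)
  have "fdiff (\<lambda>x. real_of_int x ^ k) = (\<lambda>x. \<Sum>i<k. real (k choose i) * real_of_int x ^ i)"
    by (simp add: fdiff_def fun_eq_iff binomial_ring lessThan_Suc_atMost[symmetric])
  then have eq: "(fdiff ^^ Suc r) (\<lambda>x. real_of_int x ^ k)
      = (\<lambda>x. \<Sum>i<k. real (k choose i) * (fdiff ^^ r) (\<lambda>x. real_of_int x ^ i) x)"
    by (simp only: funpow_Suc_right o_apply) (simp add: fdiff_pow_sum)
  show ?case
  proof (intro conjI impI)
    assume "k < Suc r"
    then have "(fdiff ^^ r) (\<lambda>x. real_of_int x ^ i) = (\<lambda>x. 0)" if "i < k" for i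
      using Suc[of i] that by auto
    then show "(fdiff ^^ Suc r) (\<lambda>x. real_of_int x ^ k) = (\<lambda>x. 0)"
      unfolding eq by auto
  next
    assume k: "k = Suc r"
    have "(fdiff ^^ r) (\<lambda>x. real_of_int x ^ i) = (\<lambda>x. 0)" if "i < r" for i
      using Suc[of i] that by auto
    moreover have "(fdiff ^^ r) (\<lambda>x. real_of_int x ^ r) = (\<lambda>x. fact r)"
      using Suc[of r] by auto
    ultimately show "(fdiff ^^ Suc r) (\<lambda>x. real_of_int x ^ k) = (\<lambda>x. fact (Suc r))"
      unfolding eq unfolding k by (simp add: lessThan_Suc)
  qed
qed

lemma sum_periodic_shift:
  fixes f :: "int \<Rightarrow> 'a::comm_monoid_add"
  assumes "M > 0" and per: "\<And>x. f (x + M) = f x"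
  shows "(\<Sum>x\<in>{0..<M}. f (x + c)) = (\<Sum>x\<in>{0..<M}. f x)"
proof -
  have per_nat: "f (x + int k * M) = f x" for x k
  proof (induction k)
    case (Suc k)
    have "f (x + int (Suc k) * M) = f ((x + int k * M) + M)" by (simp add: algebra_simps)
    then show ?case using per Suc by simp
  qed simp
  have per_int: "f (x + k * M) = f x" for x k
  proof (cases "k \<ge> 0")
    case True
    then show ?thesis using per_nat[of x "nat k"] by simp
  next
    case False
    then show ?thesis using per_nat[of "x + k * M" "nat (- k)"] by simp
  qed
  have mod: "f (x mod M) = f x" for x
    using per_int[of "x mod M" "x div M"] by (simp add: algebra_simps)
  have "bij_betw (\<lambda>x. (x + c) mod M) {0..<M} {0..<M}"
  proof (rule bij_betw_byWitness[where f' = "\<lambda>x. (x - c) mod M"])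
  qed (use assms in \<open>auto simp: mod_simps\<close>)
  from sum.reindex_bij_betw[OF this, of f] show ?thesis
    by (simp add: mod)
qed

lemma sum_int_lessThan:
  fixes f :: "int \<Rightarrow> 'a::comm_monoid_add"
  shows "(\<Sum>x\<in>{0..<int M}. f x) = (\<Sum>X<M. f (int X))"
  by (rule sum.reindex_bij_witness[of _ int nat]) auto

lemma fdiff_pow_periodic:
  assumes "\<And>x. f (x + M) = f x"
  shows "(fdiff ^^ r) f (x + M) = (fdiff ^^ r) f x"
proof -
  have "(\<lambda>x. f (x + M)) = f" using assms by auto
  with fdiff_pow_shift[of r f M] show ?thesis by metis
qed

text \<open>Each induction step moves one difference off \<open>u\<close> and one off
  \<open>v\<close>, both onto \<open>G\<close>; periodicity removes the boundary terms. At the end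
  \<open>u\<close> and \<open>v\<close> enter only through their suprema. In the application they
  are antiderivatives of the conjugate of a character and of the character itself.\<close>

lemma summation_by_parts:
  fixes u v :: "int \<Rightarrow> complex" and G :: "int \<Rightarrow> real"
  assumes M: "M > 0"
    and per: "\<And>x. u (x + M) = u x" "\<And>x. v (x + M) = v x" "\<And>x. G (x + M) = G x"
    and bound: "\<And>x. norm (u x) \<le> U" "\<And>x. norm (v x) \<le> V"
  shows "norm (\<Sum>x\<in>{0..<M}. \<Sum>y\<in>{0..<M}. of_real (G (x - y)) * (fdiff ^^ a) u x * (fdiff ^^ a) v y)
     \<le> U * V * of_int M * (\<Sum>d\<in>{0..<M}. \<bar>(fdiff ^^ (2 * a)) G d\<bar>)"
  using per(3)
proof (induction a arbitrary: G)
  case 0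
  have UV: "U \<ge> 0" "V \<ge> 0"
    using bound order_trans[OF norm_ge_zero] by blast+
  have "norm (\<Sum>x\<in>{0..<M}. \<Sum>y\<in>{0..<M}. of_real (G (x - y)) * u x * v y)
      \<le> (\<Sum>x\<in>{0..<M}. \<Sum>y\<in>{0..<M}. \<bar>G (x - y)\<bar> * U * V)"
    by (intro sum_norm_le) (auto simp: norm_mult intro!: mult_mono mult_nonneg_nonneg bound UV)
  also have "\<dots> = (\<Sum>y\<in>{0..<M}. U * V * (\<Sum>x\<in>{0..<M}. \<bar>G (x + (- y))\<bar>))"
    by (subst sum.swap) (simp add: sum_distrib_left mult_ac)
  also have "\<dots> = U * V * of_int M * (\<Sum>d\<in>{0..<M}. \<bar>G d\<bar>)"
    using M 0 by (subst sum_periodic_shift) auto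
  finally show ?case by simp
next
  case (Suc a)
  define u' where "u' = (fdiff ^^ a) u"
  define v' where "v' = (fdiff ^^ a) v"
  \<comment> \<open>A centred second difference: \<open>x\<close> and \<open>y\<close> enter
    \<open>G (x - y)\<close> with opposite signs, so one of them produces a backward and the other a
    forward difference. The shift by \<open>1\<close> disappears again in the sum over a full
    period.\<close>
  define G' where "G' d = fdiff (fdiff G) (d - 1)" for d
  have per': "u' (x + M) = u' x" "v' (x + M) = v' x" for x
    unfolding u'_def v'_def using fdiff_pow_periodic[of u M] fdiff_pow_periodic[of v M] per by simp_all
  have G'_per: "G' (x + M) = G' x" for x
    using Suc.prems[of "x + 1"] Suc.prems[of x] Suc.prems[of "x - 1"]
    by (simp add: G'_def fdiff_def algebra_simps)
  have xstep: "(\<Sum>x\<in>{0..<M}. of_real (H (x - y)) * fdiff u' x)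
      = (\<Sum>x\<in>{0..<M}. - of_real (H (x - y) - H (x - y - 1)) * u' x)"
    if "\<And>x. H (x + M) = H x" for H :: "int \<Rightarrow> real" and y
  proof -
    have "H (x + M - y - 1) = H (x - y - 1)" for x
      using that[of "x - y - 1"] by (simp add: algebra_simps)
    then have "(\<Sum>x\<in>{0..<M}. of_real (H ((x + 1) - y - 1)) * u' (x + 1)) =
       (\<Sum>x\<in>{0..<M}. of_real (H (x - y - 1)) * u' x)"
      using M per' by (intro sum_periodic_shift[where f = "\<lambda>x. of_real (H (x - y - 1)) * u' x"]) auto
    then show ?thesis
      by (simp add: fdiff_def algebra_simps sum_subtractf sum.distrib sum_negf)
  qed
  have ystep: "(\<Sum>y\<in>{0..<M}. of_real (H (x - y)) * fdiff v' y)
      = (\<Sum>y\<in>{0..<M}. of_real (H (x - y + 1) - H (x - y)) * v' y)"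
    if "\<And>x. H (x + M) = H x" for H :: "int \<Rightarrow> real" and x
  proof -
    have "H (x - (y + M) + 1) = H (x - y + 1)" for y
      using that[of "x - (y + M) + 1"] by (simp add: algebra_simps)
    then have "(\<Sum>y\<in>{0..<M}. of_real (H (x - (y + 1) + 1)) * v' (y + 1)) =
       (\<Sum>y\<in>{0..<M}. of_real (H (x - y + 1)) * v' y)"
      using M per' by (intro sum_periodic_shift[where f = "\<lambda>y. of_real (H (x - y + 1)) * v' y"]) auto
    then show ?thesis
      by (simp add: fdiff_def algebra_simps sum_subtractf sum.distrib sum_negf)
  qed
  have "(\<Sum>x\<in>{0..<M}. \<Sum>y\<in>{0..<M}. of_real (G (x - y)) * fdiff u' x * fdiff v' y)
      = (\<Sum>x\<in>{0..<M}. (\<Sum>y\<in>{0..<M}. of_real (fdiff G (x - y)) * v' y) * fdiff u' x)"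
  proof (rule sum.cong[OF refl])
    fix x
    have "(\<Sum>y\<in>{0..<M}. of_real (G (x - y)) * fdiff u' x * fdiff v' y)
       = (\<Sum>y\<in>{0..<M}. of_real (G (x - y)) * fdiff v' y) * fdiff u' x"
      by (simp add: sum_distrib_right sum_distrib_left mult_ac)
    then show "(\<Sum>y\<in>{0..<M}. of_real (G (x - y)) * fdiff u' x * fdiff v' y)
       = (\<Sum>y\<in>{0..<M}. of_real (fdiff G (x - y)) * v' y) * fdiff u' x"
      by (simp only: ystep[of G, OF Suc.prems] fdiff_def[of G])
  qed
  also have "\<dots> = (\<Sum>y\<in>{0..<M}. (\<Sum>x\<in>{0..<M}. of_real (fdiff G (x - y)) * fdiff u' x) * v' y)"
    unfolding sum_distrib_right by (subst sum.swap) (simp add: mult_ac)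
  also have "\<dots> = (\<Sum>y\<in>{0..<M}. (\<Sum>x\<in>{0..<M}. - of_real (G' (x - y)) * u' x) * v' y)"
  proof -
    have "fdiff G (x + M) = fdiff G x" for x
      using fdiff_pow_periodic[of G M 1] Suc.prems by simp
    then show ?thesis
      by (subst xstep) (auto simp: G'_def fdiff_def algebra_simps)
  qed
  also have "\<dots> = - (\<Sum>x\<in>{0..<M}. \<Sum>y\<in>{0..<M}. of_real (G' (x - y)) * u' x * v' y)"
    unfolding sum_distrib_right by (subst sum.swap) (simp add: sum_negf)
  finally have "norm (\<Sum>x\<in>{0..<M}. \<Sum>y\<in>{0..<M}. of_real (G (x - y)) * fdiff u' x * fdiff v' y)
      = norm (\<Sum>x\<in>{0..<M}. \<Sum>y\<in>{0..<M}. of_real (G' (x - y)) * u' x * v' y)"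
    by simp
  also have "\<dots> \<le> U * V * of_int M * (\<Sum>d\<in>{0..<M}. \<bar>(fdiff ^^ (2 * a)) G' d\<bar>)"
    unfolding u'_def v'_def by (rule Suc.IH[of G', OF G'_per])
  also have "(\<Sum>d\<in>{0..<M}. \<bar>(fdiff ^^ (2 * a)) G' d\<bar>) = (\<Sum>d\<in>{0..<M}. \<bar>(fdiff ^^ (2 * Suc a)) G (d + (- 1))\<bar>)"
  proof -
    have "G' = (\<lambda>d. (fdiff (fdiff G)) (d + (- 1)))" by (simp add: G'_def fun_eq_iff)
    then have "(fdiff ^^ (2 * a)) G' = (\<lambda>d. (fdiff ^^ (2 * a)) (fdiff (fdiff G)) (d + (- 1)))"
      by (simp only: fdiff_pow_shift)
    moreover have "(fdiff ^^ (2 * Suc a)) G = (fdiff ^^ (2 * a)) (fdiff (fdiff G))"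
      by (simp add: funpow_swap1)
    ultimately show ?thesis by simp
  qed
  also have "\<dots> = (\<Sum>d\<in>{0..<M}. \<bar>(fdiff ^^ (2 * Suc a)) G d\<bar>)"
    by (rule sum_periodic_shift[OF M, where f = "\<lambda>d. \<bar>(fdiff ^^ (2 * Suc a)) G d\<bar>"])
      (simp only: fdiff_pow_periodic[of G M, OF Suc.prems])
  finally show ?case by (simp add: u'_def v'_def)
qed

section \<open>Characters of the digit group\<close>

lemma sum_lessThan_mult:
  fixes F :: "nat \<Rightarrow> 'a::comm_monoid_add"
  shows "(\<Sum>X<n * q. F X) = (\<Sum>Y<n. \<Sum>z<q. F (z + Y * q))"
proof (induction n)
  case (Suc n)
  have "(\<Sum>X<Suc n * q. F X) = (\<Sum>X<n * q + q. F X)" by (simp add: add.commute)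
  also have "\<dots> = (\<Sum>X<n * q. F X) + (\<Sum>z<q. F (z + n * q))"
    using sum.atLeastLessThan_concat[of 0 "n * q" "n * q + q" F]
      sum.shift_bounds_nat_ivl[of F 0 "n * q" q] by (simp add: lessThan_atLeast0 add.commute)
  finally show ?case using Suc by simp
qed simp

locale digit_base =
  fixes b :: nat
  assumes b_ge_2: "b \<ge> 2"
begin

lemma b_pos: "b > 0" using b_ge_2 by simp

definition \<omega> :: complex where "\<omega> = exp (2 * of_real pi * \<i> / of_nat b)"

lemma omega_power: "\<omega> ^ k = exp (2 * of_real pi * \<i> * of_nat k / of_nat b)"
  unfolding \<omega>_def by (subst exp_of_nat_mult[symmetric]) (simp add: mult_ac)

lemma norm_omega_power [simp]: "norm (\<omega> ^ k) = 1"
  by (simp add: norm_power \<omega>_def)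

lemma omega_power_b [simp]: "\<omega> ^ b = 1"
  using b_pos by (simp add: omega_power)

lemma omega_power_mod: "\<omega> ^ (k mod b) = \<omega> ^ k"
proof -
  have "\<omega> ^ k = \<omega> ^ (b * (k div b) + k mod b)" by simp
  also have "\<dots> = \<omega> ^ (k mod b)" by (simp only: power_add power_mult) simp
  finally show ?thesis by simp
qed

lemma omega_power_eq_1: "\<omega> ^ k = 1 \<longleftrightarrow> b dvd k"
  using complex_root_unity_eq[of b k 0] b_pos by (simp add: omega_power dvd_eq_mod_eq_0)

lemma sum_omega_power:
  assumes "\<not> b dvd k"
  shows "(\<Sum>z<b. \<omega> ^ (k * z)) = 0"
proof -
  have "\<omega> ^ k \<noteq> 1" using assms omega_power_eq_1 by simp
  moreover have "(\<omega> ^ k) ^ b = 1"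
    by (metis omega_power_b power_mult mult.commute power_one)
  ultimately show ?thesis
    using geometric_sum[of "\<omega> ^ k" b] by (simp add: power_mult)
qed

text \<open>
  A frequency \<open>k\<close> assigns a digit to each of the positions \<open>1, \<dots>, n\<close>. Position \<open>1\<close> is the most
  significant digit of the grid point \<open>X / b ^ n\<close>, and \<open>X mod b\<close> is its digit at position \<open>n\<close>.
  The weight \<open>mu a n k\<close> is the sum of the \<open>a\<close> largest positions with a nonzero digit of \<open>k\<close> (of all
  such positions, if there are fewer).
\<close>

primrec chi :: "nat \<Rightarrow> (nat \<Rightarrow> nat) \<Rightarrow> int \<Rightarrow> complex" where
  "chi 0 k X = 1"
| "chi (Suc n) k X = chi n k (X div int b) * \<omega> ^ (k (Suc n) * nat (X mod int b))"

fun mu :: "nat \<Rightarrow> nat \<Rightarrow> (nat \<Rightarrow> nat) \<Rightarrow> nat" where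
  "mu 0 n k = 0"
| "mu (Suc a) 0 k = 0"
| "mu (Suc a) (Suc n) k = (if k (Suc n) \<noteq> 0 then Suc n + mu a n k else mu (Suc a) n k)"

lemma norm_chi [simp]: "norm (chi n k X) = 1"
  by (induction n arbitrary: X) (auto simp: norm_mult)

lemma chi_periodic: "chi n k (X + int (b ^ n)) = chi n k X"
proof (induction n arbitrary: X)
  case (Suc n)
  have "(X + int (b ^ Suc n)) div int b = X div int b + int (b ^ n)"
    using b_pos by simp
  moreover have "(X + int (b ^ Suc n)) mod int b = X mod int b" by simp
  ultimately show ?case using Suc[of "X div int b"] by (simp only: chi.simps)
qed simp

lemma chi_Suc_nat [simp]:
  "z < b \<Longrightarrow> chi (Suc n) k (int (z + Y * b)) = chi n k (int Y) * \<omega> ^ (k (Suc n) * z)"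
  using b_pos by (simp add: nat_mod_distrib nat_add_distrib nat_mult_distrib)

lemma chi_zero: "(\<And>i. i \<in> {1..n} \<Longrightarrow> k i = 0) \<Longrightarrow> chi n k X = 1"
  by (induction n arbitrary: X) auto

lemma mu_Suc_le: "mu (Suc a) n k \<le> n + mu a n k"
proof (induction n arbitrary: a)
  case (Suc n)
  have "mu a n k \<le> mu a (Suc n) k"
    using Suc[of "a - 1"] by (cases a) auto
  then show ?case
    using Suc[of a] by (cases a) auto
qed simp

lemma mu_zero: "(\<And>i. i \<in> {1..n} \<Longrightarrow> k i = 0) \<Longrightarrow> mu a n k = 0"
  by (induction a n k rule: mu.induct) auto

text \<open>
  Splitting off the last digit, \<open>(Y + t) / b ^ n\<close> is expanded around \<open>Y / b ^ n\<close>; the constant term is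
  killed by a nonzero last frequency digit.
\<close>

lemma moment_bound:
  assumes "\<theta> \<in> {0..1}" "p \<le> r" "\<And>i. i \<in> {1..n} \<Longrightarrow> k i < b"
  shows "norm ((\<Sum>X<b ^ n. of_real (((real X + \<theta>) / real (b ^ n)) ^ p) * chi n k (int X)) / of_nat (b ^ n))
     \<le> (2 ^ r * real b) ^ a / real b ^ mu a n k"
  using assms
proof (induction n arbitrary: a p \<theta>)
  case 0
  have "\<bar>\<theta>\<bar> ^ p \<le> 1" using 0 by (simp add: power_le_one)
  also have "1 \<le> (2 ^ r * real b) ^ a"
    using b_ge_2 mult_mono[of 1 "2 ^ r" 1 "real b"] by (intro one_le_power) simp
  finally show ?case by (cases a) (simp_all add: norm_power)
next
  case (Suc n)
  \<comment> \<open>Last digit and offset together form an offset in \<open>[0, 1]\<close> for the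
    grid with one digit less; this is why the induction keeps \<open>\<theta>\<close>
    arbitrary.\<close>
  define t where "t z = (real z + \<theta>) / real b" for z
  have t: "t z \<in> {0..1}" if "z < b" for z
    using that Suc.prems b_pos by (auto simp: t_def divide_le_eq)
  define m where "m p \<theta> = (\<Sum>X<b ^ n. of_real (((real X + \<theta>) / real (b ^ n)) ^ p) * chi n k (int X)) / of_nat (b ^ n)"
    for p \<theta>
  have split: "(\<Sum>X<b ^ Suc n. of_real (((real X + \<theta>) / real (b ^ Suc n)) ^ p) * chi (Suc n) k (int X)) / of_nat (b ^ Suc n)
     = (\<Sum>Y<b ^ n. \<Sum>z<b. of_real (((real Y + t z) / real (b ^ n)) ^ p) * (chi n k (int Y) * \<omega> ^ (k (Suc n) * z))) / of_nat (b ^ Suc n)"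
  proof -
    have point: "(real (z + Y * b) + \<theta>) / real (b ^ Suc n) = (real Y + t z) / real (b ^ n)" for z Y
      using b_pos by (simp add: t_def field_simps)
    have "(\<Sum>X<b ^ Suc n. of_real (((real X + \<theta>) / real (b ^ Suc n)) ^ p) * chi (Suc n) k (int X))
      = (\<Sum>Y<b ^ n. \<Sum>z<b. of_real (((real (z + Y * b) + \<theta>) / real (b ^ Suc n)) ^ p) * chi (Suc n) k (int (z + Y * b)))"
      by (simp only: power_Suc2 sum_lessThan_mult)
    then show ?thesis
      unfolding point by (simp del: of_nat_add chi.simps)
  qed
  show ?case
  proof (cases "a = 0 \<or> k (Suc n) = 0")
    case True
    then consider "a = 0" | a' where "a = Suc a'" "k (Suc n) = 0" by (cases a) auto
    then show ?thesis
    proof cases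
      case 1
      have "norm (\<Sum>X<b ^ Suc n. of_real (((real X + \<theta>) / real (b ^ Suc n)) ^ p) * chi (Suc n) k (int X))
         \<le> (\<Sum>X<b ^ Suc n. 1)"
      proof (rule sum_norm_le)
        fix X assume "X \<in> {..<b ^ Suc n}"
        then have "real X + 1 \<le> real (b ^ Suc n)"
          by (metis Suc_leI lessThan_iff of_nat_Suc of_nat_le_iff add.commute)
        then have "(real X + \<theta>) / real (b ^ Suc n) \<le> 1" "(real X + \<theta>) / real (b ^ Suc n) \<ge> 0"
          using Suc.prems b_pos by (auto simp: divide_le_eq)
        then show "norm (of_real (((real X + \<theta>) / real (b ^ Suc n)) ^ p) * chi (Suc n) k (int X)) \<le> 1"
          by (simp only: norm_mult norm_chi norm_of_real) (simp only: power_le_one abs_of_nonneg zero_le_power mult_1_right)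
      qed
      then show ?thesis using 1 b_pos by (simp add: norm_divide norm_mult norm_power divide_le_eq)
    next
      case 2
      have "(\<Sum>Y<b ^ n. \<Sum>z<b. of_real (((real Y + t z) / real (b ^ n)) ^ p) * (chi n k (int Y) * \<omega> ^ (k (Suc n) * z))) / of_nat (b ^ Suc n)
         = (\<Sum>z<b. m p (t z)) / of_nat b"
        unfolding m_def 2 by (subst sum.swap) (simp add: sum_divide_distrib[symmetric] mult.commute)
      also have "norm \<dots> \<le> (\<Sum>z<b. (2 ^ r * real b) ^ a / real b ^ mu a n k) / real b"
      proof -
        have "norm (m p (t z)) \<le> (2 ^ r * real b) ^ a / real b ^ mu a n k" if "z < b" for z
          unfolding m_def by (rule Suc.IH[OF t[OF that] Suc.prems(2)]) (use Suc.prems(3) in auto)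
        then have "norm (\<Sum>z<b. m p (t z)) \<le> (\<Sum>z<b. (2 ^ r * real b) ^ a / real b ^ mu a n k)"
          by (intro sum_norm_le) auto
        then show ?thesis
          unfolding norm_divide norm_of_nat by (rule divide_right_mono) simp
      qed
      also have "\<dots> = (2 ^ r * real b) ^ a / real b ^ mu a (Suc n) k"
        using b_pos 2 by simp
      finally show ?thesis unfolding split .
    qed
  next
    case False
    then obtain a' where a: "a = Suc a'" and k: "k (Suc n) \<noteq> 0" by (cases a) auto
    \<comment> \<open>\<open>w q\<close> is the \<open>q\<close>-th moment of the last digit against
      its character. \<open>w 0 = 0\<close> is the cancellation, and the other moments are at most
      \<open>b ^ (- n)\<close>. As the position of the digit is \<open>n + 1\<close>, this costs one
      factor \<open>b\<close>; the factor \<open>2 ^ r\<close> bounds the sum of the binomial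
      coefficients. Each of the \<open>a\<close> counted digits pays both factors at most
      once.\<close>
    define w where "w q = (\<Sum>z<b. of_real ((t z / real (b ^ n)) ^ q) * \<omega> ^ (k (Suc n) * z)) / of_nat b" for q
    have "\<not> b dvd k (Suc n)"
      using k Suc.prems(3)[of "Suc n"] by (auto dest: dvd_imp_le)
    then have w0: "w 0 = 0"
      using sum_omega_power by (simp add: w_def)
    have w: "norm (w q) \<le> 1 / real (b ^ n)" if "q \<ge> 1" for q
    proof -
      have "norm (of_real ((t z / real (b ^ n)) ^ q) * \<omega> ^ (k (Suc n) * z)) \<le> 1 / real (b ^ n)" if "z < b" for z
      proof -
        have "0 \<le> t z / real (b ^ n)" "t z / real (b ^ n) \<le> 1 / real (b ^ n)"
          using t[OF \<open>z < b\<close>] b_pos by (auto simp: divide_right_mono)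
        moreover have "1 / real (b ^ n) \<le> 1" using b_pos by simp
        ultimately have "(t z / real (b ^ n)) ^ q \<le> t z / real (b ^ n)"
          using power_decreasing[of 1 q "t z / real (b ^ n)"] \<open>q \<ge> 1\<close> by simp
        moreover have "0 \<le> (t z / real (b ^ n)) ^ q"
          by (rule zero_le_power) fact
        ultimately show ?thesis
          using \<open>t z / real (b ^ n) \<le> 1 / real (b ^ n)\<close>
          by (simp only: norm_mult norm_omega_power norm_of_real)
      qed
      then have "norm (\<Sum>z<b. of_real ((t z / real (b ^ n)) ^ q) * \<omega> ^ (k (Suc n) * z)) \<le> (\<Sum>z<b. 1 / real (b ^ n))"
        by (intro sum_norm_le) auto
      then show ?thesis using b_pos by (simp add: w_def norm_divide divide_le_eq)
    qed
    have "(\<Sum>Y<b ^ n. \<Sum>z<b. of_real (((real Y + t z) / real (b ^ n)) ^ p) * (chi n k (int Y) * \<omega> ^ (k (Suc n) * z))) / of_nat (b ^ Suc n)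
       = (\<Sum>Y<b ^ n. \<Sum>z<b. \<Sum>q\<le>p. of_nat (p choose q) * (of_real ((t z / real (b ^ n)) ^ q) * \<omega> ^ (k (Suc n) * z)) *
            (of_real (((real Y + 0) / real (b ^ n)) ^ (p - q)) * chi n k (int Y))) / of_nat (b ^ Suc n)"
    proof -
      have "((real Y + t z) / real (b ^ n)) ^ p = (\<Sum>q\<le>p. real (p choose q) * (t z / real (b ^ n)) ^ q * ((real Y + 0) / real (b ^ n)) ^ (p - q))"
        for Y z
        using binomial_ring[of "t z / real (b ^ n)" "(real Y + 0) / real (b ^ n)" p]
        by (simp add: add_divide_distrib[symmetric] add.commute)
      then have "of_real (((real Y + t z) / real (b ^ n)) ^ p) * (chi n k (int Y) * \<omega> ^ (k (Suc n) * z))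
         = (\<Sum>q\<le>p. of_nat (p choose q) * (of_real ((t z / real (b ^ n)) ^ q) * \<omega> ^ (k (Suc n) * z)) *
            (of_real (((real Y + 0) / real (b ^ n)) ^ (p - q)) * chi n k (int Y)))" for Y z
        by (simp only: of_real_sum of_real_mult of_real_of_nat_eq sum_distrib_right) (simp only: mult_ac)
      then show ?thesis by (simp only:)
    qed
    also have "\<dots> = (\<Sum>q\<le>p. of_nat (p choose q) * (w q * m (p - q) 0))"
    proof -
      have "(\<Sum>Y<b ^ n. \<Sum>z<b. \<Sum>q\<le>p. of_nat (p choose q) * A q z * B q Y) / of_nat (b ^ Suc n)
        = (\<Sum>q\<le>p. of_nat (p choose q) * ((\<Sum>z<b. A q z) / of_nat b * ((\<Sum>Y<b ^ n. B q Y) / of_nat (b ^ n))))"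
        for A B :: "nat \<Rightarrow> nat \<Rightarrow> complex"
      proof -
        have "(\<Sum>Y<b ^ n. \<Sum>z<b. \<Sum>q\<le>p. of_nat (p choose q) * A q z * B q Y)
          = (\<Sum>Y<b ^ n. \<Sum>q\<le>p. \<Sum>z<b. of_nat (p choose q) * A q z * B q Y)"
          by (rule sum.cong[OF refl], rule sum.swap)
        also have "\<dots> = (\<Sum>q\<le>p. \<Sum>Y<b ^ n. \<Sum>z<b. of_nat (p choose q) * A q z * B q Y)"
          by (rule sum.swap)
        also have "\<dots> = (\<Sum>q\<le>p. of_nat (p choose q) * ((\<Sum>z<b. A q z) * (\<Sum>Y<b ^ n. B q Y)))"
          by (simp add: sum_distrib_left sum_distrib_right mult_ac)
        finally have eq: "(\<Sum>Y<b ^ n. \<Sum>z<b. \<Sum>q\<le>p. of_nat (p choose q) * A q z * B q Y)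
          = (\<Sum>q\<le>p. of_nat (p choose q) * ((\<Sum>z<b. A q z) * (\<Sum>Y<b ^ n. B q Y)))" .
        show ?thesis
          unfolding eq by (simp only: sum_divide_distrib[of _ "{..p}"]) (simp add: mult_ac)
      qed
      then show ?thesis unfolding w_def m_def .
    qed
    also have "norm \<dots> \<le> (\<Sum>q\<le>p. real (p choose q) * (1 / real (b ^ n) * ((2 ^ r * real b) ^ a' / real b ^ mu a' n k)))"
    proof (rule sum_norm_le)
      fix q assume "q \<in> {..p}"
      have m: "norm (m (p - q) 0) \<le> (2 ^ r * real b) ^ a' / real b ^ mu a' n k"
        unfolding m_def by (rule Suc.IH) (use Suc.prems in auto)
      have "norm (w q) \<le> 1 / real (b ^ n)" using w w0 by (cases "q = 0") auto
      then show "norm (of_nat (p choose q) * (w q * m (p - q) 0))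
        \<le> real (p choose q) * (1 / real (b ^ n) * ((2 ^ r * real b) ^ a' / real b ^ mu a' n k))"
        unfolding norm_mult norm_of_nat by (intro mult_left_mono mult_mono m) auto
    qed
    also have "\<dots> = 2 ^ p * (1 / real (b ^ n) * ((2 ^ r * real b) ^ a' / real b ^ mu a' n k))"
    proof -
      have "(\<Sum>q\<le>p. real (p choose q)) = 2 ^ p"
        using choose_row_sum[of p] by (metis of_nat_numeral of_nat_power of_nat_sum)
      then show ?thesis by (simp only: sum_distrib_right[symmetric])
    qed
    also have "\<dots> \<le> 2 ^ r * (1 / real (b ^ n) * ((2 ^ r * real b) ^ a' / real b ^ mu a' n k))"
      using Suc.prems(2) by (intro mult_right_mono power_increasing) auto
    also have "\<dots> = (2 ^ r * real b) ^ a / real b ^ mu a (Suc n) k"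
      using k b_pos by (simp add: a power_add field_simps)
    finally show ?thesis unfolding split .
  qed
qed

subsection \<open>Antiderivatives of characters\<close>

text \<open>The induction hypothesis of \<open>block_antideriv\<close>, named because
  \<open>chi_antideriv_aux\<close> uses it for the same \<open>a\<close>. A mean-zero
  \<open>\<psi>\<close> of length \<open>Q\<close> plays the role of a nonzero digit just after
  position \<open>n\<close>: in terms of the period \<open>M = b ^ n * Q\<close> its first
  antiderivative costs only \<open>Q = M / b ^ n\<close>, hence the \<open>n\<close> in the
  exponent.\<close>

definition block_const :: "nat \<Rightarrow> real \<Rightarrow> bool" where
  "block_const a C \<longleftrightarrow> C > 0 \<and>
     (\<forall>n k Q \<psi> B. Q > 0 \<longrightarrow> (\<Sum>y<Q. \<psi> y) = 0 \<longrightarrow> (\<forall>y. norm (\<psi> y) \<le> B) \<longrightarrow>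
      (\<forall>i\<in>{1..n}. k i < b) \<longrightarrow>
      (\<exists>u. (\<forall>x. u (x + int (b ^ n * Q)) = u x) \<and>
          (fdiff ^^ a) u = (\<lambda>x. chi n k (x div int Q) * \<psi> (nat (x mod int Q))) \<and>
          (\<forall>x. norm (u x) \<le> C * B * real (b ^ n * Q) ^ a / real b ^ (if a = 0 then 0 else n + mu (a - 1) n k))))"

lemma block_constE:
  assumes "block_const a C" "Q > 0" "(\<Sum>y<Q. \<psi> y) = 0" "\<And>y. norm (\<psi> y) \<le> B" "\<And>i. i \<in> {1..n} \<Longrightarrow> k i < b"
  obtains u where "\<And>x. u (x + int (b ^ n * Q)) = u x"
    "(fdiff ^^ a) u = (\<lambda>x. chi n k (x div int Q) * \<psi> (nat (x mod int Q)))"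
    "\<And>x. norm (u x) \<le> C * B * real (b ^ n * Q) ^ a / real b ^ (if a = 0 then 0 else n + mu (a - 1) n k)"
proof -
  have "\<exists>u. (\<forall>x. u (x + int (b ^ n * Q)) = u x) \<and>
          (fdiff ^^ a) u = (\<lambda>x. chi n k (x div int Q) * \<psi> (nat (x mod int Q))) \<and>
          (\<forall>x. norm (u x) \<le> C * B * real (b ^ n * Q) ^ a / real b ^ (if a = 0 then 0 else n + mu (a - 1) n k))"
    by (rule assms(1)[unfolded block_const_def, THEN conjunct2, rule_format]) (use assms in auto)
  then show ?thesis
    by (elim exE conjE) (rule that, erule spec, assumption, erule spec)
qed

text \<open>Zero digits at the end of the frequency only lengthen the blocks on which the function
  is constant, so the induction on \<open>n\<close> multiplies \<open>Q\<close> by \<open>b\<close>.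
  The last nonzero digit makes a block of length \<open>Q * b\<close> mean-zero, and
  \<open>block_const\<close> applies. The factor \<open>b\<close> in the bound pays for
  \<open>n\<close> instead of \<open>n + 1\<close> in the exponent there.\<close>

lemma chi_antideriv_aux:
  assumes block: "block_const a C"
    and Q: "Q > 0" and k: "\<And>i. i \<in> {1..n} \<Longrightarrow> k i < b" and nz: "\<exists>i\<in>{1..n}. k i \<noteq> 0"
  shows "\<exists>u. (\<forall>x. u (x + int (b ^ n * Q)) = u x) \<and>
          (fdiff ^^ a) u = (\<lambda>x. chi n k (x div int Q)) \<and>
          (\<forall>x. norm (u x) \<le> C * real b * real (b ^ n * Q) ^ a / real b ^ mu a n k)"
  using Q k nz
proof (induction n arbitrary: Q)
  case 0
  then show ?case by simp
next
  case (Suc n)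
  have C: "C > 0" using block by (simp add: block_const_def)
  have divmul: "x div int Q div int b = x div int (Q * b)" for x
    using zdiv_zmult2_eq[of "int b" x "int Q"] by simp
  have modmul: "nat (x div int Q mod int b) = nat (x mod int (Q * b)) div Q" for x
  proof -
    have "x mod int (Q * b) = int Q * (x div int Q mod int b) + x mod int Q"
      using zmod_zmult2_eq[of "int b" x "int Q"] by simp
    moreover have "(int Q * (x div int Q mod int b) + x mod int Q) div int Q = x div int Q mod int b"
      using Suc.prems(1) by simp
    ultimately have "x div int Q mod int b = x mod int (Q * b) div int Q" by simp
    then show ?thesis
      using Suc.prems(1) b_pos by (simp add: nat_div_distrib)
  qed
  have size: "b ^ Suc n * Q = b ^ n * (Q * b)" by simp
  have Qb: "Q * b > 0" using Suc.prems(1) b_pos by simp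
  show ?case
  proof (cases "k (Suc n) = 0")
    case True
    have "\<exists>i\<in>{1..n}. k i \<noteq> 0"
      using Suc.prems(3) True by (metis atLeastAtMost_iff le_Suc_eq)
    then obtain u where u: "\<And>x. u (x + int (b ^ n * (Q * b))) = u x"
      "(fdiff ^^ a) u = (\<lambda>x. chi n k (x div int (Q * b)))"
      "\<And>x. norm (u x) \<le> C * real b * real (b ^ n * (Q * b)) ^ a / real b ^ mu a n k"
      using Suc.IH[OF Qb] Suc.prems(2) by auto
    have "mu a (Suc n) k = mu a n k" using True by (cases a) auto
    then have "norm (u x) \<le> C * real b * real (b ^ n * (Q * b)) ^ a / real b ^ mu a (Suc n) k" for x
      using u(3)[of x] by (simp only:)
    moreover have "(\<lambda>x. chi (Suc n) k (x div int Q)) = (\<lambda>x. chi n k (x div int (Q * b)))"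
      using True by (simp add: divmul)
    then have "(fdiff ^^ a) u = (\<lambda>x. chi (Suc n) k (x div int Q))"
      using u(2) by (simp only:)
    ultimately show ?thesis
      unfolding size using u(1) by blast
  next
    case False
    define \<psi> where "\<psi> y = \<omega> ^ (k (Suc n) * (y div Q))" for y
    have "\<not> b dvd k (Suc n)"
      using False Suc.prems(2)[of "Suc n"] by (auto dest: dvd_imp_le)
    then have sum0: "(\<Sum>y<Q * b. \<psi> y) = 0"
      using Suc.prems(1) sum_omega_power[of "k (Suc n)"]
      unfolding mult.commute[of Q b] sum_lessThan_mult \<psi>_def by (simp add: sum_distrib_left[symmetric])
    obtain u where u: "\<And>x. u (x + int (b ^ n * (Q * b))) = u x"
      "(fdiff ^^ a) u = (\<lambda>x. chi n k (x div int (Q * b)) * \<psi> (nat (x mod int (Q * b))))"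
      "\<And>x. norm (u x) \<le> C * 1 * real (b ^ n * (Q * b)) ^ a / real b ^ (if a = 0 then 0 else n + mu (a - 1) n k)"
    proof (rule block_constE[where \<psi> = \<psi> and n = n and k = k and B = 1, OF block Qb sum0])
      show "k i < b" if "i \<in> {1..n}" for i using Suc.prems(2)[of i] that by simp
      show "norm (\<psi> y) \<le> 1" for y by (simp only: \<psi>_def norm_omega_power order_refl)
    qed blast
    have chi: "(\<lambda>x. chi (Suc n) k (x div int Q)) = (\<lambda>x. chi n k (x div int (Q * b)) * \<psi> (nat (x mod int (Q * b))))"
      by (simp add: divmul modmul \<psi>_def)
    have "norm (u x) \<le> C * real b * real (b ^ n * (Q * b)) ^ a / real b ^ mu a (Suc n) k" for x
    proof (cases a)
      case 0
      have "norm (u x) \<le> C * 1" using u(3)[of x] 0 by simp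
      also have "\<dots> \<le> C * real b" using C b_pos by (intro mult_left_mono) auto
      finally show ?thesis using 0 by simp
    next
      case (Suc a')
      then show ?thesis
        using u(3)[of x] False b_pos by simp
    qed
    then show ?thesis
      unfolding size chi using u(1,2) by blast
  qed
qed

text \<open>
  The function \<open>X \<mapsto> chi n k (X div Q) \<psi> (X mod Q)\<close> has the antiderivative \<open>chi n k (X div Q) \<Psi> (X mod Q)\<close>
  for the partial sums \<open>\<Psi>\<close> of \<open>\<psi>\<close>. Splitting \<open>\<Psi>\<close> into its mean and the rest leads to the same
  situation with one antiderivative less, and to a shorter character.
\<close>

lemma block_antideriv:
  "\<exists>C. block_const a C"
proof (induction a)
  case 0
  show ?case
    unfolding block_const_def
  proof (intro exI[of _ "1::real"] conjI allI impI)
    fix n Q :: nat and k :: "nat \<Rightarrow> nat" and \<psi> :: "nat \<Rightarrow> complex" and B :: real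
    assume Q: "Q > 0" and \<psi>: "\<forall>y. norm (\<psi> y) \<le> B"
    define u where "u x = chi n k (x div int Q) * \<psi> (nat (x mod int Q))" for x
    have "u (x + int (b ^ n * Q)) = u x" for x
      using Q chi_periodic[of n k "x div int Q"] by (simp add: u_def add.commute)
    moreover have "norm (u x) \<le> B" for x
      using \<psi> by (simp add: u_def norm_mult)
    ultimately show "\<exists>u. (\<forall>x. u (x + int (b ^ n * Q)) = u x) \<and>
          (fdiff ^^ 0) u = (\<lambda>x. chi n k (x div int Q) * \<psi> (nat (x mod int Q))) \<and>
          (\<forall>x. norm (u x) \<le> 1 * B * real (b ^ n * Q) ^ 0 / real b ^ (if 0 = 0 then 0 else n + mu (0 - 1) n k))"
      by (intro exI[of _ u]) (auto simp: u_def)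
  qed simp
next
  case (Suc a)
  then obtain C where IH: "block_const a C" by blast
  then have C: "C > 0" by (simp add: block_const_def)
  show ?case
    unfolding block_const_def
  proof (intro exI[of _ "2 * C + C * real b"] conjI allI impI)
    show "2 * C + C * real b > 0" using C by (simp add: add_pos_nonneg)
    fix n Q :: nat and k :: "nat \<Rightarrow> nat" and \<psi> :: "nat \<Rightarrow> complex" and B :: real
    assume Q: "Q > 0" and sum0: "(\<Sum>y<Q. \<psi> y) = 0" and \<psi>: "\<forall>y. norm (\<psi> y) \<le> B" and k: "\<forall>i\<in>{1..n}. k i < b"
    have B: "B \<ge> 0" using \<psi> order_trans[OF norm_ge_zero] by blast
    \<comment> \<open>Partial sums within one block. They start at \<open>0\<close> and, as
      \<open>\<psi>\<close> sums to zero, return to \<open>0\<close> at the end of the block, so the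
      change of \<open>chi\<close> from one block to the next makes no jump.\<close>
    define \<Psi> where "\<Psi> x = (if x < Q then \<Sum>y<x. \<psi> y else 0)" for x
    define c where "c = (\<Sum>x<Q. \<Psi> x) / of_nat Q"
    define M where "M = real (b ^ n * Q)"
    have M: "M > 0" using Q b_pos by (simp add: M_def)
    have norm_\<Psi>: "norm (\<Psi> x) \<le> real Q * B" for x
    proof (cases "x < Q")
      case True
      have "norm (\<Psi> x) \<le> (\<Sum>y<x. B)"
        using True \<psi> by (simp add: \<Psi>_def sum_norm_le del: sum_constant)
      also have "\<dots> \<le> real Q * B" using True B by (auto intro!: mult_right_mono)
      finally show ?thesis .
    qed (use B in \<open>auto simp: \<Psi>_def\<close>)
    have norm_c: "norm c \<le> real Q * B"
    proof -
      have "norm (\<Sum>x<Q. \<Psi> x) \<le> (\<Sum>x<Q. real Q * B)"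
        by (intro sum_norm_le norm_\<Psi>)
      then show ?thesis using Q by (simp add: c_def norm_divide divide_le_eq mult.commute)
    qed
    define \<psi>1 where "\<psi>1 x = \<Psi> x - c" for x
    have norm_\<psi>1: "norm (\<psi>1 x) \<le> 2 * real Q * B" for x
      using norm_triangle_ineq4[of "\<Psi> x" c] norm_\<Psi>[of x] norm_c by (simp add: \<psi>1_def)
    have sum1: "(\<Sum>x<Q. \<psi>1 x) = 0"
      using Q by (simp add: \<psi>1_def sum_subtractf c_def)
    obtain u1 where u1: "\<And>x. u1 (x + int (b ^ n * Q)) = u1 x"
      "(fdiff ^^ a) u1 = (\<lambda>x. chi n k (x div int Q) * \<psi>1 (nat (x mod int Q)))"
      "\<And>x. norm (u1 x) \<le> C * (2 * real Q * B) * M ^ a / real b ^ (if a = 0 then 0 else n + mu (a - 1) n k)"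
      unfolding M_def
    proof (rule block_constE[where \<psi> = \<psi>1 and n = n and k = k, OF IH Q sum1 norm_\<psi>1])
      show "k i < b" if "i \<in> {1..n}" for i using k that by simp
    qed blast
    have QM: "real Q = M / real b ^ n" using b_pos by (simp add: M_def)
    have norm_u1: "norm (u1 x) \<le> 2 * C * B * M ^ Suc a / real b ^ (n + mu a n k)" for x
    proof -
      \<comment> \<open>The exponent supplied by the induction hypothesis is at least
        \<open>mu a n k\<close>; the additional \<open>n\<close> that is required now comes from
        \<open>Q = M / b ^ n\<close>.\<close>
      have le: "mu a n k \<le> (if a = 0 then 0 else n + mu (a - 1) n k)"
        using mu_Suc_le[of "a - 1" n k] by (cases a) auto
      have "norm (u1 x) \<le> C * (2 * real Q * B) * M ^ a / real b ^ mu a n k"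
        by (rule order_trans[OF u1(3)], intro divide_left_mono power_increasing le mult_pos_pos zero_less_power)
          (use b_ge_2 C B M in auto)
      also have "\<dots> = 2 * C * B * M ^ Suc a / real b ^ (n + mu a n k)"
        using b_pos by (simp add: QM power_add)
      finally show ?thesis .
    qed
    define v where "v x = chi n k (x div int Q) * \<Psi> (nat (x mod int Q))" for x
    have fdiff_v: "fdiff v x = chi n k (x div int Q) * \<psi> (nat (x mod int Q))" for x
    proof (cases "x mod int Q + 1 < int Q")
      case True
      have "(x + 1) div int Q = x div int Q" "(x + 1) mod int Q = x mod int Q + 1"
      proof -
        have x: "x + 1 = int Q * (x div int Q) + (x mod int Q + 1)" by simp
        have "0 \<le> x mod int Q + 1" using Q by simp
        then show "(x + 1) mod int Q = x mod int Q + 1"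
          using True by (subst x) (simp only: mod_mult_self4 mod_pos_pos_trivial mult.commute)
        show "(x + 1) div int Q = x div int Q"
          using True Q \<open>0 \<le> x mod int Q + 1\<close> by (subst x) (simp only: div_mult_self4 div_pos_pos_trivial)
      qed
      moreover have "nat (x mod int Q) < Q" "nat (x mod int Q + 1) = Suc (nat (x mod int Q))"
        using Q by (auto simp: nat_less_iff nat_add_distrib)
      ultimately show ?thesis
        using True by (simp add: fdiff_def v_def \<Psi>_def algebra_simps nat_less_iff)
    next
      case False
      moreover have "x mod int Q < int Q" using Q by simp
      ultimately have last: "x mod int Q = int Q - 1" by linarith
      then have "(x + 1) mod int Q = 0" by (metis add_diff_cancel_right' diff_add_cancel mod_add_left_eq mod_self)
      moreover have nat_last: "nat (x mod int Q) = Q - 1" using last by simp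
      moreover have "\<Psi> 0 = 0" by (simp add: \<Psi>_def)
      moreover have "\<Psi> (Q - 1) + \<psi> (Q - 1) = 0"
        using sum0 Q sum.lessThan_Suc[of \<psi> "Q - 1"] by (simp add: \<Psi>_def)
      ultimately show ?thesis
        by (simp add: fdiff_def v_def) (metis add.commute minus_unique mult_minus_right)
    qed
    show "\<exists>u. (\<forall>x. u (x + int (b ^ n * Q)) = u x) \<and>
          (fdiff ^^ Suc a) u = (\<lambda>x. chi n k (x div int Q) * \<psi> (nat (x mod int Q))) \<and>
          (\<forall>x. norm (u x) \<le> (2 * C + C * real b) * B * real (b ^ n * Q) ^ Suc a
             / real b ^ (if Suc a = 0 then 0 else n + mu (Suc a - 1) n k))"
    \<comment> \<open>The mean \<open>c\<close> of \<open>\<Psi>\<close> contributes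
      \<open>c\<close> times a character with \<open>n\<close> digits. If this character is
      nontrivial, it has an \<open>a\<close>-fold antiderivative of its own; if it is trivial, the
      contribution is a constant, which the last difference removes.\<close>
    proof (cases "\<exists>i\<in>{1..n}. k i \<noteq> 0")
      case True
      obtain u2 where u2: "\<And>x. u2 (x + int (b ^ n * Q)) = u2 x"
        "(fdiff ^^ a) u2 = (\<lambda>x. chi n k (x div int Q))"
        "\<And>x. norm (u2 x) \<le> C * real b * M ^ a / real b ^ mu a n k"
        using chi_antideriv_aux[OF IH Q _ True] k unfolding M_def by blast
      define u where "u x = u1 x + c * u2 x" for x
      have "(fdiff ^^ a) u = v"
        unfolding u_def fdiff_pow_linear u1 u2
        by (simp add: \<psi>1_def v_def[abs_def] algebra_simps)
      then have "(fdiff ^^ Suc a) u = (\<lambda>x. chi n k (x div int Q) * \<psi> (nat (x mod int Q)))"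
        using fdiff_v by auto
      moreover have "u (x + int (b ^ n * Q)) = u x" for x
        using u1(1) u2(1) by (simp add: u_def)
      moreover have "norm (u x) \<le> (2 * C + C * real b) * B * M ^ Suc a / real b ^ (n + mu a n k)" for x
      proof -
        have "norm (c * u2 x) \<le> real Q * B * (C * real b * M ^ a / real b ^ mu a n k)"
          unfolding norm_mult by (intro mult_mono norm_c u2(3)) (use B in auto)
        also have "\<dots> = C * real b * B * M ^ Suc a / real b ^ (n + mu a n k)"
          using b_pos by (simp add: QM power_add)
        finally have "norm (u x) \<le> 2 * C * B * M ^ Suc a / real b ^ (n + mu a n k) + C * real b * B * M ^ Suc a / real b ^ (n + mu a n k)"
          unfolding u_def using norm_u1[of x] norm_triangle_ineq[of "u1 x" "c * u2 x"] by linarith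
        then show ?thesis by (simp add: add_divide_distrib[symmetric] algebra_simps)
      qed
      ultimately show ?thesis by (intro exI[of _ u]) (simp add: M_def)
    next
      case False
      then have chi1: "chi n k X = 1" for X
        by (intro chi_zero) auto
      have "(fdiff ^^ a) u1 x = v x - c" for x
        unfolding u1 by (simp add: \<psi>1_def v_def chi1)
      then have "(fdiff ^^ Suc a) u1 = (\<lambda>x. chi n k (x div int Q) * \<psi> (nat (x mod int Q)))"
        using fdiff_v by (simp add: fdiff_def fun_eq_iff)
      moreover have "norm (u1 x) \<le> (2 * C + C * real b) * B * M ^ Suc a / real b ^ (n + mu a n k)" for x
        by (rule order_trans[OF norm_u1], intro divide_right_mono mult_right_mono)
          (use C B M b_pos in auto)
      ultimately show ?thesis using u1(1) by (intro exI[of _ u1]) (simp add: M_def)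
    qed
  qed
qed

lemma chi_antideriv:
  "\<exists>C>0. \<forall>n k. (\<forall>i\<in>{1..n::nat}. k i < b) \<longrightarrow> (\<exists>i\<in>{1..n}. k i \<noteq> 0) \<longrightarrow>
      (\<exists>u. (\<forall>x. u (x + int (b ^ n)) = u x) \<and> (fdiff ^^ a) u = chi n k \<and>
          (\<forall>x. norm (u x) \<le> C * real (b ^ n) ^ a / real b ^ mu a n k))"
proof -
  obtain C where block: "block_const a C"
    using block_antideriv[of a] by blast
  then have C: "C > 0" by (simp add: block_const_def)
  show ?thesis
  proof (intro exI[of _ "C * real b"] conjI allI impI)
    fix n :: nat and k :: "nat \<Rightarrow> nat"
    assume "\<forall>i\<in>{1..n}. k i < b" "\<exists>i\<in>{1..n}. k i \<noteq> 0"
    then show "\<exists>u. (\<forall>x. u (x + int (b ^ n)) = u x) \<and> (fdiff ^^ a) u = chi n k \<and>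
          (\<forall>x. norm (u x) \<le> C * real b * real (b ^ n) ^ a / real b ^ mu a n k)"
      using chi_antideriv_aux[OF block, of 1 n k] by simp
  qed (use C b_pos in simp)
qed

end

section \<open>The dual net\<close>

lemma sum_PiE_insert:
  assumes "j \<notin> w"
  shows "(\<Sum>h\<in>PiE (insert j w) V. F h) = (\<Sum>c\<in>V j. \<Sum>h\<in>PiE w V. F (h(j := c)))"
proof -
  have "(\<Sum>h\<in>PiE (insert j w) V. F h) = (\<Sum>(c, h)\<in>V j \<times> PiE w V. F (h(j := c)))"
    unfolding PiE_insert_eq using assms
    by (subst sum.reindex[OF inj_combinator]) (auto simp: case_prod_unfold)
  then show ?thesis by (simp add: sum.cartesian_product)
qed

lemma exists_sum_eq:
  fixes l :: "'i \<Rightarrow> nat"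
  assumes "finite u" "r \<le> (\<Sum>j\<in>u. l j)"
  shows "\<exists>v. (\<forall>j\<in>u. v j \<le> l j) \<and> (\<Sum>j\<in>u. v j) = r"
  using assms
proof (induction u arbitrary: r)
  case (insert j u)
  define q where "q = min r (l j)"
  have "r - q \<le> (\<Sum>j\<in>u. l j)" using insert by (auto simp: q_def min_def)
  then obtain v where v: "\<forall>j\<in>u. v j \<le> l j" "(\<Sum>j\<in>u. v j) = r - q"
    using insert.IH by blast
  have "(\<Sum>i\<in>insert j u. (v(j := q)) i) = q + (\<Sum>i\<in>u. v i)"
    using insert.hyps by (simp, intro sum.cong refl) auto
  then show ?case
    using v by (intro exI[of _ "v(j := q)"]) (auto simp: q_def)
qed simp

lemma prod_insert_upd:
  assumes "finite w" "j \<notin> w"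
  shows "(\<Prod>i\<in>insert j w. f ((h(j := c)) i)) = f c * (\<Prod>i\<in>w. f (h i))"
  using assms by (simp, intro arg_cong2[of _ _ _ _ "(*)"] prod.cong refl) auto

lemma sum_insert_upd:
  assumes "finite w" "j \<notin> w"
  shows "(\<Sum>i\<in>insert j w. f ((h(j := c)) i)) = f c + (\<Sum>i\<in>w. f (h i))"
  using assms by (simp, intro arg_cong2[of _ _ _ _ "(+)"] sum.cong refl) auto

text \<open>The arithmetic behind the rate. In the application \<open>A\<close>, \<open>B\<close>,
  \<open>L\<close> are the sums over the coordinates of \<open>mu a\<close>,
  \<open>mu \<beta>\<close> and \<open>lev a\<close>. Divided by 2, the inequality compares
  exponents of \<open>b\<close>: up to \<open>3 * t\<close>, the weight \<open>2 * A\<close> beats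
  the target \<open>2 * a * m\<close> together with the exponent \<open>L + t - m\<close> of the
  size of a group, and half of \<open>(A - a * L) + \<bar>L - m\<bar>\<close> is to spare for
  geometric sums. The two truncated differences add up to \<open>\<bar>L - m\<bar>\<close>.\<close>

lemma exponent_inequality:
  fixes a \<beta> t m A B L :: nat
  assumes B: "B + t > \<beta> * m" and BA: "B \<le> A + (\<beta> - a) * L" and AL: "a * L \<le> A"
    and a: "a \<ge> 1" and \<beta>: "\<beta> \<ge> 2 * a"
  shows "(A - a * L) + ((L - m) + (m - L)) + 4 * (a * m) + 2 * (L + t - m) \<le> 4 * A + 6 * t"
proof -
  define R where "R = A - a * L"
  have A: "A = a * L + R" using AL by (simp add: R_def)
  show ?thesis
  proof (cases "m \<le> L")
    case True
    then obtain e where L: "L = m + e" using le_Suc_ex by blast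
    have "e \<le> a * e" using a by simp
    moreover have eqs: "A - a * L = R" "a * L = a * m + a * e" "L - m = e" "m - L = 0" "L + t - m = e + t"
      by (simp_all add: R_def L distrib_left)
    moreover have "R + (e + 0) + 4 * y + 2 * (e + t) \<le> 4 * (y + x + R) + 6 * t" if "e \<le> x" for x y
      using that by simp
    then have "R + (e + 0) + 4 * (a * m) + 2 * (e + t) \<le> 4 * (a * m + a * e + R) + 6 * t"
      using \<open>e \<le> a * e\<close> by blast
    ultimately show ?thesis using A by (simp only:)
  next
    case False
    define d where "d = m - L"
    have m: "m = L + d" using False by (simp add: d_def)
    have "a * L + (\<beta> - a) * L = \<beta> * L"
      using \<beta> by (simp add: add_mult_distrib[symmetric])
    then have "\<beta> * L + \<beta> * d \<le> \<beta> * L + R + t"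
      using B BA A unfolding m distrib_left by linarith
    then have "\<beta> * d \<le> R + t" by simp
    \<comment> \<open>Here \<open>\<beta> \<ge> 2 * a\<close> enters: up to \<open>t\<close>, the
      excess \<open>R\<close> is at least twice the deficit \<open>a * d\<close> of
      \<open>a * L\<close> below \<open>a * m\<close>.\<close>
    moreover have "2 * (a * d) \<le> \<beta> * d" using \<beta> by (simp add: mult.assoc[symmetric])
    ultimately have "2 * (a * d) \<le> R + t" by (rule order_trans[rotated])
    moreover have "d \<le> a * d" using a by simp
    moreover have "R + (0 + d) + 4 * (y + x) + 2 * t \<le> 4 * (y + R) + 6 * t" if "2 * x \<le> R + t" "d \<le> x" for x y
      using that by simp
    ultimately have key: "R + (0 + d) + 4 * (a * L + a * d) + 2 * t \<le> 4 * (a * L + R) + 6 * t"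
      by blast
    have eqs: "A - a * L = R" "a * m = a * L + a * d" "L - m = 0" "m - L = d"
      by (simp_all add: R_def m distrib_left)
    have "L + t - m \<le> t" by (simp add: m)
    then have "R + (0 + d) + 4 * (a * L + a * d) + 2 * (L + t - m) \<le> R + (0 + d) + 4 * (a * L + a * d) + 2 * t"
      by (intro add_left_mono mult_left_mono) auto
    also note key
    finally show ?thesis using A by (simp only: eqs)
  qed
qed

text \<open>The row condition of \<open>order_digital_net\<close>, split off so that
  \<open>n\<close> and the matrices become parameters.\<close>

definition net_rows ::
  "nat \<Rightarrow> nat \<Rightarrow> nat \<Rightarrow> nat \<Rightarrow> nat \<Rightarrow> nat \<Rightarrow> (nat \<Rightarrow> nat \<Rightarrow> nat \<Rightarrow> nat) \<Rightarrow> bool" where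
  "net_rows b \<beta> t m s n C \<longleftrightarrow>
     (\<forall>v i.
       (\<forall>j\<in>{1..s}. (\<forall>l\<in>{1..v j}. i j l \<in> {1..n}) \<and>
                    (\<forall>l l'. 1 \<le> l \<and> l < l' \<and> l' \<le> v j \<longrightarrow> i j l' < i j l)) \<and>
       (\<Sum>j=1..s. \<Sum>l=1..min \<beta> (v j). i j l) \<le> \<beta> * m - t
       \<longrightarrow> lin_indep_mod b m (SIGMA j:{1..s}. {1..v j}) (\<lambda>(j, l). C j (i j l)))"

context digit_base
begin

text \<open>
  The position of the \<open>a\<close>-th nonzero digit of \<open>k\<close>, counted from the position \<open>n\<close> downwards; \<open>0\<close> if
  there is none.
\<close>

fun lev :: "nat \<Rightarrow> nat \<Rightarrow> (nat \<Rightarrow> nat) \<Rightarrow> nat" where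
  "lev 0 n k = Suc n"
| "lev (Suc a) 0 k = 0"
| "lev (Suc a) (Suc n) k = (if k (Suc n) \<noteq> 0 then lev a n k else lev (Suc a) n k)"

lemma lev_le: "lev a n k \<le> Suc n"
  by (induction a n k rule: lev.induct) auto

lemma lev_Suc_le: "lev (Suc a) n k \<le> n"
  by (induction n) (auto simp: lev_le)

lemma lev_mu_le: "a * lev a n k \<le> mu a n k"
proof (induction a n k rule: lev.induct)
  case (3 a n k)
  then show ?case using lev_le[of a n k] by auto
qed auto

text \<open>Every nonzero position after the \<open>a\<close>-th one is at most
  \<open>lev a n k\<close>. With \<open>a + c = \<beta>\<close> this is how the net property, which
  is about \<open>mu \<beta>\<close>, reaches the weight \<open>mu a\<close> of the
  coefficients.\<close>

lemma mu_add_le: "mu (a + c) n k \<le> mu a n k + c * lev a n k"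
proof (induction a n k rule: lev.induct)
  case (1 n k)
  show ?case
  proof (induction c)
    case (Suc c)
    then show ?case using mu_Suc_le[of c n k] by simp
  qed simp
qed auto

lemma mu_le_support:
  "(\<And>i. i \<in> {1..n} \<Longrightarrow> k i \<noteq> 0 \<Longrightarrow> i \<le> v) \<Longrightarrow> mu a n k \<le> a * v"
proof (induction a n k rule: mu.induct)
  case (3 a n k)
  show ?case
  proof (cases "k (Suc n) = 0")
    case False
    then have "Suc n \<le> v" using "3.prems" by simp
    moreover have "mu a n k \<le> a * v" using 3 False by simp
    ultimately show ?thesis using False by simp
  qed (use 3 in simp)
qed auto

text \<open>Digits at positions smaller than \<open>lev a n k\<close> have no influence, which
  allows passing from a frequency to its \<open>head\<close>.\<close>

lemma lev_mu_cong:
  "(\<And>i. i \<in> {1..n} \<Longrightarrow> lev a n k \<le> i \<Longrightarrow> k' i = k i) \<Longrightarrow> lev a n k' = lev a n k \<and> mu a n k' = mu a n k"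
proof (induction a n k rule: lev.induct)
  case (3 a n k)
  show ?case
  proof (cases "k (Suc n) = 0")
    case True
    have "lev (Suc a) n k \<le> Suc n" using lev_le .
    then have "k' (Suc n) = 0" using "3.prems"[of "Suc n"] True by simp
    then show ?thesis using 3 True by simp
  next
    case False
    have "k' (Suc n) = k (Suc n)" using "3.prems"[of "Suc n"] lev_le[of a n k] False by simp
    then show ?thesis using 3 False by simp
  qed
qed auto

text \<open>The net property selects rows by decreasing lists. Listing the nonzero positions from
  the top serves all \<open>a\<close> at once, because the induction puts a new position in
  front.\<close>

lemma mu_enumeration:
  "\<exists>v i. (\<forall>l\<in>{1..v}. i l \<in> {1..n}) \<and> (\<forall>l l'. 1 \<le> l \<and> l < l' \<and> l' \<le> v \<longrightarrow> i l' < i l) \<and>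
     i ` {1..v} = {p\<in>{1..n}. k p \<noteq> 0} \<and> (\<forall>a. (\<Sum>l=1..min a v. i l) = mu a n k)"
proof (induction n)
  case 0
  have "mu a 0 k = 0" for a by (cases a) auto
  then show ?case by (intro exI[of _ 0]) auto
next
  case (Suc n)
  then obtain v i where vi: "\<forall>l\<in>{1..v}. i l \<in> {1..n}" "\<forall>l l'. 1 \<le> l \<and> l < l' \<and> l' \<le> v \<longrightarrow> i l' < i l"
     "i ` {1..v} = {p\<in>{1..n}. k p \<noteq> 0}" "\<And>a. (\<Sum>l=1..min a v. i l) = mu a n k"
    by blast
  show ?case
  proof (cases "k (Suc n) = 0")
    case True
    have "mu a (Suc n) k = mu a n k" for a using True by (cases a) auto
    moreover have "{p\<in>{1..Suc n}. k p \<noteq> 0} = {p\<in>{1..n}. k p \<noteq> 0}"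
      using True by (auto simp: le_Suc_eq)
    ultimately show ?thesis
      using vi by (intro exI[of _ v] exI[of _ i]) (auto simp: le_Suc_eq)
  next
    case False
    define i' where "i' l = (if l = 1 then Suc n else i (l - 1))" for l
    have range: "\<forall>l\<in>{1..Suc v}. i' l \<in> {1..Suc n}"
    proof
      fix l assume l: "l \<in> {1..Suc v}"
      show "i' l \<in> {1..Suc n}"
      proof (cases "l = 1")
        case False
        then have "l - 1 \<in> {1..v}" using l by auto
        then have "i (l - 1) \<in> {1..n}" using vi(1) by blast
        then show ?thesis using False by (simp add: i'_def)
      qed (simp add: i'_def)
    qed
    have dec: "i' l' < i' l" if "1 \<le> l" "l < l'" "l' \<le> Suc v" for l l'
    proof (cases "l = 1")
      case True
      have "l' - 1 \<in> {1..v}" using that by auto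
      then have "i (l' - 1) \<in> {1..n}" using vi(1) by blast
      then show ?thesis using True that by (simp add: i'_def)
    next
      case False
      then have "1 \<le> l - 1 \<and> l - 1 < l' - 1 \<and> l' - 1 \<le> v" using that by auto
      then have "i (l' - 1) < i (l - 1)" using vi(2) by blast
      then show ?thesis using False that by (simp add: i'_def)
    qed
    have "{1..Suc v} = insert 1 (Suc ` {1..v})"
      by (auto simp: image_Suc_atLeastAtMost)
    then have "i' ` {1..Suc v} = insert (i' 1) ((\<lambda>l. i' (Suc l)) ` {1..v})"
      by (simp only: image_insert image_image)
    also have "(\<lambda>l. i' (Suc l)) ` {1..v} = i ` {1..v}"
      by (rule image_cong) (auto simp: i'_def)
    finally have "i' ` {1..Suc v} = insert (Suc n) (i ` {1..v})"
      by (simp add: i'_def)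
    then have img: "i' ` {1..Suc v} = {p\<in>{1..Suc n}. k p \<noteq> 0}"
      unfolding vi(3) using False by (auto simp: le_Suc_eq)
    have "(\<Sum>l=1..min a (Suc v). i' l) = mu a (Suc n) k" for a
    proof (cases a)
      case (Suc a')
      have "(\<Sum>l=1..min a (Suc v). i' l) = (\<Sum>l=1..Suc (min a' v). i' l)" by (simp add: Suc)
      also have "\<dots> = i' 1 + (\<Sum>l=Suc 1..Suc (min a' v). i' l)"
        by (rule sum.atLeast_Suc_atMost) simp
      also have "(\<Sum>l=Suc 1..Suc (min a' v). i' l) = (\<Sum>l=1..min a' v. i l)"
        unfolding sum.shift_bounds_cl_Suc_ivl by (simp add: i'_def)
      finally show ?thesis using False vi(4)[of a'] by (simp add: Suc i'_def)
    qed simp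
    then show ?thesis
      using range dec img by (intro exI[of _ "Suc v"] exI[of _ i']) blast
  qed
qed

text \<open>The minimum distance of the dual net: nonzero digits of \<open>k\<close> would be the
  coefficients of a linear relation between rows that the net property declares independent.\<close>

lemma dual_min_dist:
  assumes net: "net_rows b \<beta> t m s n C" and u: "u \<subseteq> {1..s}"
    and k: "\<And>j i. j \<in> u \<Longrightarrow> i \<in> {1..n} \<Longrightarrow> k j i < b"
    and dual: "\<And>p. p < m \<Longrightarrow> [(\<Sum>j\<in>u. \<Sum>i=1..n. k j i * C j i p) = 0] (mod b)"
    and small: "(\<Sum>j\<in>u. mu \<beta> n (k j)) \<le> \<beta> * m - t"
    and ji: "j \<in> u" "i \<in> {1..n}"
  shows "k j i = 0"
proof -
  \<comment> \<open>Extended by zero: the net property selects rows in all coordinates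
    \<open>1..s\<close>, and none are to be selected outside \<open>u\<close>.\<close>
  define k0 where "k0 j = (if j \<in> u then k j else (\<lambda>_. 0))" for j
  have "\<forall>j. \<exists>v i. (\<forall>l\<in>{1..v}. i l \<in> {1..n}) \<and> (\<forall>l l'. 1 \<le> l \<and> l < l' \<and> l' \<le> v \<longrightarrow> i l' < i l) \<and>
     i ` {1..v} = {p\<in>{1..n}. k0 j p \<noteq> 0} \<and> (\<forall>a. (\<Sum>l=1..min a v. i l) = mu a n (k0 j))"
    by (intro allI mu_enumeration)
  then obtain v where "\<forall>j. \<exists>i. (\<forall>l\<in>{1..v j}. i l \<in> {1..n}) \<and> (\<forall>l l'. 1 \<le> l \<and> l < l' \<and> l' \<le> v j \<longrightarrow> i l' < i l) \<and>
     i ` {1..v j} = {p\<in>{1..n}. k0 j p \<noteq> 0} \<and> (\<forall>a. (\<Sum>l=1..min a (v j). i l) = mu a n (k0 j))"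
    by (rule choice[THEN exE])
  then obtain I where I: "\<forall>j. (\<forall>l\<in>{1..v j}. I j l \<in> {1..n}) \<and> (\<forall>l l'. 1 \<le> l \<and> l < l' \<and> l' \<le> v j \<longrightarrow> I j l' < I j l) \<and>
     I j ` {1..v j} = {p\<in>{1..n}. k0 j p \<noteq> 0} \<and> (\<forall>a. (\<Sum>l=1..min a (v j). I j l) = mu a n (k0 j))"
    by (rule choice[THEN exE])
  have "(\<Sum>j=1..s. \<Sum>l=1..min \<beta> (v j). I j l) = (\<Sum>j=1..s. mu \<beta> n (k0 j))"
    using I by simp
  also have "\<dots> = (\<Sum>j\<in>u. mu \<beta> n (k j))"
    by (rule sum.mono_neutral_cong_right) (use u in \<open>auto simp: k0_def intro: mu_zero\<close>)
  finally have sum_le: "(\<Sum>j=1..s. \<Sum>l=1..min \<beta> (v j). I j l) \<le> \<beta> * m - t"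
    using small by simp
  have indep: "lin_indep_mod b m (SIGMA j:{1..s}. {1..v j}) (\<lambda>(j, l). C j (I j l))"
    by (rule net[unfolded net_rows_def, rule_format]) (use I sum_le in simp_all)
  have inj: "inj_on (I j) {1..v j}" for j
  proof (rule linorder_inj_onI)
    fix x y assume "x < y" "x \<in> {1..v j}" "y \<in> {1..v j}"
    moreover have "\<forall>l l'. 1 \<le> l \<and> l < l' \<and> l' \<le> v j \<longrightarrow> I j l' < I j l" using I by blast
    ultimately have "I j y < I j x" by simp
    then show "I j x \<noteq> I j y" by simp
  qed linarith
  have "(\<Sum>q\<in>(SIGMA j:{1..s}. {1..v j}). (\<lambda>(j, l). k0 j (I j l)) q * (\<lambda>(j, l). C j (I j l)) q p)
      = (\<Sum>j\<in>u. \<Sum>i=1..n. k j i * C j i p)" for p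
  proof -
    have "(\<Sum>q\<in>(SIGMA j:{1..s}. {1..v j}). (\<lambda>(j, l). k0 j (I j l)) q * (\<lambda>(j, l). C j (I j l)) q p)
       = (\<Sum>j\<in>{1..s}. \<Sum>l\<in>{1..v j}. k0 j (I j l) * C j (I j l) p)"
      by (subst sum.Sigma) (auto simp: case_prod_unfold)
    also have "\<dots> = (\<Sum>j\<in>{1..s}. \<Sum>i=1..n. k0 j i * C j i p)"
    proof (rule sum.cong[OF refl])
      fix j
      have "(\<Sum>l\<in>{1..v j}. k0 j (I j l) * C j (I j l) p) = (\<Sum>i\<in>I j ` {1..v j}. k0 j i * C j i p)"
        by (subst sum.reindex[OF inj]) simp
      also have "I j ` {1..v j} = {p\<in>{1..n}. k0 j p \<noteq> 0}" using I by blast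
      also have "(\<Sum>i\<in>{p\<in>{1..n}. k0 j p \<noteq> 0}. k0 j i * C j i p) = (\<Sum>i=1..n. k0 j i * C j i p)"
        by (rule sum.mono_neutral_left) auto
      finally show "(\<Sum>l\<in>{1..v j}. k0 j (I j l) * C j (I j l) p) = (\<Sum>i=1..n. k0 j i * C j i p)" .
    qed
    also have "\<dots> = (\<Sum>j\<in>u. \<Sum>i=1..n. k j i * C j i p)"
      by (rule sum.mono_neutral_cong_right) (use u in \<open>auto simp: k0_def\<close>)
    finally show ?thesis .
  qed
  then have comb: "\<forall>p<m. [(\<Sum>q\<in>(SIGMA j:{1..s}. {1..v j}). (\<lambda>(j, l). k0 j (I j l)) q * (\<lambda>(j, l). C j (I j l)) q p) = 0] (mod b)"
    using dual by simp
  have less: "\<forall>q\<in>(SIGMA j:{1..s}. {1..v j}). (\<lambda>(j, l). k0 j (I j l)) q < b"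
    using I k b_pos by (auto simp: k0_def)
  have zero: "\<forall>q\<in>(SIGMA j:{1..s}. {1..v j}). (\<lambda>(j, l). k0 j (I j l)) q = 0"
    using comb less by (intro indep[unfolded lin_indep_mod_def, THEN spec, THEN mp] conjI)
  show ?thesis
  proof (rule ccontr)
    assume "k j i \<noteq> 0"
    then have "i \<in> I j ` {1..v j}" using I ji by (auto simp: k0_def)
    then obtain l where l: "l \<in> {1..v j}" "i = I j l" by blast
    then have "k0 j (I j l) = 0" using bspec[OF zero, of "(j, l)"] u ji by auto
    then show False using ji l \<open>k j i \<noteq> 0\<close> by (simp add: k0_def)
  qed
qed

definition digits :: "nat \<Rightarrow> (nat \<Rightarrow> nat) set" where
  "digits n = PiE {1..n} (\<lambda>_. {..<b})"

text \<open>The kernel of the map that takes \<open>k\<close> to the sum of the vectors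
  \<open>C\<^sub>j\<^sup>T k\<^sub>j\<close>, \<open>j \<in> u\<close>, over the field with
  \<open>b\<close> elements; equivalently, the frequencies whose product character is trivial on the
  net.\<close>

definition dual :: "nat \<Rightarrow> nat \<Rightarrow> (nat \<Rightarrow> nat \<Rightarrow> nat \<Rightarrow> nat) \<Rightarrow> nat set \<Rightarrow> (nat \<Rightarrow> nat \<Rightarrow> nat) set" where
  "dual n m C u = {k \<in> PiE u (\<lambda>_. digits n). \<forall>p<m. [(\<Sum>j\<in>u. \<Sum>i=1..n. k j i * C j i p) = 0] (mod b)}"

lemma finite_digits [simp, intro]: "finite (digits n)"
  by (simp add: digits_def finite_PiE)

lemma digits_less: "k \<in> digits n \<Longrightarrow> i \<in> {1..n} \<Longrightarrow> k i < b"
  by (auto simp: digits_def)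

lemma finite_dual: "finite u \<Longrightarrow> finite (dual n m C u)"
  by (simp add: dual_def finite_PiE)

text \<open>
  A difference of two elements of \<open>S\<close> that agree on the positions between \<open>v\<close> and \<open>l\<close> is supported on
  \<open>\<Sum>v \<le> m - t\<close> leading positions, so it vanishes.
\<close>

lemma card_dual_fiber:
  assumes net: "net_rows b \<beta> t m s n C" and u: "u \<subseteq> {1..s}" and \<beta>: "\<beta> \<ge> 1"
    and S: "S \<subseteq> dual n m C u" and l: "\<And>j. j \<in> u \<Longrightarrow> l j \<le> n"
    and agree: "\<And>k k' j i. k \<in> S \<Longrightarrow> k' \<in> S \<Longrightarrow> j \<in> u \<Longrightarrow> i \<in> {1..n} \<Longrightarrow> l j \<le> i \<Longrightarrow> k j i = k' j i"
  shows "card S \<le> b ^ ((\<Sum>j\<in>u. l j) + t - m)"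
proof -
  have fin: "finite u" using u finite_subset by blast
  define L where "L = (\<Sum>j\<in>u. l j)"
  \<comment> \<open>A difference supported on the positions up to \<open>v j\<close> has
    \<open>mu \<beta>\<close> summing to at most
    \<open>\<beta> * (m - t) \<le> \<beta> * m - t\<close>, so these positions need not be recorded.
    The digits between \<open>v j\<close> and \<open>l j\<close> determine the element, and their
    number gives the exponent.\<close>
  obtain v where v: "\<And>j. j \<in> u \<Longrightarrow> v j \<le> l j" "(\<Sum>j\<in>u. v j) = min L (m - t)"
    using exists_sum_eq[OF fin, of "min L (m - t)" l] by (auto simp: L_def)
  define T where "T = PiE u (\<lambda>j. PiE {v j<..l j} (\<lambda>_. {..<b}))"
  define f where "f k = (\<lambda>j\<in>u. \<lambda>i\<in>{v j<..l j}. k j i)" for k :: "nat \<Rightarrow> nat \<Rightarrow> nat"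
  have finT: "finite T" unfolding T_def by (intro finite_PiE fin) auto
  have digit: "k j i < b" if "k \<in> dual n m C u" "j \<in> u" "i \<in> {1..n}" for k j i
    using that digits_less by (auto simp: dual_def PiE_iff)
  have "f ` S \<subseteq> T"
  proof
    fix y assume "y \<in> f ` S"
    then obtain k where k: "k \<in> S" "y = f k" by blast
    have "k j i < b" if "j \<in> u" "i \<in> {v j<..l j}" for i j
      using digit[of k j i] k S l[OF that(1)] that by auto
    then show "y \<in> T" unfolding k T_def f_def by auto
  qed
  moreover have "inj_on f S"
  proof (rule inj_onI)
    fix k k' assume k: "k \<in> S" "k' \<in> S" "f k = f k'"
    have kD: "k \<in> dual n m C u" "k' \<in> dual n m C u" using k S by auto
    have eq: "k j i = k' j i" if "j \<in> u" "i \<in> {1..n}" "v j < i" for j i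
    proof (cases "i \<le> l j")
      case True
      then show ?thesis
        using fun_cong[OF fun_cong[OF k(3), of j], of i] that by (simp add: f_def)
    next
      case False
      then show ?thesis using agree[OF k(1,2) that(1,2)] by simp
    qed
    define d where "d j i = (k j i + (b - k' j i)) mod b" for j i
    have d0: "d j i = 0" if "j \<in> u" "i \<in> {1..n}" for j i
    proof (rule dual_min_dist[OF net u _ _ _ that, of d])
      show "d j i < b" for j i using b_pos by (simp add: d_def)
      show "[(\<Sum>j\<in>u. \<Sum>i=1..n. d j i * C j i p) = 0] (mod b)" if "p < m" for p
      proof -
        have "[(\<Sum>j\<in>u. \<Sum>i=1..n. d j i * C j i p) + (\<Sum>j\<in>u. \<Sum>i=1..n. k' j i * C j i p)
           = (\<Sum>j\<in>u. \<Sum>i=1..n. k j i * C j i p)] (mod b)"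
        proof -
          have "[d j i * C j i p + k' j i * C j i p = k j i * C j i p] (mod b)" if "j \<in> u" "i \<in> {1..n}" for j i
          proof -
            have "[d j i + k' j i = (k j i + (b - k' j i)) + k' j i] (mod b)"
              unfolding d_def by (simp add: cong_def mod_add_left_eq)
            also have "(k j i + (b - k' j i)) + k' j i = k j i + b"
              using digit[OF kD(2) that] by simp
            also have "[k j i + b = k j i] (mod b)" by (simp add: cong_def)
            finally show ?thesis
              unfolding distrib_right[symmetric] by (rule cong_mult) simp
          qed
          then show ?thesis
            unfolding sum.distrib[symmetric] by (intro cong_sum) auto
        qed
        moreover have "[(\<Sum>j\<in>u. \<Sum>i=1..n. k' j i * C j i p) = 0] (mod b)" "[(\<Sum>j\<in>u. \<Sum>i=1..n. k j i * C j i p) = 0] (mod b)"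
          using kD that by (auto simp: dual_def)
        ultimately show ?thesis
          using cong_dvd_iff dvd_add_left_iff unfolding cong_0_iff by blast
      qed
      have "mu \<beta> n (d j) \<le> \<beta> * v j" if "j \<in> u" for j
      proof (rule mu_le_support)
        fix i assume i: "i \<in> {1..n}" "d j i \<noteq> 0"
        show "i \<le> v j"
        proof (rule ccontr)
          assume "\<not> i \<le> v j"
          then have "k j i = k' j i" using eq[OF that i(1)] by simp
          then show False using i digit[OF kD(2) that i(1)] by (simp add: d_def)
        qed
      qed
      then have "(\<Sum>j\<in>u. mu \<beta> n (d j)) \<le> \<beta> * (\<Sum>j\<in>u. v j)"
        unfolding sum_distrib_left by (rule sum_mono)
      also have "\<dots> \<le> \<beta> * (m - t)" using v(2) by simp
      also have "\<dots> \<le> \<beta> * m - t"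
        using \<beta> by (simp add: diff_mult_distrib2 diff_le_mono2)
      finally show "(\<Sum>j\<in>u. mu \<beta> n (d j)) \<le> \<beta> * m - t" .
    qed
    have same: "k j i = k' j i" if "j \<in> u" "i \<in> {1..n}" for j i
    proof -
      have "k j i < b" "k' j i < b" using digit kD that by auto
      moreover have "b dvd k j i + (b - k' j i)" using d0[OF that] by (simp add: d_def dvd_eq_mod_eq_0)
      ultimately have "[k j i + (b - k' j i) + k' j i = 0 + k' j i] (mod b)"
        by (intro cong_add cong_refl) (simp add: cong_0_iff)
      then have "[k j i = k' j i] (mod b)"
        using \<open>k' j i < b\<close> by (simp add: cong_def)
      then show ?thesis using \<open>k j i < b\<close> \<open>k' j i < b\<close> by (simp add: cong_def)
    qed
    have kP: "k \<in> PiE u (\<lambda>_. digits n)" "k' \<in> PiE u (\<lambda>_. digits n)"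
      using kD by (simp_all add: dual_def)
    show "k = k'"
    proof (rule PiE_ext[OF kP])
      fix j assume j: "j \<in> u"
      have "k j \<in> PiE {1..n} (\<lambda>_. {..<b})" "k' j \<in> PiE {1..n} (\<lambda>_. {..<b})"
        using kP j by (auto simp: digits_def)
      then show "k j = k' j"
        by (rule PiE_ext) (rule same[OF j])
    qed
  qed
  ultimately have "card S \<le> card T" using card_inj_on_le finT by blast
  also have "card T = (\<Prod>j\<in>u. b ^ (l j - v j))"
    unfolding T_def by (simp add: card_PiE fin)
  also have "\<dots> = b ^ (\<Sum>j\<in>u. l j - v j)" by (simp add: power_sum)
  also have "(\<Sum>j\<in>u. l j - v j) = L - min L (m - t)"
    using v by (subst sum_subtractf_nat) (auto simp: L_def)
  also have "b ^ (L - min L (m - t)) \<le> b ^ (L + t - m)"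
    using b_pos by (intro power_increasing) auto
  finally show ?thesis unfolding L_def .
qed

end

text \<open>
  The periodic extension of \<open>B\<^sub>2\<^sub>a\<close> is a polynomial of degree \<open>2 a\<close> away from the integers, where its
  differences of order \<open>2 a\<close> are constant. Only the \<open>2 a\<close> windows that cross an integer see the
  truncated power.
\<close>

lemma sum_fdiff_bernpoly:
  assumes a: "a \<ge> 1"
  shows "\<exists>C>0. \<forall>M::nat. M \<ge> 2 * a \<longrightarrow>
    (\<Sum>d\<in>{0..<int M}. \<bar>(fdiff ^^ (2 * a)) (\<lambda>d. bernpoly (2 * a) (real_of_int (d mod int M) / real M)) d\<bar>)
      \<le> C / real M ^ (2 * a - 1)"
proof -
  define r where "r = 2 * a"
  \<comment> \<open>\<open>M\<close> windows contribute \<open>fact r / M ^ r\<close> each. In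
    addition \<open>r\<close> windows contribute at most \<open>r / M ^ (r - 1)\<close> times
    \<open>2 ^ r\<close> times the largest truncated power \<open>r ^ (r - 1)\<close>.\<close>
  define C where "C = fact r + real r * (real r * (2 ^ r * real r ^ (r - 1)))"
  have r: "r \<ge> 2" using a by (simp add: r_def)
  have Cpos: "C > 0" unfolding C_def by (intro add_pos_nonneg) auto
  have "(\<Sum>d\<in>{0..<int M}. \<bar>(fdiff ^^ r) (\<lambda>d. bernpoly r (real_of_int (d mod int M) / real M)) d\<bar>)
      \<le> C / real M ^ (r - 1)" if M: "M \<ge> r" for M :: nat
  proof -
    have M0: "M > 0" using M r by simp
    define G where "G d = bernpoly r (real_of_int (d mod int M) / real M)" for d
    define h where "h e = real_of_int (min e 0) ^ (r - 1)" for e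
    have per: "G (x + int M) = G x" for x by (simp add: G_def)
    have G_eq: "G e = bernpoly r (real_of_int e / real M) + real r / real M ^ (r - 1) * h e"
      if "- int M \<le> e" "e < int M" for e
    proof (cases "e \<ge> 0")
      case True
      then show ?thesis using that r by (simp add: G_def h_def)
    next
      case False
      have "(e + int M) mod int M = e + int M"
        by (rule mod_pos_pos_trivial) (use that False in auto)
      then have "e mod int M = e + int M" by simp
      then have "G e = bernpoly r (real_of_int e / real M + 1)"
        using M0 by (simp add: G_def add_divide_distrib)
      also have "\<dots> = bernpoly r (real_of_int e / real M) + real r * (real_of_int e / real M) ^ (r - 1)"
        using bernpoly_diff[of r "real_of_int e / real M"] by simp
      finally show ?thesis using False by (simp add: h_def min_def power_divide)
    qed
    have poly: "(fdiff ^^ r) (\<lambda>e. bernpoly r (real_of_int e / real M)) d = fact r / real M ^ r" for d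
    proof -
      have "(\<lambda>e. bernpoly r (real_of_int e / real M)) =
          (\<lambda>e. \<Sum>k\<le>r. (real (r choose k) * bernoulli k / real M ^ (r - k)) * real_of_int e ^ (r - k))"
        by (simp add: bernpoly_def power_divide)
      then have "(fdiff ^^ r) (\<lambda>e. bernpoly r (real_of_int e / real M)) d
        = (\<Sum>k\<le>r. (real (r choose k) * bernoulli k / real M ^ (r - k)) * (fdiff ^^ r) (\<lambda>e. real_of_int e ^ (r - k)) d)"
        by (simp only: fdiff_pow_sum[OF finite_atMost])
      also have "\<dots> = (\<Sum>k\<le>r. if k = 0 then fact r / real M ^ r else 0)"
      proof (rule sum.cong[OF refl])
        fix k assume "k \<in> {..r}"
        then show "(real (r choose k) * bernoulli k / real M ^ (r - k)) * (fdiff ^^ r) (\<lambda>e. real_of_int e ^ (r - k)) d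
          = (if k = 0 then fact r / real M ^ r else 0)"
          using fdiff_pow_monomial[of "r - k" r] by (cases "k = 0") auto
      qed
      finally show ?thesis by simp
    qed
    \<comment> \<open>The period is taken from \<open>- r\<close> to \<open>M - r\<close>: as
      \<open>M \<ge> r\<close>, all windows from \<open>d\<close> to \<open>d + r\<close> stay
      inside the range of \<open>G_eq\<close>, and those that see the truncated power are the ones
      with \<open>d < 0\<close>.\<close>
    have bound: "\<bar>(fdiff ^^ r) G d\<bar> \<le> fact r / real M ^ r +
        (if d < 0 then real r / real M ^ (r - 1) * (2 ^ r * real r ^ (r - 1)) else 0)"
      if d: "d \<in> {- int r..<int M - int r}" for d
    proof -
      have "(fdiff ^^ r) G d = (fdiff ^^ r) (\<lambda>e. bernpoly r (real_of_int e / real M) + real r / real M ^ (r - 1) * h e) d"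
        by (rule fdiff_pow_cong, rule G_eq) (use d M in auto)
      also have "\<dots> = fact r / real M ^ r + real r / real M ^ (r - 1) * (fdiff ^^ r) h d"
        by (simp only: fdiff_pow_linear poly)
      finally have eq: "(fdiff ^^ r) G d = fact r / real M ^ r + real r / real M ^ (r - 1) * (fdiff ^^ r) h d" .
      have "\<bar>(fdiff ^^ r) h d\<bar> \<le> (if d < 0 then 2 ^ r * real r ^ (r - 1) else 0)"
      proof (cases "d < 0")
        case True
        have "\<bar>(fdiff ^^ r) h d\<bar> \<le> 2 ^ r * real r ^ (r - 1)"
        proof (rule fdiff_pow_bound)
          fix e assume "d \<le> e" "e \<le> d + int r"
          then have "\<bar>min e 0\<bar> \<le> int r" using d by auto
          then have "\<bar>real_of_int (min e 0)\<bar> \<le> real r" by linarith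
          then show "\<bar>h e\<bar> \<le> real r ^ (r - 1)"
            unfolding h_def power_abs by (rule power_mono) simp
        qed
        with True show ?thesis by simp
      next
        case False
        have "(fdiff ^^ r) h d = (fdiff ^^ r) (\<lambda>x. 0) d"
          by (rule fdiff_pow_cong) (use False r in \<open>auto simp: h_def\<close>)
        with False show ?thesis by (simp add: fdiff_pow_zero)
      qed
      then have "\<bar>real r / real M ^ (r - 1) * (fdiff ^^ r) h d\<bar>
        \<le> real r / real M ^ (r - 1) * (if d < 0 then 2 ^ r * real r ^ (r - 1) else 0)"
        by (simp only: abs_mult) (intro mult_mono; simp)
      then show ?thesis
        unfolding eq using abs_triangle_ineq[of "fact r / real M ^ r" "real r / real M ^ (r - 1) * (fdiff ^^ r) h d"]
        by (simp split: if_splits)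
    qed
    have "(\<Sum>d\<in>{0..<int M}. \<bar>(fdiff ^^ r) G d\<bar>) = (\<Sum>d\<in>{0..<int M}. \<bar>(fdiff ^^ r) G (d + (- int r))\<bar>)"
      by (rule sum_periodic_shift[symmetric, where f = "\<lambda>d. \<bar>(fdiff ^^ r) G d\<bar>"])
        (use M0 fdiff_pow_periodic[of G "int M", OF per] in auto)
    also have "\<dots> = (\<Sum>d\<in>{- int r..<int M - int r}. \<bar>(fdiff ^^ r) G d\<bar>)"
      by (rule sum.reindex_bij_witness[of _ "\<lambda>d. d + int r" "\<lambda>d. d - int r"]) auto
    also have "\<dots> \<le> (\<Sum>d\<in>{- int r..<int M - int r}. fact r / real M ^ r +
        (if d < 0 then real r / real M ^ (r - 1) * (2 ^ r * real r ^ (r - 1)) else 0))"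
      by (intro sum_mono bound)
    also have "\<dots> = real M * (fact r / real M ^ r) + (\<Sum>d\<in>{- int r..<int M - int r}.
        (if d < 0 then real r / real M ^ (r - 1) * (2 ^ r * real r ^ (r - 1)) else 0))"
      by (simp add: sum.distrib)
    also have "(\<Sum>d\<in>{- int r..<int M - int r}.
        (if d < 0 then real r / real M ^ (r - 1) * (2 ^ r * real r ^ (r - 1)) else 0))
      = (\<Sum>d\<in>{- int r..<0}. real r / real M ^ (r - 1) * (2 ^ r * real r ^ (r - 1)))"
      by (rule sum.mono_neutral_cong_right) (use M in auto)
    also have "\<dots> = real r * (real r / real M ^ (r - 1) * (2 ^ r * real r ^ (r - 1)))"
      by simp
    also have "real M * (fact r / real M ^ r) = fact r / real M ^ (r - 1)"
      using M0 r power_minus_mult[of r "real M"] by (simp add: field_simps)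
    also have "fact r / real M ^ (r - 1) + real r * (real r / real M ^ (r - 1) * (2 ^ r * real r ^ (r - 1)))
       = C / real M ^ (r - 1)"
      by (simp add: C_def add_divide_distrib)
    finally show ?thesis unfolding G_def .
  qed
  with Cpos show ?thesis unfolding r_def by blast
qed

section \<open>Character coefficients of the kernel on a grid\<close>

context digit_base
begin

text \<open>The Fourier coefficient of the kernel on the grid with offset \<open>\<tau>\<close>,
  with the same frequency in both arguments. Only these diagonal coefficients survive the average
  over digital shifts.\<close>

definition kern_coeff :: "nat \<Rightarrow> nat \<Rightarrow> real \<Rightarrow> (nat \<Rightarrow> nat) \<Rightarrow> complex" where
  "kern_coeff a n \<tau> k = (\<Sum>X<b ^ n. \<Sum>Y<b ^ n.
     of_real (kern a ((real X + \<tau>) / real (b ^ n)) ((real Y + \<tau>) / real (b ^ n)))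
       * cnj (chi n k (int X)) * chi n k (int Y)) / of_nat (b ^ n) ^ 2"

lemma bernpoly_coeff_bound:
  "\<exists>C>0. \<forall>n k \<tau>. \<tau> \<in> {0..1} \<longrightarrow> (\<forall>i\<in>{1..n}. k i < b) \<longrightarrow>
     norm ((\<Sum>X<b ^ n. of_real (bernpoly r ((real X + \<tau>) / real (b ^ n))) * chi n k (int X)) / of_nat (b ^ n))
       \<le> C / real b ^ mu a n k"
proof -
  define K where "K = (2 ^ r * real b) ^ a"
  define C where "C = (\<Sum>j\<le>r. \<bar>real (r choose j) * bernoulli j\<bar>) * K + 1"
  have K: "K \<ge> 0" by (simp add: K_def)
  have "norm ((\<Sum>X<b ^ n. of_real (bernpoly r ((real X + \<tau>) / real (b ^ n))) * chi n k (int X)) / of_nat (b ^ n))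
       \<le> C / real b ^ mu a n k" if \<tau>: "\<tau> \<in> {0..1}" and k: "\<forall>i\<in>{1..n}. k i < b" for n k \<tau>
  proof -
    define m where "m p = (\<Sum>X<b ^ n. of_real (((real X + \<tau>) / real (b ^ n)) ^ p) * chi n k (int X)) / of_nat (b ^ n)" for p
    have m: "norm (m p) \<le> K / real b ^ mu a n k" if "p \<le> r" for p
      unfolding m_def K_def by (rule moment_bound[OF \<tau> that]) (use k in simp)
    have "(\<Sum>X<b ^ n. of_real (bernpoly r ((real X + \<tau>) / real (b ^ n))) * chi n k (int X))
       = (\<Sum>X<b ^ n. \<Sum>j\<le>r. of_real (real (r choose j) * bernoulli j) * (of_real (((real X + \<tau>) / real (b ^ n)) ^ (r - j)) * chi n k (int X)))"
      unfolding bernpoly_def of_real_sum sum_distrib_right of_real_mult by (simp only: mult_ac)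
    also have "\<dots> = (\<Sum>j\<le>r. of_real (real (r choose j) * bernoulli j) * (\<Sum>X<b ^ n. of_real (((real X + \<tau>) / real (b ^ n)) ^ (r - j)) * chi n k (int X)))"
      unfolding sum_distrib_left by (rule sum.swap)
    finally have "(\<Sum>X<b ^ n. of_real (bernpoly r ((real X + \<tau>) / real (b ^ n))) * chi n k (int X)) / of_nat (b ^ n)
       = (\<Sum>j\<le>r. of_real (real (r choose j) * bernoulli j) * m (r - j))"
      by (simp only: m_def sum_divide_distrib[of _ "{..r}"] times_divide_eq_right)
    also have "norm \<dots> \<le> (\<Sum>j\<le>r. \<bar>real (r choose j) * bernoulli j\<bar> * (K / real b ^ mu a n k))"
      by (rule sum_norm_le) (simp only: norm_mult norm_of_real, intro mult_left_mono m, auto)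
    also have "\<dots> = (\<Sum>j\<le>r. \<bar>real (r choose j) * bernoulli j\<bar>) * K / real b ^ mu a n k"
      by (simp only: sum_distrib_right sum_divide_distrib times_divide_eq_right)
    also have "\<dots> \<le> C / real b ^ mu a n k"
      by (intro divide_right_mono) (auto simp: C_def)
    finally show ?thesis .
  qed
  moreover have "C > 0" unfolding C_def
    by (intro add_nonneg_pos mult_nonneg_nonneg sum_nonneg K) auto
  ultimately show ?thesis by blast
qed

text \<open>With \<open>M = b ^ n\<close>, two antiderivatives of size
  \<open>M ^ a / b ^ mu a n k\<close>, a factor \<open>M\<close> and differences of total size
  \<open>1 / M ^ (2 * a - 1)\<close> leave \<open>M ^ 2\<close>, which the normalisation removes.
  The zero frequency is excluded because a constant character has no periodic
  antiderivative.\<close>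

lemma bernpoly_even_coeff_bound:
  assumes a: "a \<ge> 1"
  shows "\<exists>C>0. \<forall>n k \<tau>. b ^ n \<ge> 2 * a \<longrightarrow> (\<forall>i\<in>{1..n}. k i < b) \<longrightarrow> (\<exists>i\<in>{1..n}. k i \<noteq> 0) \<longrightarrow>
     norm ((\<Sum>X<b ^ n. \<Sum>Y<b ^ n. of_real (bernpoly (2 * a) \<bar>(real X + \<tau>) / real (b ^ n) - (real Y + \<tau>) / real (b ^ n)\<bar>)
        * cnj (chi n k (int X)) * chi n k (int Y)) / of_nat (b ^ n) ^ 2)
       \<le> C / real b ^ (2 * mu a n k)"
proof -
  obtain C where C: "C > 0" and C_sum: "\<And>M::nat. M \<ge> 2 * a \<Longrightarrow>
    (\<Sum>d\<in>{0..<int M}. \<bar>(fdiff ^^ (2 * a)) (\<lambda>d. bernpoly (2 * a) (real_of_int (d mod int M) / real M)) d\<bar>)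
      \<le> C / real M ^ (2 * a - 1)"
    using sum_fdiff_bernpoly[OF a] by blast
  obtain K where K: "K > 0" and K_anti: "\<And>n k. \<forall>i\<in>{1..n::nat}. k i < b \<Longrightarrow> \<exists>i\<in>{1..n}. k i \<noteq> 0 \<Longrightarrow>
      \<exists>u. (\<forall>x. u (x + int (b ^ n)) = u x) \<and> (fdiff ^^ a) u = chi n k \<and>
          (\<forall>x. norm (u x) \<le> K * real (b ^ n) ^ a / real b ^ mu a n k)"
    using chi_antideriv[of a] by metis
  have "norm ((\<Sum>X<b ^ n. \<Sum>Y<b ^ n. of_real (bernpoly (2 * a) \<bar>(real X + \<tau>) / real (b ^ n) - (real Y + \<tau>) / real (b ^ n)\<bar>)
        * cnj (chi n k (int X)) * chi n k (int Y)) / of_nat (b ^ n) ^ 2)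
       \<le> K ^ 2 * C / real b ^ (2 * mu a n k)"
    if size: "b ^ n \<ge> 2 * a" and k: "\<forall>i\<in>{1..n}. k i < b" "\<exists>i\<in>{1..n}. k i \<noteq> 0" for n k \<tau>
  proof -
    define M where "M = b ^ n"
    have M: "M > 0" using b_pos by (simp add: M_def)
    define G where "G d = bernpoly (2 * a) (real_of_int (d mod int M) / real M)" for d
    obtain u where u: "\<And>x. u (x + int M) = u x" "(fdiff ^^ a) u = chi n k"
      "\<And>x. norm (u x) \<le> K * real M ^ a / real b ^ mu a n k"
      using K_anti[OF k] unfolding M_def by blast
    have cnj_anti: "(fdiff ^^ r) (\<lambda>x. cnj (u x)) = (\<lambda>x. cnj ((fdiff ^^ r) u x))" for r
      by (induction r) (auto simp: fdiff_def)
    have "(\<Sum>X<M. \<Sum>Y<M. of_real (bernpoly (2 * a) \<bar>(real X + \<tau>) / real M - (real Y + \<tau>) / real M\<bar>)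
        * cnj (chi n k (int X)) * chi n k (int Y))
      = (\<Sum>x\<in>{0..<int M}. \<Sum>y\<in>{0..<int M}. of_real (G (x - y)) * (fdiff ^^ a) (\<lambda>x. cnj (u x)) x * (fdiff ^^ a) u y)"
      unfolding sum_int_lessThan cnj_anti u(2) G_def
      by (intro sum.cong refl) (simp add: bernpoly_even_abs_mod)
    also have "norm \<dots> \<le> (K * real M ^ a / real b ^ mu a n k) * (K * real M ^ a / real b ^ mu a n k) * of_int (int M)
       * (\<Sum>d\<in>{0..<int M}. \<bar>(fdiff ^^ (2 * a)) G d\<bar>)"
      by (rule summation_by_parts) (use M u in \<open>auto simp: G_def\<close>)
    also have "\<dots> \<le> (K * real M ^ a / real b ^ mu a n k) * (K * real M ^ a / real b ^ mu a n k) * of_int (int M)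
       * (C / real M ^ (2 * a - 1))"
      unfolding G_def using size K by (intro mult_left_mono C_sum) (auto simp: M_def)
    also have "\<dots> = K ^ 2 * C / real b ^ (2 * mu a n k) * real M ^ 2"
    proof -
      have "real M ^ (2 * a - 1) * real M = real M ^ a * real M ^ a"
        using a power_minus_mult[of "2 * a" "real M"] by (simp add: power_add[symmetric] mult_2)
      then have "real M ^ a * real M ^ a * real M / real M ^ (2 * a - 1) = real M ^ 2"
        using M by (simp add: field_simps power2_eq_square)
      then have "K * K * C / (real b ^ mu a n k * real b ^ mu a n k) * (real M ^ a * real M ^ a * real M / real M ^ (2 * a - 1))
        = K * K * C / (real b ^ mu a n k * real b ^ mu a n k) * real M ^ 2"
        by (simp only:)
      then show ?thesis
        by (simp add: power2_eq_square mult_2 power_add mult_ac)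
    qed
    finally show ?thesis
      using M unfolding M_def[symmetric] by (simp add: norm_divide norm_power divide_le_eq)
  qed
  moreover have "K ^ 2 * C > 0" using K C by simp
  ultimately show ?thesis by blast
qed

text \<open>On the diagonal the products of Bernoulli polynomials give squared moduli of
  one-dimensional coefficients, hence \<open>2 * mu a n k\<close>. At the zero frequency
  \<open>mu\<close> gives no decay; the second bound, a quadrature error, takes the place of the
  vanishing double integral of the kernel.\<close>

lemma kern_coeff_bound:
  assumes a: "a \<ge> 1"
  shows "\<exists>D>0. \<forall>n k \<tau>. \<tau> \<in> {0..1} \<longrightarrow> b ^ n \<ge> 2 * a \<longrightarrow> (\<forall>i\<in>{1..n}. k i < b) \<longrightarrow>
     norm (kern_coeff a n \<tau> k) \<le> D / real b ^ (2 * mu a n k) \<and>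
     ((\<forall>i\<in>{1..n}. k i = 0) \<longrightarrow> norm (kern_coeff a n \<tau> k) \<le> D / real (b ^ n))"
proof -
  have "\<forall>r. \<exists>C>0. \<forall>n k \<tau>. \<tau> \<in> {0..1} \<longrightarrow> (\<forall>i\<in>{1..n}. k i < b) \<longrightarrow>
     norm ((\<Sum>X<b ^ n. of_real (bernpoly r ((real X + \<tau>) / real (b ^ n))) * chi n k (int X)) / of_nat (b ^ n))
       \<le> C / real b ^ mu a n k"
    by (rule allI, rule bernpoly_coeff_bound)
  from choice[OF this] obtain P where "\<forall>r. P r > 0 \<and> (\<forall>n k \<tau>. \<tau> \<in> {0..1} \<longrightarrow> (\<forall>i\<in>{1..n}. k i < b) \<longrightarrow>
     norm ((\<Sum>X<b ^ n. of_real (bernpoly r ((real X + \<tau>) / real (b ^ n))) * chi n k (int X)) / of_nat (b ^ n))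
       \<le> P r / real b ^ mu a n k)" ..
  then have P: "\<And>r. P r > 0" and P_bound: "\<And>r n k \<tau>. \<tau> \<in> {0..1} \<Longrightarrow> \<forall>i\<in>{1..n}. k i < b \<Longrightarrow>
     norm ((\<Sum>X<b ^ n. of_real (bernpoly r ((real X + \<tau>) / real (b ^ n))) * chi n k (int X)) / of_nat (b ^ n))
       \<le> P r / real b ^ mu a n k"
    by simp_all
  obtain E where E: "E > 0" and E_bound: "\<And>n k \<tau>. b ^ n \<ge> 2 * a \<Longrightarrow> \<forall>i\<in>{1..n}. k i < b \<Longrightarrow> \<exists>i\<in>{1..n}. k i \<noteq> 0 \<Longrightarrow>
     norm ((\<Sum>X<b ^ n. \<Sum>Y<b ^ n. of_real (bernpoly (2 * a) \<bar>(real X + \<tau>) / real (b ^ n) - (real Y + \<tau>) / real (b ^ n)\<bar>)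
        * cnj (chi n k (int X)) * chi n k (int Y)) / of_nat (b ^ n) ^ 2)
       \<le> E / real b ^ (2 * mu a n k)"
    using bernpoly_even_coeff_bound[OF a] by (elim exE conjE) (rule that, assumption, simp)
  obtain C where C: "C > 0" and C_bound: "\<And>M \<theta> x. M > 0 \<Longrightarrow> \<theta> \<in> {0..1} \<Longrightarrow> x \<in> {0..1} \<Longrightarrow>
     \<bar>(\<Sum>y<M. kern a x ((real y + \<theta>) / real M)) / real M\<bar> \<le> C / real M"
    using kern_quadrature[OF a] by blast
  define D1 where "D1 = (\<Sum>r=1..a. P r ^ 2) + E"
  define D where "D = D1 + C"
  have D1: "D1 > 0" unfolding D1_def by (intro add_nonneg_pos sum_nonneg E) auto
  have main: "norm (kern_coeff a n \<tau> k) \<le> D1 / real b ^ (2 * mu a n k)"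
    if \<tau>: "\<tau> \<in> {0..1}" and size: "b ^ n \<ge> 2 * a" and k: "\<forall>i\<in>{1..n}. k i < b" and nz: "\<exists>i\<in>{1..n}. k i \<noteq> 0" for n k \<tau>
  proof -
    define M where "M = b ^ n"
    define x where "x X = (real X + \<tau>) / real M" for X
    define m where "m r = (\<Sum>X<M. of_real (bernpoly r (x X)) * chi n k (int X)) / of_nat M" for r
    define e where "e = (\<Sum>X<M. \<Sum>Y<M. of_real (bernpoly (2 * a) \<bar>x X - x Y\<bar>)
        * cnj (chi n k (int X)) * chi n k (int Y)) / of_nat M ^ 2"
    have m: "norm (m r) \<le> P r / real b ^ mu a n k" for r
      unfolding m_def x_def M_def by (rule P_bound[OF \<tau> k])
    have e: "norm e \<le> E / real b ^ (2 * mu a n k)"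
      unfolding e_def x_def M_def by (rule E_bound[OF size k nz])
    have "kern_coeff a n \<tau> k = (\<Sum>X<M. \<Sum>Y<M. (\<Sum>r=1..a. of_real (1 / (fact r)\<^sup>2) *
            (of_real (bernpoly r (x X)) * cnj (chi n k (int X))) * (of_real (bernpoly r (x Y)) * chi n k (int Y)))
          + of_real ((-1) ^ (a + 1) / fact (2 * a)) * (of_real (bernpoly (2 * a) \<bar>x X - x Y\<bar>)
        * cnj (chi n k (int X)) * chi n k (int Y))) / of_nat M ^ 2"
    proof -
      have "of_real (kern a (x X) (x Y)) * cnj (chi n k (int X)) * chi n k (int Y)
        = (\<Sum>r=1..a. of_real (1 / (fact r)\<^sup>2) *
            (of_real (bernpoly r (x X)) * cnj (chi n k (int X))) * (of_real (bernpoly r (x Y)) * chi n k (int Y)))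
          + of_real ((-1) ^ (a + 1) / fact (2 * a)) * (of_real (bernpoly (2 * a) \<bar>x X - x Y\<bar>)
        * cnj (chi n k (int X)) * chi n k (int Y))" for X Y
        unfolding kern_def of_real_add distrib_right of_real_sum sum_distrib_right
        by (intro arg_cong2[of _ _ _ _ "(+)"] sum.cong refl) (simp_all add: mult_ac)
      then show ?thesis
        unfolding kern_coeff_def x_def[symmetric] M_def[symmetric] by (simp only:)
    qed
    also have "\<dots> = ((\<Sum>r=1..a. of_real (1 / (fact r)\<^sup>2) *
            (\<Sum>X<M. of_real (bernpoly r (x X)) * cnj (chi n k (int X))) * (\<Sum>Y<M. of_real (bernpoly r (x Y)) * chi n k (int Y)))
         + of_real ((-1) ^ (a + 1) / fact (2 * a)) * (\<Sum>X<M. \<Sum>Y<M. of_real (bernpoly (2 * a) \<bar>x X - x Y\<bar>)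
        * cnj (chi n k (int X)) * chi n k (int Y))) / of_nat M ^ 2"
    proof -
      have "(\<Sum>X<M. \<Sum>Y<M. (\<Sum>r=1..a. c r * A r X * B r Y) + d * F X Y)
        = (\<Sum>r=1..a. c r * (\<Sum>X<M. A r X) * (\<Sum>Y<M. B r Y)) + d * (\<Sum>X<M. \<Sum>Y<M. F X Y)"
        for c :: "nat \<Rightarrow> complex" and A B F d
      proof -
        have "(\<Sum>X<M. \<Sum>Y<M. \<Sum>r=1..a. c r * A r X * B r Y) = (\<Sum>X<M. \<Sum>r=1..a. \<Sum>Y<M. c r * A r X * B r Y)"
          by (rule sum.cong[OF refl], rule sum.swap)
        also have "\<dots> = (\<Sum>r=1..a. \<Sum>X<M. \<Sum>Y<M. c r * A r X * B r Y)"
          by (rule sum.swap)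
        also have "\<dots> = (\<Sum>r=1..a. c r * (\<Sum>X<M. A r X) * (\<Sum>Y<M. B r Y))"
          by (simp only: mult.assoc sum_product) (simp only: sum_distrib_left)
        finally show ?thesis by (simp add: sum.distrib sum_distrib_left)
      qed
      then show ?thesis by (simp only:)
    qed
    also have "\<dots> = (\<Sum>r=1..a. of_real (1 / (fact r)\<^sup>2) * cnj (m r) * m r) + of_real ((-1) ^ (a + 1) / fact (2 * a)) * e"
    proof -
      have "cnj (m r) = (\<Sum>X<M. of_real (bernpoly r (x X)) * cnj (chi n k (int X))) / of_nat M" for r
        by (simp add: m_def)
      moreover have "((\<Sum>r=1..a. c r * A r * B r) + d * F) / z ^ 2 = (\<Sum>r=1..a. c r * (A r / z) * (B r / z)) + d * (F / z ^ 2)"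
        for c A B :: "nat \<Rightarrow> complex" and d F z
        by (simp add: add_divide_distrib sum_divide_distrib power2_eq_square)
      ultimately show ?thesis unfolding m_def e_def by (simp only:)
    qed
    also have "norm \<dots> \<le> (\<Sum>r=1..a. P r ^ 2 / real b ^ (2 * mu a n k)) + E / real b ^ (2 * mu a n k)"
    proof (rule order_trans[OF norm_triangle_ineq add_mono])
      show "norm (\<Sum>r=1..a. of_real (1 / (fact r)\<^sup>2) * cnj (m r) * m r) \<le> (\<Sum>r=1..a. P r ^ 2 / real b ^ (2 * mu a n k))"
      proof (rule sum_norm_le)
        fix r
        have "norm (of_real (1 / (fact r)\<^sup>2) * cnj (m r) * m r) \<le> 1 * (norm (m r))\<^sup>2"
          by (simp only: norm_mult norm_of_real complex_mod_cnj power2_eq_square mult.assoc, intro mult_right_mono)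
            (auto simp: divide_le_eq one_le_power power2_eq_square[symmetric])
        also have "\<dots> \<le> (P r / real b ^ mu a n k)\<^sup>2"
          using m[of r] by (simp add: power_mono)
        finally show "norm (of_real (1 / (fact r)\<^sup>2) * cnj (m r) * m r) \<le> P r ^ 2 / real b ^ (2 * mu a n k)"
          by (simp add: power_divide power_mult[symmetric] mult.commute)
      qed
      have "norm (of_real ((-1) ^ (a + 1) / fact (2 * a)) * e) \<le> 1 * norm e"
        unfolding norm_mult by (intro mult_right_mono) (auto simp: norm_divide norm_power)
      then show "norm (of_real ((-1) ^ (a + 1) / fact (2 * a)) * e) \<le> E / real b ^ (2 * mu a n k)"
        using e by simp
    qed
    also have "\<dots> = D1 / real b ^ (2 * mu a n k)"
      by (simp add: D1_def add_divide_distrib sum_divide_distrib)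
    finally show ?thesis .
  qed
  have zero: "norm (kern_coeff a n \<tau> k) \<le> C / real (b ^ n)"
    if \<tau>: "\<tau> \<in> {0..1}" and k: "\<forall>i\<in>{1..n}. k i = 0" for n k \<tau>
  proof -
    define M where "M = b ^ n"
    have M: "M > 0" using b_pos by (simp add: M_def)
    define x where "x X = (real X + \<tau>) / real M" for X
    have chi: "chi n k X = 1" for X using k by (intro chi_zero) auto
    have "kern_coeff a n \<tau> k = of_real ((\<Sum>X<M. (\<Sum>Y<M. kern a (x X) (x Y)) / real M) / real M)"
      unfolding kern_coeff_def M_def[symmetric] x_def[symmetric] chi
      by (simp add: power2_eq_square sum_divide_distrib[symmetric])
    then have "norm (kern_coeff a n \<tau> k) = \<bar>\<Sum>X<M. (\<Sum>Y<M. kern a (x X) (x Y)) / real M\<bar> / real M"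
      by (simp only: norm_of_real abs_divide abs_of_nat)
    also have "\<dots> \<le> (\<Sum>X<M. C / real M) / real M"
    proof (intro divide_right_mono order_trans[OF sum_abs sum_mono])
      fix X assume "X \<in> {..<M}"
      then have "real X + 1 \<le> real M" by (simp add: Suc_leI flip: of_nat_Suc)
      then have "x X \<in> {0..1}" using \<tau> M by (auto simp: x_def divide_le_eq)
      then show "\<bar>(\<Sum>Y<M. kern a (x X) (x Y)) / real M\<bar> \<le> C / real M"
        unfolding x_def[of Y for Y] using C_bound[OF M \<tau>] by blast
    qed simp
    also have "\<dots> = C / real M" using M by simp
    finally show ?thesis unfolding M_def .
  qed
  have "norm (kern_coeff a n \<tau> k) \<le> D / real b ^ (2 * mu a n k) \<and>
     ((\<forall>i\<in>{1..n}. k i = 0) \<longrightarrow> norm (kern_coeff a n \<tau> k) \<le> D / real (b ^ n))"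
    if \<tau>: "\<tau> \<in> {0..1}" and size: "b ^ n \<ge> 2 * a" and k: "\<forall>i\<in>{1..n}. k i < b" for n k \<tau>
  proof (cases "\<forall>i\<in>{1..n}. k i = 0")
    case True
    have "norm (kern_coeff a n \<tau> k) \<le> C / real (b ^ n)" by (rule zero[OF \<tau> True])
    also have "\<dots> \<le> D / real (b ^ n)" using D1 by (intro divide_right_mono) (auto simp: D_def)
    finally have 1: "norm (kern_coeff a n \<tau> k) \<le> D / real (b ^ n)" .
    \<comment> \<open>At the zero frequency \<open>mu a n k = 0\<close>, so
      \<open>1 / b ^ n \<le> 1\<close> turns the quadrature bound into the first bound as
      well.\<close>
    have "1 \<le> real (b ^ n)" using b_pos by (simp add: Suc_leI)
    then have "D / real (b ^ n) \<le> D / 1"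
      using D1 C b_pos by (intro divide_left_mono) (auto simp: D_def)
    then show ?thesis using 1 True mu_zero[of n k a] by simp
  next
    case False
    then have "norm (kern_coeff a n \<tau> k) \<le> D1 / real b ^ (2 * mu a n k)"
      using main[OF \<tau> size k] by blast
    also have "\<dots> \<le> D / real b ^ (2 * mu a n k)" using C by (intro divide_right_mono) (auto simp: D_def)
    finally show ?thesis using False by blast
  qed
  moreover have "D > 0" using D1 C by (simp add: D_def)
  ultimately show ?thesis by blast
qed

section \<open>Sums over the leading digits of frequencies\<close>

lemma digits_0: "digits 0 = {\<lambda>_. undefined}"
  by (simp add: digits_def)

lemma sum_digits_Suc:
  "(\<Sum>h\<in>digits (Suc n). F h) = (\<Sum>c<b. \<Sum>h\<in>digits n. F (h(Suc n := c)))"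
proof -
  have "{1..Suc n} = insert (Suc n) {1..n}" by auto
  then show ?thesis
    unfolding digits_def by (simp only: sum_PiE_insert[of "Suc n" "{1..n}" "\<lambda>_. {..<b}"]) (simp add: sum_PiE_insert)
qed

text \<open>The frequencies with at most \<open>a\<close> nonzero digits. They represent the groups
  of frequencies that have the same \<open>lev a\<close> and the same digits from this position
  on.\<close>

definition heads :: "nat \<Rightarrow> nat \<Rightarrow> (nat \<Rightarrow> nat) set" where
  "heads a n = {h \<in> digits n. \<forall>i\<in>{1..n}. i < lev a n h \<longrightarrow> h i = 0}"

definition head :: "nat \<Rightarrow> nat \<Rightarrow> (nat \<Rightarrow> nat) \<Rightarrow> (nat \<Rightarrow> nat)" where
  "head a n k = (\<lambda>i\<in>{1..n}. if lev a n k \<le> i then k i else 0)"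

lemma head_lev_mu: "lev a n (head a n k) = lev a n k" "mu a n (head a n k) = mu a n k"
  using lev_mu_cong[of n a k "head a n k"] by (auto simp: head_def)

lemma head_in_heads: "k \<in> digits n \<Longrightarrow> head a n k \<in> heads a n"
  unfolding heads_def mem_Collect_eq head_lev_mu
  using b_pos by (auto simp: head_def digits_def PiE_iff)

lemma finite_heads [simp, intro]: "finite (heads a n)"
  by (simp add: heads_def)

text \<open>Powers of \<open>b\<close> are kept as even powers of \<open>\<theta>\<^sup>-\<^sup>1\<close>, which leaves room for a geometric decay in \<open>\<theta>\<close>.\<close>

definition \<theta> :: real where "\<theta> = 1 / sqrt (real b)"

lemma theta: "0 < \<theta>" "\<theta> < 1"
  using b_ge_2 by (auto simp: \<theta>_def)

lemma theta_power_le: "i \<le> j \<Longrightarrow> \<theta> ^ j \<le> \<theta> ^ i"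
  using theta by (intro power_decreasing) auto

lemma sum_theta_le: "(\<Sum>i\<le>n. \<theta> ^ i) \<le> 1 / (1 - \<theta>)"
proof -
  have "(\<Sum>i\<le>n. \<theta> ^ i) = (1 - \<theta> ^ Suc n) / (1 - \<theta>)"
    using theta by (simp add: sum_gp0)
  also have "\<dots> \<le> 1 / (1 - \<theta>)"
    using theta by (intro divide_right_mono) auto
  finally show ?thesis .
qed

lemma sum_theta_diff_le:
  "(\<Sum>i\<in>{l..n}. \<theta> ^ (i - l)) \<le> 1 / (1 - \<theta>)"
proof (cases "l \<le> n")
  case True
  have "(\<Sum>i\<in>{l..n}. \<theta> ^ (i - l)) = (\<Sum>i\<le>n - l. \<theta> ^ i)"
    by (rule sum.reindex_bij_witness[of _ "\<lambda>i. i + l" "\<lambda>i. i - l"]) (use True in auto)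
  then show ?thesis using sum_theta_le by simp
next
  case False
  then show ?thesis using theta by simp
qed

text \<open>For a head of level \<open>l\<close>, \<open>mu a n h - a * l\<close> is the total
  distance of its nonzero positions from \<open>l\<close>. The sum runs over all of
  \<open>digits n\<close> with a condition, rather than over \<open>heads a n\<close>, to suit the
  recursion on the last digit.\<close>

definition head_sum :: "nat \<Rightarrow> nat \<Rightarrow> nat \<Rightarrow> real" where
  "head_sum a n l = (\<Sum>h\<in>digits n. if (\<forall>i\<in>{1..n}. i < lev a n h \<longrightarrow> h i = 0) \<and> lev a n h = l
      then \<theta> ^ (mu a n h - a * l) else 0)"

lemma head_sum_Suc:
  "head_sum (Suc a) (Suc n) l \<le> head_sum (Suc a) n l + (if l \<le> Suc n then real b * \<theta> ^ (Suc n - l) * head_sum a n l else 0)"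
proof -
  define F where "F a n h = (if (\<forall>i\<in>{1..n}. i < lev a n h \<longrightarrow> h i = 0) \<and> lev a n h = l
      then \<theta> ^ (mu a n h - a * l) else 0)" for a n h
  have hs: "head_sum a n l = (\<Sum>h\<in>digits n. F a n h)" for a n
    by (simp only: head_sum_def F_def)
  have F_nonneg: "F a n h \<ge> 0" for a n h using theta by (simp add: F_def)
  have upd: "lev a n (h(Suc n := c)) = lev a n h" "mu a n (h(Suc n := c)) = mu a n h" for a h c
    using lev_mu_cong[of n a h "h(Suc n := c)"] by auto
  have zero: "F (Suc a) (Suc n) (h(Suc n := 0)) = F (Suc a) n h" for h
  proof -
    have "(\<forall>i\<in>{1..Suc n}. i < x \<longrightarrow> (h(Suc n := 0)) i = 0) \<longleftrightarrow> (\<forall>i\<in>{1..n}. i < x \<longrightarrow> h i = 0)" for x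
      by (auto simp: le_Suc_eq)
    moreover have "lev (Suc a) (Suc n) (h(Suc n := 0)) = lev (Suc a) n h"
      "mu (Suc a) (Suc n) (h(Suc n := 0)) = mu (Suc a) n h"
      using upd by simp_all
    ultimately show ?thesis unfolding F_def by (simp only:)
  qed
  have nonzero: "F (Suc a) (Suc n) (h(Suc n := c)) = (if l \<le> Suc n then \<theta> ^ (Suc n - l) * F a n h else 0)"
    if "c \<noteq> 0" for h c
  proof -
    have cond: "(\<forall>i\<in>{1..Suc n}. i < lev a n h \<longrightarrow> (h(Suc n := c)) i = 0) \<longleftrightarrow> (\<forall>i\<in>{1..n}. i < lev a n h \<longrightarrow> h i = 0)"
      using lev_le[of a n h] by (auto simp: le_Suc_eq)
    have L: "lev (Suc a) (Suc n) (h(Suc n := c)) = lev a n h"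
      and Mu: "mu (Suc a) (Suc n) (h(Suc n := c)) = Suc n + mu a n h"
      using that upd by simp_all
    show ?thesis
    proof (cases "lev a n h = l")
      case True
      have "l \<le> Suc n" using lev_le[of a n h] True by simp
      moreover have "a * l \<le> mu a n h" using lev_mu_le[of a n h] True by simp
      ultimately have "Suc n + mu a n h - Suc a * l = (Suc n - l) + (mu a n h - a * l)" by simp
      then have "\<theta> ^ (Suc n + mu a n h - Suc a * l) = \<theta> ^ (Suc n - l) * \<theta> ^ (mu a n h - a * l)"
        by (simp only: power_add)
      then show ?thesis
        unfolding F_def L Mu cond unfolding True using \<open>l \<le> Suc n\<close>
        by (auto simp only: if_True if_False mult_zero_right split: if_split)
    next
      case False
      then show ?thesis unfolding F_def L by simp
    qed
  qed
  have "head_sum (Suc a) (Suc n) l = (\<Sum>c<b. \<Sum>h\<in>digits n. F (Suc a) (Suc n) (h(Suc n := c)))"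
    unfolding hs by (rule sum_digits_Suc)
  also have "\<dots> = (\<Sum>c<b. if c = 0 then head_sum (Suc a) n l else (if l \<le> Suc n then \<theta> ^ (Suc n - l) * head_sum a n l else 0))"
    by (rule sum.cong[OF refl]) (auto simp: zero nonzero hs sum_distrib_left)
  also have "\<dots> \<le> (\<Sum>c<b. (if c = 0 then head_sum (Suc a) n l else 0) + (if l \<le> Suc n then \<theta> ^ (Suc n - l) * head_sum a n l else 0))"
  proof -
    have "head_sum a n l \<ge> 0"
      unfolding hs by (intro sum_nonneg F_nonneg)
    then show ?thesis using theta by (intro sum_mono) auto
  qed
  also have "\<dots> = head_sum (Suc a) n l + (if l \<le> Suc n then real b * \<theta> ^ (Suc n - l) * head_sum a n l else 0)"
    using b_pos by (simp add: sum.distrib)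
  finally show ?thesis .
qed

text \<open>Uniform in \<open>n\<close> and \<open>l\<close>, because for given \<open>l\<close>
  each larger position is summed with the weight \<open>\<theta>\<close> to the power of its
  distance from \<open>l\<close>, a geometric series.\<close>

lemma head_sum_bound: "\<exists>C>0. \<forall>n l. head_sum a n l \<le> C"
proof (induction a)
  case 0
  have "head_sum 0 n l \<le> 1" for n l
  proof -
    have "head_sum 0 n l \<le> (\<Sum>h\<in>digits n. if h = (\<lambda>i\<in>{1..n}. 0) then 1 else 0)"
      unfolding head_sum_def
    proof (rule sum_mono)
      fix h assume h: "h \<in> digits n"
      have "h = (\<lambda>i\<in>{1..n}. 0)" if "\<forall>i\<in>{1..n}. i < lev 0 n h \<longrightarrow> h i = 0"
      proof (rule extensionalityI[of _ "{1..n}"])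
        show "h \<in> extensional {1..n}" using h by (simp add: digits_def PiE_def)
        show "h i = (\<lambda>i\<in>{1..n}. 0) i" if "i \<in> {1..n}" for i
          using that \<open>\<forall>i\<in>{1..n}. i < lev 0 n h \<longrightarrow> h i = 0\<close> by simp
      qed simp
      moreover have "(if P \<and> Q then x else 0) \<le> (if R then 1 else 0)" if "P \<Longrightarrow> R" "x = 1" for P Q R and x :: real
        using that by simp
      ultimately show "(if (\<forall>i\<in>{1..n}. i < lev 0 n h \<longrightarrow> h i = 0) \<and> lev 0 n h = l
        then \<theta> ^ (mu 0 n h - 0 * l) else 0) \<le> (if h = (\<lambda>i\<in>{1..n}. 0) then 1 else 0)"
        by (simp only: mu.simps mult_zero_left diff_zero power_0)
    qed
    also have "\<dots> \<le> 1" by (subst sum.delta) auto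
    finally show ?thesis .
  qed
  then show ?case by (intro exI[of _ 1]) auto
next
  case (Suc a)
  then obtain C where C: "C > 0" "\<And>n l. head_sum a n l \<le> C" by blast
  \<comment> \<open>\<open>head_sum_Suc\<close> unrolled in \<open>n\<close>: \<open>i\<close> runs
    through the possible largest positions, shifted by one, and \<open>1\<close> bounds the value at
    \<open>n = 0\<close>.\<close>
  have step: "head_sum (Suc a) n l \<le> 1 + real b * C * (\<Sum>i\<in>{l..n}. \<theta> ^ (i - l))" for n l
  proof (induction n)
    case 0
    have "head_sum (Suc a) 0 l \<le> 1"
      unfolding head_sum_def digits_0 by (simp add: power_le_one theta less_imp_le)
    moreover have "real b * C * (\<Sum>i\<in>{l..0}. \<theta> ^ (i - l)) \<ge> 0"
      using C theta by (intro mult_nonneg_nonneg sum_nonneg) auto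
    ultimately show ?case by linarith
  next
    case (Suc n)
    show ?case
    proof (cases "l \<le> Suc n")
      case True
      have "real b * \<theta> ^ (Suc n - l) * head_sum a n l \<le> real b * \<theta> ^ (Suc n - l) * C"
        using theta by (intro mult_left_mono C(2)) auto
      then have "head_sum (Suc a) (Suc n) l \<le> 1 + real b * C * (\<Sum>i\<in>{l..n}. \<theta> ^ (i - l)) + real b * \<theta> ^ (Suc n - l) * C"
        using head_sum_Suc[of a n l] Suc True by simp
      also have "\<dots> = 1 + real b * C * (\<Sum>i\<in>{l..Suc n}. \<theta> ^ (i - l))"
        using True by (simp add: distrib_left mult.assoc mult.commute[of _ C])
      finally show ?thesis .
    next
      case False
      then show ?thesis using head_sum_Suc[of a n l] Suc by simp
    qed
  qed
  have "head_sum (Suc a) n l \<le> 1 + real b * C * (1 / (1 - \<theta>))" for n l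
    using C by (intro order_trans[OF step] add_left_mono mult_left_mono sum_theta_diff_le) auto
  moreover have "1 + real b * C * (1 / (1 - \<theta>)) > 0"
    using C theta by (intro add_pos_nonneg) auto
  ultimately show ?case by (intro exI[of _ "1 + real b * C * (1 / (1 - \<theta>))"]) simp
qed

definition excess :: "nat \<Rightarrow> nat \<Rightarrow> (nat \<Rightarrow> nat) \<Rightarrow> nat" where
  "excess a n h = mu a n h - a * lev a n h"

text \<open>Reduces a sum over heads to a sum over their levels. \<open>a \<ge> 1\<close> keeps the
  levels at most \<open>n\<close>; the level for \<open>a = 0\<close> is
  \<open>n + 1\<close>.\<close>

lemma heads_group:
  assumes C: "\<And>n l. head_sum a n l \<le> C" and a: "a \<ge> 1" and F: "\<And>l. F l \<ge> 0"
  shows "(\<Sum>h\<in>heads a n. \<theta> ^ excess a n h * F (lev a n h)) \<le> C * (\<Sum>l\<le>n. F l)"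
proof -
  have "lev a n ` heads a n \<subseteq> {..n}"
    using lev_Suc_le[of "a - 1" n] a by auto
  then have "(\<Sum>h\<in>heads a n. \<theta> ^ excess a n h * F (lev a n h))
     = (\<Sum>l\<le>n. \<Sum>h\<in>{h\<in>heads a n. lev a n h = l}. \<theta> ^ excess a n h * F (lev a n h))"
    by (intro sum.group[symmetric]) auto
  also have "\<dots> = (\<Sum>l\<le>n. head_sum a n l * F l)"
  proof (rule sum.cong[OF refl])
    fix l
    have "(\<Sum>h\<in>{h\<in>heads a n. lev a n h = l}. \<theta> ^ excess a n h * F (lev a n h))
      = (\<Sum>h\<in>digits n. (if (\<forall>i\<in>{1..n}. i < lev a n h \<longrightarrow> h i = 0) \<and> lev a n h = l
      then \<theta> ^ (mu a n h - a * l) else 0) * F l)"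
      by (rule sum.mono_neutral_cong_left) (auto simp: heads_def excess_def)
    then show "(\<Sum>h\<in>{h\<in>heads a n. lev a n h = l}. \<theta> ^ excess a n h * F (lev a n h)) = head_sum a n l * F l"
      by (simp add: head_sum_def sum_distrib_right)
  qed
  also have "\<dots> \<le> (\<Sum>l\<le>n. C * F l)"
    by (intro sum_mono mult_right_mono C F)
  finally show ?thesis by (simp add: sum_distrib_left)
qed

text \<open>Levels below \<open>m\<close> may contribute fully, which is the origin of one factor
  \<open>m\<close> per coordinate; the levels above \<open>m\<close> form a geometric series. The
  other levels, collected in \<open>r\<close>, keep the decay
  \<open>\<theta> ^ (r - m)\<close>.\<close>

lemma sum_theta_excess:
  "(\<Sum>l\<le>n. \<theta> ^ (l + r - m)) \<le> (real m + 1 / (1 - \<theta>)) * \<theta> ^ (r - m)"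
proof -
  have "(\<Sum>l\<le>n. \<theta> ^ (l - m)) \<le> (\<Sum>l\<in>{..<m} \<union> {m..n}. \<theta> ^ (l - m))"
    using theta by (intro sum_mono2) auto
  also have "\<dots> = (\<Sum>l<m. \<theta> ^ (l - m)) + (\<Sum>l\<in>{m..n}. \<theta> ^ (l - m))"
    by (rule sum.union_disjoint) auto
  also have "\<dots> \<le> real m + 1 / (1 - \<theta>)"
    by (intro add_mono sum_theta_diff_le) simp
  finally have *: "(\<Sum>l\<le>n. \<theta> ^ (l - m)) \<le> real m + 1 / (1 - \<theta>)" .
  have "(\<Sum>l\<le>n. \<theta> ^ (l + r - m)) \<le> (\<Sum>l\<le>n. \<theta> ^ (l - m) * \<theta> ^ (r - m))"
    by (intro sum_mono) (simp add: power_add[symmetric] theta_power_le)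
  also have "\<dots> \<le> (real m + 1 / (1 - \<theta>)) * \<theta> ^ (r - m)"
    unfolding sum_distrib_right[symmetric] using theta by (intro mult_right_mono *) auto
  finally show ?thesis .
qed

text \<open>Here the exponent is \<open>\<bar>l + r - m\<bar>\<close>, so \<open>l\<close> is
  confined to the neighbourhood of \<open>m - r\<close> and no factor \<open>m\<close> appears. If
  \<open>r\<close> exceeds \<open>m\<close>, a decay is left for the other coordinates.\<close>

lemma sum_theta_dist:
  "(\<Sum>l\<le>n. \<theta> ^ ((l + r - m) + (m - (l + r)))) \<le> 2 / (1 - \<theta>) * \<theta> ^ (r - m)"
proof (cases "m \<le> r")
  case True
  then have "(\<Sum>l\<le>n. \<theta> ^ ((l + r - m) + (m - (l + r)))) = (\<Sum>l\<le>n. \<theta> ^ l) * \<theta> ^ (r - m)"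
    unfolding sum_distrib_right by (intro sum.cong refl) (simp add: power_add[symmetric])
  also have "\<dots> \<le> 1 / (1 - \<theta>) * \<theta> ^ (r - m)"
    using theta by (intro mult_right_mono sum_theta_le) auto
  also have "\<dots> \<le> 2 / (1 - \<theta>) * \<theta> ^ (r - m)"
    using theta by (intro mult_right_mono divide_right_mono) auto
  finally show ?thesis .
next
  case False
  define q where "q = m - r"
  have "(\<Sum>l\<le>n. \<theta> ^ ((l + r - m) + (m - (l + r)))) = (\<Sum>l\<le>n. \<theta> ^ ((l - q) + (q - l)))"
    using False by (intro sum.cong refl arg_cong[of _ _ "\<lambda>i. \<theta> ^ i"]) (auto simp: q_def)
  also have "\<dots> \<le> (\<Sum>l\<in>{..q} \<union> {q<..n}. \<theta> ^ ((l - q) + (q - l)))"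
    using theta by (intro sum_mono2) auto
  also have "\<dots> = (\<Sum>l\<le>q. \<theta> ^ (q - l)) + (\<Sum>l\<in>{q<..n}. \<theta> ^ (l - q))"
    by (subst sum.union_disjoint) auto
  also have "(\<Sum>l\<le>q. \<theta> ^ (q - l)) = (\<Sum>l\<le>q. \<theta> ^ l)"
    by (rule sum.reindex_bij_witness[of _ "\<lambda>i. q - i" "\<lambda>i. q - i"]) auto
  also have "(\<Sum>l\<in>{q<..n}. \<theta> ^ (l - q)) \<le> (\<Sum>l\<in>{q..n}. \<theta> ^ (l - q))"
    using theta by (intro sum_mono2) auto
  also have "(\<Sum>l\<le>q. \<theta> ^ l) + (\<Sum>l\<in>{q..n}. \<theta> ^ (l - q)) \<le> 1 / (1 - \<theta>) + 1 / (1 - \<theta>)"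
    by (intro add_mono sum_theta_le sum_theta_diff_le)
  finally show ?thesis using False by simp
qed

text \<open>The exponent involves only the total of the levels, so the induction collects in
  \<open>r\<close> the levels of the coordinates already split off.\<close>

lemma heads_prod_sum:
  assumes C: "\<And>n l. head_sum a n l \<le> C" "C > 0" and a: "a \<ge> 1" and "finite w"
  shows "(\<Sum>h\<in>PiE w (\<lambda>_. heads a n). (\<Prod>j\<in>w. \<theta> ^ excess a n (h j)) * \<theta> ^ ((\<Sum>j\<in>w. lev a n (h j)) + r - m))
     \<le> (C * (real m + 1 / (1 - \<theta>))) ^ card w * \<theta> ^ (r - m)"
  using \<open>finite w\<close>
proof (induction w arbitrary: r)
  case (insert j w)
  let ?K = "C * (real m + 1 / (1 - \<theta>))"
  have K: "?K \<ge> 0" using C theta by (intro mult_nonneg_nonneg add_nonneg_nonneg) auto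
  have upd: "(\<Prod>i\<in>insert j w. \<theta> ^ excess a n ((h(j := c)) i)) = \<theta> ^ excess a n c * (\<Prod>i\<in>w. \<theta> ^ excess a n (h i))"
    "(\<Sum>i\<in>insert j w. lev a n ((h(j := c)) i)) = lev a n c + (\<Sum>i\<in>w. lev a n (h i))" for h c
    by (rule prod_insert_upd[OF insert.hyps, where f = "\<lambda>x. \<theta> ^ excess a n x"],
        rule sum_insert_upd[OF insert.hyps, where f = "lev a n"])
  have "(\<Sum>h\<in>PiE (insert j w) (\<lambda>_. heads a n). (\<Prod>i\<in>insert j w. \<theta> ^ excess a n (h i)) * \<theta> ^ ((\<Sum>i\<in>insert j w. lev a n (h i)) + r - m))
     = (\<Sum>c\<in>heads a n. \<theta> ^ excess a n c * (\<Sum>h\<in>PiE w (\<lambda>_. heads a n). (\<Prod>i\<in>w. \<theta> ^ excess a n (h i)) * \<theta> ^ ((\<Sum>i\<in>w. lev a n (h i)) + (lev a n c + r) - m)))"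
    unfolding sum_PiE_insert[OF insert.hyps(2)] upd sum_distrib_left by (simp only: ac_simps)
  also have "\<dots> \<le> (\<Sum>c\<in>heads a n. \<theta> ^ excess a n c * (?K ^ card w * \<theta> ^ (lev a n c + r - m)))"
    using theta by (intro sum_mono mult_left_mono insert.IH) auto
  also have "\<dots> \<le> C * (\<Sum>l\<le>n. ?K ^ card w * \<theta> ^ (l + r - m))"
    using theta K by (intro heads_group C a mult_nonneg_nonneg) auto
  also have "\<dots> = C * ?K ^ card w * (\<Sum>l\<le>n. \<theta> ^ (l + r - m))"
    by (simp only: sum_distrib_left mult.assoc)
  also have "\<dots> \<le> C * ?K ^ card w * ((real m + 1 / (1 - \<theta>)) * \<theta> ^ (r - m))"
    using C K by (intro mult_left_mono sum_theta_excess mult_nonneg_nonneg) auto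
  also have "\<dots> = ?K ^ card (insert j w) * \<theta> ^ (r - m)"
    using insert.hyps by (simp add: mult_ac)
  finally show ?case .
qed simp

text \<open>One coordinate is summed with the others fixed; by \<open>sum_theta_dist\<close> it
  costs only a constant. The remaining \<open>card u - 1\<close> coordinates cost a factor of order
  \<open>m\<close> each.\<close>

lemma heads_prod_sum_dist:
  assumes C: "\<And>n l. head_sum a n l \<le> C" "C > 0" and a: "a \<ge> 1" and u: "finite u" "u \<noteq> {}"
  shows "(\<Sum>h\<in>PiE u (\<lambda>_. heads a n). (\<Prod>j\<in>u. \<theta> ^ excess a n (h j)) *
        \<theta> ^ (((\<Sum>j\<in>u. lev a n (h j)) - m) + (m - (\<Sum>j\<in>u. lev a n (h j)))))
     \<le> C * (2 / (1 - \<theta>)) * (C * (real m + 1 / (1 - \<theta>))) ^ (card u - 1)"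
proof -
  obtain j where j: "j \<in> u" using u by blast
  define w where "w = u - {j}"
  have w: "u = insert j w" "j \<notin> w" "finite w"
    using u j by (auto simp: w_def)
  define E where "E h = (\<Prod>i\<in>w. \<theta> ^ excess a n (h i))" for h
  define L where "L h = (\<Sum>i\<in>w. lev a n (h i))" for h
  have E: "E h \<ge> 0" for h unfolding E_def using theta by (intro prod_nonneg) auto
  have upd: "(\<Prod>i\<in>u. \<theta> ^ excess a n ((h(j := c)) i)) = \<theta> ^ excess a n c * E h"
    "(\<Sum>i\<in>u. lev a n ((h(j := c)) i)) = lev a n c + L h" for h c
    unfolding E_def L_def w(1)
    by (rule prod_insert_upd[OF w(3,2), where f = "\<lambda>x. \<theta> ^ excess a n x"],
        rule sum_insert_upd[OF w(3,2), where f = "lev a n"])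
  have "(\<Sum>h\<in>PiE u (\<lambda>_. heads a n). (\<Prod>i\<in>u. \<theta> ^ excess a n (h i)) *
        \<theta> ^ (((\<Sum>i\<in>u. lev a n (h i)) - m) + (m - (\<Sum>i\<in>u. lev a n (h i)))))
     = (\<Sum>h\<in>PiE w (\<lambda>_. heads a n). E h * (\<Sum>c\<in>heads a n. \<theta> ^ excess a n c *
         \<theta> ^ ((lev a n c + L h - m) + (m - (lev a n c + L h)))))"
    unfolding w(1) sum_PiE_insert[OF w(2)] unfolding w(1)[symmetric] upd
    by (subst sum.swap) (simp add: sum_distrib_left mult_ac)
  also have "\<dots> \<le> (\<Sum>h\<in>PiE w (\<lambda>_. heads a n). E h * (C * (2 / (1 - \<theta>) * \<theta> ^ (L h - m))))"
  proof (intro sum_mono mult_left_mono E)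
    fix h
    have "(\<Sum>c\<in>heads a n. \<theta> ^ excess a n c * \<theta> ^ ((lev a n c + L h - m) + (m - (lev a n c + L h))))
       \<le> C * (\<Sum>l\<le>n. \<theta> ^ ((l + L h - m) + (m - (l + L h))))"
      using theta by (intro heads_group[where F = "\<lambda>l. \<theta> ^ ((l + L h - m) + (m - (l + L h)))"] C a) auto
    also have "\<dots> \<le> C * (2 / (1 - \<theta>) * \<theta> ^ (L h - m))"
      using C by (intro mult_left_mono sum_theta_dist) auto
    finally show "(\<Sum>c\<in>heads a n. \<theta> ^ excess a n c * \<theta> ^ ((lev a n c + L h - m) + (m - (lev a n c + L h))))
       \<le> C * (2 / (1 - \<theta>) * \<theta> ^ (L h - m))" .
  qed
  also have "\<dots> = C * (2 / (1 - \<theta>)) * (\<Sum>h\<in>PiE w (\<lambda>_. heads a n). E h * \<theta> ^ (L h + 0 - m))"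
    by (simp add: sum_distrib_left mult_ac)
  also have "\<dots> \<le> C * (2 / (1 - \<theta>)) * ((C * (real m + 1 / (1 - \<theta>))) ^ card w * \<theta> ^ (0 - m))"
    unfolding E_def L_def using C theta by (intro mult_left_mono heads_prod_sum a w) auto
  also have "card w = card u - 1" using w by simp
  finally show ?thesis by simp
qed

lemma theta_even_power: "real b ^ i * \<theta> ^ (2 * i) = 1"
proof -
  have "\<theta> ^ 2 = 1 / real b" by (simp add: \<theta>_def power_divide)
  then show ?thesis using b_pos by (simp add: power_mult power_one_over)
qed

definition nonzero_dual where
  "nonzero_dual n m C u = {k \<in> dual n m C u. \<exists>j\<in>u. \<exists>i\<in>{1..n}. k j i \<noteq> 0}"

text \<open>
  The elements of the dual net are grouped by their heads: the digits down to the \<open>a\<close>-th nonzero one,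
  which determine the weight. Each group has at most \<open>b ^ ((L + t) - m)\<close> elements.
\<close>

lemma dual_sum_bound:
  assumes a: "a \<ge> 1" and u0: "finite u" "u \<noteq> {}"
  shows "\<exists>K>0. \<forall>\<beta> m s n C. \<beta> \<ge> 2 * a \<longrightarrow> m \<ge> 1 \<longrightarrow> u \<subseteq> {1..s} \<longrightarrow> net_rows b \<beta> t m s n C \<longrightarrow>
     (\<Sum>k\<in>nonzero_dual n m C u. \<Prod>j\<in>u. 1 / real b ^ (2 * mu a n (k j))) \<le> K * real m ^ (card u - 1) / real b ^ (2 * a * m)"
proof -
  obtain c where c: "c > 0" "\<And>n l. head_sum a n l \<le> c" using head_sum_bound by blast
  define c1 where "c1 = c * (1 + 1 / (1 - \<theta>))"
  \<comment> \<open>\<open>3 * t\<close> is half of the \<open>6 * t\<close> in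
    \<open>exponent_inequality\<close>, and \<open>c1\<close> absorbs the constant next to
    \<open>m\<close>, as \<open>m \<ge> 1\<close>.\<close>
  define K where "K = real b ^ (3 * t) * (c * (2 / (1 - \<theta>)) * c1 ^ (card u - 1))"
  have c1: "c1 > 0" using c theta by (auto simp: c1_def intro!: mult_pos_pos add_pos_pos)
  have K: "K > 0" unfolding K_def using c c1 theta b_pos by (intro mult_pos_pos zero_less_power) auto
  have "(\<Sum>k\<in>nonzero_dual n m C u. \<Prod>j\<in>u. 1 / real b ^ (2 * mu a n (k j))) \<le> K * real m ^ (card u - 1) / real b ^ (2 * a * m)"
    if \<beta>: "\<beta> \<ge> 2 * a" and m: "m \<ge> 1" and u: "u \<subseteq> {1..s}" and net: "net_rows b \<beta> t m s n C" for \<beta> m s n C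
  proof -
    define D where "D = nonzero_dual n m C u"
    have finD: "finite D" unfolding D_def nonzero_dual_def using finite_dual[OF u0(1)] by simp
    have D_dual: "D \<subseteq> dual n m C u" by (auto simp: D_def nonzero_dual_def)
    define V where "V = PiE u (\<lambda>_. heads a n)"
    have finV: "finite V" unfolding V_def by (intro finite_PiE u0) auto
    define H where "H k = (\<lambda>j\<in>u. head a n (k j))" for k
    have HV: "H ` D \<subseteq> V"
    proof
      fix h assume "h \<in> H ` D"
      then obtain k where k: "k \<in> D" "h = H k" by blast
      then have "k \<in> PiE u (\<lambda>_. digits n)" using D_dual by (auto simp: dual_def)
      then have "k j \<in> digits n" if "j \<in> u" for j using that by (rule PiE_mem)
      then show "h \<in> V" unfolding k H_def V_def by (auto intro!: head_in_heads)
    qed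
    define A where "A k = (\<Sum>j\<in>u. mu a n (k j))" for k
    define L where "L k = (\<Sum>j\<in>u. lev a n (k j))" for k
    have AH: "A (H k) = A k" "L (H k) = L k" for k
      by (simp_all add: A_def L_def H_def head_lev_mu)
    have weight: "(\<Prod>j\<in>u. 1 / real b ^ (2 * mu a n (k j))) = 1 / real b ^ (2 * A k)" for k
      by (simp add: A_def power_sum prod_dividef sum_distrib_left)
    have fiber: "(\<Sum>k\<in>{k\<in>D. H k = h}. 1 / real b ^ (2 * A k))
       \<le> real b ^ (3 * t) / real b ^ (2 * a * m) * ((\<Prod>j\<in>u. \<theta> ^ excess a n (h j)) * \<theta> ^ ((L h - m) + (m - L h)))"
      if h: "h \<in> V" for h
    proof (cases "{k\<in>D. H k = h} = {}")
      case True
      then show ?thesis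
        using theta by (simp only: sum.empty) (intro mult_nonneg_nonneg prod_nonneg divide_nonneg_nonneg zero_le_power; simp)
    next
      case False
      then obtain k0 where k0: "k0 \<in> D" "H k0 = h" by blast
      have lev_h: "lev a n (k j) = lev a n (h j)" if "H k = h" "j \<in> u" for k j
        using that by (auto simp: H_def head_lev_mu)
      have card: "card {k\<in>D. H k = h} \<le> b ^ ((\<Sum>j\<in>u. lev a n (h j)) + t - m)"
      proof (rule card_dual_fiber[OF net u])
        show "lev a n (h j) \<le> n" for j using lev_Suc_le[of "a - 1" n "h j"] a by simp
        fix k k' j i assume k: "k \<in> {k\<in>D. H k = h}" "k' \<in> {k\<in>D. H k = h}" and ji: "j \<in> u" "i \<in> {1..n}" "lev a n (h j) \<le> i"
        have "H k j = H k' j" using k by simp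
        then have "head a n (k j) i = head a n (k' j) i" using ji by (simp add: H_def)
        then show "k j i = k' j i"
          using ji lev_h[of k j] lev_h[of k' j] k by (simp add: head_def)
      qed (use D_dual \<beta> a in auto)
      have sum_eq: "(\<Sum>k\<in>{k\<in>D. H k = h}. 1 / real b ^ (2 * A k)) = real (card {k\<in>D. H k = h}) / real b ^ (2 * A h)"
      proof -
        have "A k = A h" if "H k = h" for k using AH(1)[of k] unfolding that by (rule sym)
        then have "(\<Sum>k\<in>{k\<in>D. H k = h}. 1 / real b ^ (2 * A k)) = (\<Sum>k\<in>{k\<in>D. H k = h}. 1 / real b ^ (2 * A h))"
          by (intro sum.cong refl) simp
        then show ?thesis by simp
      qed
      \<comment> \<open>All elements of the group share \<open>A\<close> and \<open>L\<close>, so a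
        single element suffices to feed the minimum distance into
        \<open>exponent_inequality\<close>.\<close>
      define B where "B = (\<Sum>j\<in>u. mu \<beta> n (k0 j))"
      have "B + t > \<beta> * m"
      proof (rule ccontr)
        assume "\<not> B + t > \<beta> * m"
        then have small: "B \<le> \<beta> * m - t" by simp
        obtain j i where ji: "j \<in> u" "i \<in> {1..n}" "k0 j i \<noteq> 0" using k0 by (auto simp: D_def nonzero_dual_def)
        have "k0 j i = 0"
        proof (rule dual_min_dist[OF net u _ _ _ ji(1,2)])
          show "k0 j i < b" if "j \<in> u" "i \<in> {1..n}" for j i
            using k0(1) D_dual that digits_less[of "k0 j" n i] by (auto simp: dual_def PiE_iff)
          show "[(\<Sum>j\<in>u. \<Sum>i=1..n. k0 j i * C j i p) = 0] (mod b)" if "p < m" for p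
            using k0(1) D_dual that by (auto simp: dual_def)
        qed (use small in \<open>simp add: B_def\<close>)
        then show False using ji by simp
      qed
      moreover have "B \<le> A h + (\<beta> - a) * L h"
      proof -
        have "mu \<beta> n (k0 j) \<le> mu a n (k0 j) + (\<beta> - a) * lev a n (k0 j)" for j
          using mu_add_le[of a "\<beta> - a" n "k0 j"] \<beta> by simp
        then have "B \<le> A k0 + (\<beta> - a) * L k0"
          unfolding B_def A_def L_def sum_distrib_left sum.distrib[symmetric] by (intro sum_mono) auto
        then show ?thesis using AH[of k0] unfolding k0(2) by simp
      qed
      moreover have "a * L h \<le> A h"
        unfolding L_def A_def sum_distrib_left by (intro sum_mono lev_mu_le)
      ultimately have ineq: "(A h - a * L h) + ((L h - m) + (m - L h)) + 4 * (a * m) + 2 * (L h + t - m) \<le> 4 * A h + 6 * t"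
        using a \<beta> by (rule exponent_inequality)
      have excess: "(\<Prod>j\<in>u. \<theta> ^ excess a n (h j)) = \<theta> ^ (A h - a * L h)"
      proof -
        have "(\<Sum>j\<in>u. excess a n (h j)) = A h - a * L h"
          unfolding excess_def A_def L_def sum_distrib_left using lev_mu_le by (intro sum_subtractf_nat) auto
        then show ?thesis by (simp add: power_sum[symmetric])
      qed
      define X where "X = real b ^ (L h + t - m)"
      define R where "R = (A h - a * L h) + ((L h - m) + (m - L h))"
      have "\<theta> ^ (4 * A h + 6 * t) \<le> \<theta> ^ (R + 4 * (a * m) + 2 * (L h + t - m))"
        using ineq unfolding R_def by (intro theta_power_le) simp
      then have "\<theta> ^ (2 * (2 * A h)) * \<theta> ^ (2 * (3 * t)) \<le> \<theta> ^ R * \<theta> ^ (2 * (2 * a * m)) * \<theta> ^ (2 * (L h + t - m))"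
        by (simp add: power_add[symmetric] ac_simps)
      moreover have "\<theta> ^ (2 * i) = 1 / real b ^ i" for i
        using theta_even_power[of i] b_pos by (simp add: field_simps)
      ultimately have ineq': "1 / real b ^ (2 * A h) * (1 / real b ^ (3 * t)) \<le> \<theta> ^ R * (1 / real b ^ (2 * a * m)) * (1 / X)"
        unfolding X_def by (simp only:)
      have rearrange: "X / p \<le> q / r * T" if "1 / p * (1 / q) \<le> T * (1 / r) * (1 / X)" "q > 0" "X > 0" for p q r T X :: real
        using mult_left_mono[OF that(1), of "q * X"] that(2,3) by (simp add: mult_ac)
      have "X / real b ^ (2 * A h) \<le> real b ^ (3 * t) / real b ^ (2 * a * m) * \<theta> ^ R"
        by (rule rearrange[OF ineq']) (use b_pos in \<open>simp_all add: X_def\<close>)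
      moreover have "real (card {k\<in>D. H k = h}) \<le> X"
        using card by (simp add: X_def L_def flip: of_nat_power)
      then have "real (card {k\<in>D. H k = h}) / real b ^ (2 * A h) \<le> X / real b ^ (2 * A h)"
        by (rule divide_right_mono) simp
      ultimately have "real (card {k\<in>D. H k = h}) / real b ^ (2 * A h) \<le> real b ^ (3 * t) / real b ^ (2 * a * m) * \<theta> ^ R"
        by linarith
      then show ?thesis
        unfolding sum_eq excess R_def by (simp add: power_add)
    qed
    have "(\<Sum>k\<in>D. \<Prod>j\<in>u. 1 / real b ^ (2 * mu a n (k j))) = (\<Sum>h\<in>V. \<Sum>k\<in>{k\<in>D. H k = h}. 1 / real b ^ (2 * A k))"
      unfolding weight by (rule sum.group[OF finD finV HV, symmetric])
    also have "\<dots> \<le> (\<Sum>h\<in>V. real b ^ (3 * t) / real b ^ (2 * a * m) * ((\<Prod>j\<in>u. \<theta> ^ excess a n (h j)) * \<theta> ^ ((L h - m) + (m - L h))))"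
      by (intro sum_mono fiber)
    also have "\<dots> = real b ^ (3 * t) / real b ^ (2 * a * m) * (\<Sum>h\<in>V. (\<Prod>j\<in>u. \<theta> ^ excess a n (h j)) * \<theta> ^ ((L h - m) + (m - L h)))"
      by (simp add: sum_distrib_left)
    also have "\<dots> \<le> real b ^ (3 * t) / real b ^ (2 * a * m) * (c * (2 / (1 - \<theta>)) * (c * (real m + 1 / (1 - \<theta>))) ^ (card u - 1))"
      unfolding V_def L_def by (intro mult_left_mono heads_prod_sum_dist c a u0) auto
    also have "\<dots> \<le> real b ^ (3 * t) / real b ^ (2 * a * m) * (c * (2 / (1 - \<theta>)) * (c1 * real m) ^ (card u - 1))"
    proof -
      have "c * (real m + 1 / (1 - \<theta>)) \<le> c * (real m + 1 / (1 - \<theta>) * real m)"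
        using m theta c by (intro mult_left_mono add_left_mono) (auto simp: divide_right_mono)
      also have "\<dots> = c1 * real m" by (simp add: c1_def algebra_simps)
      finally have "c * (real m + 1 / (1 - \<theta>)) \<le> c1 * real m" .
      then show ?thesis
        using c theta by (intro mult_left_mono power_mono mult_nonneg_nonneg add_nonneg_nonneg) auto
    qed
    also have "\<dots> = K * real m ^ (card u - 1) / real b ^ (2 * a * m)"
      by (simp add: K_def power_mult_distrib mult_ac)
    finally show ?thesis unfolding D_def .
  qed
  with K show ?thesis by blast
qed

end

section \<open>Worst-case errors in reproducing kernel Hilbert spaces\<close>

context rkhs
begin

lemma ip_zero: "f \<in> H \<Longrightarrow> ip f (\<lambda>x\<in>D. 0) = 0"
  using ip_scale[of f f 0] by (subst ip_commute) (simp_all add: zero)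

lemma ip_add_right: "f \<in> H \<Longrightarrow> g \<in> H \<Longrightarrow> h \<in> H \<Longrightarrow> ip h (\<lambda>x\<in>D. f x + g x) = ip h f + ip h g"
  using ip_add[of f g h] by (simp only: ip_commute[of h] add)

lemma ip_scale_right: "f \<in> H \<Longrightarrow> g \<in> H \<Longrightarrow> ip g (\<lambda>x\<in>D. c * f x) = c * ip g f"
  using ip_scale[of f g c] by (simp only: ip_commute[of g] scale)

lemma cauchy_schwarz:
  assumes f: "f \<in> H" and g: "g \<in> H"
  shows "(ip f g)\<^sup>2 \<le> ip f f * ip g g"
proof (cases "ip g g = 0")
  case True
  then show ?thesis using ip_eq_0[OF g] ip_zero[OF f] by simp
next
  case False
  then have pos: "ip g g > 0" using ip_nonneg[OF g] by simp
  define t where "t = - ip f g / ip g g"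
  define h where "h = (\<lambda>x\<in>D. t * g x)"
  have h: "h \<in> H" unfolding h_def using g by (rule scale)
  have "0 \<le> ip (\<lambda>x\<in>D. f x + h x) (\<lambda>x\<in>D. f x + h x)"
    using f h by (intro ip_nonneg add)
  also have "\<dots> = ip f f + 2 * ip f h + ip h h"
    using f h by (simp add: ip_add ip_add_right add ip_commute[of h f])
  also have "\<dots> = ip f f + 2 * t * ip f g + t\<^sup>2 * ip g g"
    using f g h by (simp add: h_def ip_scale ip_scale_right scale power2_eq_square)
  also have "\<dots> = ip f f - (ip f g)\<^sup>2 / ip g g"
    using pos by (simp add: t_def power2_eq_square field_simps)
  finally show ?thesis using pos by (simp add: field_simps)
qed

text \<open>Kernel sums are the representers of combinations of point evaluations. Membership and
  representation are proved together because the induction needs both.\<close>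

lemma kernel_sum:
  assumes "finite I" "\<And>i. i \<in> I \<Longrightarrow> p i \<in> D"
  shows "(\<lambda>x\<in>D. \<Sum>i\<in>I. c i * K x (p i)) \<in> H \<and>
     (\<forall>f\<in>H. ip f (\<lambda>x\<in>D. \<Sum>i\<in>I. c i * K x (p i)) = (\<Sum>i\<in>I. c i * f (p i)))"
  using assms
proof (induction I)
  case empty
  then show ?case using zero ip_zero by (simp add: restrict_def)
next
  case (insert i I)
  define e where "e = (\<lambda>x\<in>D. \<Sum>i\<in>I. c i * K x (p i))"
  define k where "k = (\<lambda>x\<in>D. K x (p i))"
  define ck where "ck = (\<lambda>x\<in>D. c i * k x)"
  have e: "e \<in> H" "\<And>f. f \<in> H \<Longrightarrow> ip f e = (\<Sum>i\<in>I. c i * f (p i))"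
    using insert.IH insert.prems unfolding e_def by blast+
  have k: "k \<in> H" unfolding k_def using insert by (intro kernel) auto
  have ck: "ck \<in> H" unfolding ck_def using k by (rule scale)
  have eq: "(\<lambda>x\<in>D. \<Sum>i\<in>insert i I. c i * K x (p i)) = (\<lambda>x\<in>D. ck x + e x)"
    using insert by (auto simp: e_def k_def ck_def)
  have "ip f (\<lambda>x\<in>D. ck x + e x) = (\<Sum>i\<in>insert i I. c i * f (p i))" if f: "f \<in> H" for f
  proof -
    have "ip f (\<lambda>x\<in>D. ck x + e x) = ip f ck + ip f e"
      using f ck e by (intro ip_add_right)
    also have "ip f ck = c i * ip f k"
      unfolding ck_def using f k by (intro ip_scale_right)
    also have "ip f k = f (p i)"
      unfolding k_def using f insert by (intro reproducing) auto
    finally show ?thesis unfolding sum.insert[OF insert.hyps] e(2)[OF f] .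
  qed
  then show ?case unfolding eq using add[OF ck e(1)] by blast
qed

text \<open>Cauchy-Schwarz for the difference of two quadrature rules; the right-hand side is the
  squared norm of the difference of their representers. The index types are separate because one
  rule will be the shifted net and the other a fine grid standing in for the integral.\<close>

lemma kernel_sum_diff:
  fixes c :: "'i \<Rightarrow> real" and d :: "'j \<Rightarrow> real" and p :: "'i \<Rightarrow> 'a" and q :: "'j \<Rightarrow> 'a"
  assumes I: "finite I" "\<And>i. i \<in> I \<Longrightarrow> p i \<in> D" and J: "finite J" "\<And>j. j \<in> J \<Longrightarrow> q j \<in> D"
    and f: "f \<in> H" "ip f f \<le> 1"
  shows "((\<Sum>i\<in>I. c i * f (p i)) - (\<Sum>j\<in>J. d j * f (q j)))\<^sup>2 \<le>
     (\<Sum>i\<in>I. c i * (\<Sum>i'\<in>I. c i' * K (p i) (p i'))) - (\<Sum>j\<in>J. d j * (\<Sum>i\<in>I. c i * K (q j) (p i)))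
     - (\<Sum>i\<in>I. c i * (\<Sum>j\<in>J. d j * K (p i) (q j))) + (\<Sum>j\<in>J. d j * (\<Sum>j'\<in>J. d j' * K (q j) (q j')))"
proof -
  define e1 where "e1 = (\<lambda>x\<in>D. \<Sum>i\<in>I. c i * K x (p i))"
  define e2 where "e2 = (\<lambda>x\<in>D. \<Sum>j\<in>J. d j * K x (q j))"
  define m where "m = (\<lambda>x\<in>D. (-1) * e2 x)"
  define e where "e = (\<lambda>x\<in>D. e1 x + m x)"
  have e1: "e1 \<in> H" "\<And>f. f \<in> H \<Longrightarrow> ip f e1 = (\<Sum>i\<in>I. c i * f (p i))"
    unfolding e1_def using kernel_sum[where I = I and p = p and c = c, OF I] by blast+
  have e2: "e2 \<in> H" "\<And>f. f \<in> H \<Longrightarrow> ip f e2 = (\<Sum>j\<in>J. d j * f (q j))"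
    unfolding e2_def using kernel_sum[where I = J and p = q and c = d, OF J] by blast+
  have m: "m \<in> H" "\<And>f. f \<in> H \<Longrightarrow> ip f m = - ip f e2"
    unfolding m_def using e2(1) scale[of e2 "-1"] ip_scale_right[of e2 _ "-1"] by auto
  have e: "e \<in> H" "\<And>f. f \<in> H \<Longrightarrow> ip f e = ip f e1 - ip f e2"
    unfolding e_def using e1(1) m add ip_add_right[of e1 m] by auto
  have ev: "e (p i) = e1 (p i) - e2 (p i)" if "i \<in> I" for i
    using I(2)[OF that] by (simp add: e_def m_def)
  have ev': "e (q j) = e1 (q j) - e2 (q j)" if "j \<in> J" for j
    using J(2)[OF that] by (simp add: e_def m_def)
  have "ip e e = (\<Sum>i\<in>I. c i * e (p i)) - (\<Sum>j\<in>J. d j * e (q j))"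
    using e e1(2) e2(2) by simp
  also have "\<dots> = ((\<Sum>i\<in>I. c i * e1 (p i)) - (\<Sum>i\<in>I. c i * e2 (p i))) - ((\<Sum>j\<in>J. d j * e1 (q j)) - (\<Sum>j\<in>J. d j * e2 (q j)))"
    by (simp add: ev ev' right_diff_distrib sum_subtractf)
  also have "\<dots> = (\<Sum>i\<in>I. c i * (\<Sum>i'\<in>I. c i' * K (p i) (p i'))) - (\<Sum>j\<in>J. d j * (\<Sum>i\<in>I. c i * K (q j) (p i)))
     - (\<Sum>i\<in>I. c i * (\<Sum>j\<in>J. d j * K (p i) (q j))) + (\<Sum>j\<in>J. d j * (\<Sum>j'\<in>J. d j' * K (q j) (q j')))"
    using I(2) J(2) by (simp add: e1_def e2_def)
  finally have "ip e e = (\<Sum>i\<in>I. c i * (\<Sum>i'\<in>I. c i' * K (p i) (p i'))) - (\<Sum>j\<in>J. d j * (\<Sum>i\<in>I. c i * K (q j) (p i)))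
     - (\<Sum>i\<in>I. c i * (\<Sum>j\<in>J. d j * K (p i) (q j))) + (\<Sum>j\<in>J. d j * (\<Sum>j'\<in>J. d j' * K (q j) (q j')))" .
  moreover have "(ip f e)\<^sup>2 \<le> 1 * ip e e"
    by (rule order_trans[OF cauchy_schwarz[OF f(1) e(1)] mult_right_mono[OF f(2) ip_nonneg[OF e(1)]]])
  ultimately show ?thesis
    using e(2)[OF f(1)] e1(2)[OF f(1)] e2(2)[OF f(1)] by simp
qed

end

section \<open>Integration over the unit cube\<close>

abbreviation unit_measure :: "real measure" where
  "unit_measure \<equiv> restrict_space lborel {0..<1}"

lemma prob_space_unit: "prob_space unit_measure"
  by (rule prob_spaceI) (simp add: space_restrict_space emeasure_restrict_space)

interpretation unit: prob_space unit_measure by (rule prob_space_unit)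

interpretation cube: product_sigma_finite "\<lambda>_::nat. unit_measure"
  by (unfold_locales) 

lemma space_unit [simp]: "space unit_measure = {0..<1}"
  by (simp add: space_restrict_space)

lemma measurable_unit: "f \<in> borel_measurable borel \<Longrightarrow> f \<in> borel_measurable unit_measure"
  by (rule measurable_restrict_space1) simp

lemma integrable_unit:
  fixes f :: "real \<Rightarrow> 'a::{banach, second_countable_topology}"
  assumes "f \<in> borel_measurable unit_measure" "\<And>x. x \<in> {0..<1} \<Longrightarrow> norm (f x) \<le> B"
  shows "integrable unit_measure f"
  using assms by (intro unit.integrable_const_bound[of _ B]) auto

lemma prob_space_cube: "prob_space (cube_measure s)"
  unfolding cube_measure_def by (intro prob_space_PiM prob_space_unit)

lemma integral_cube_prod:
  fixes f :: "nat \<Rightarrow> real \<Rightarrow> real"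
  assumes "\<And>j. j \<in> {1..s} \<Longrightarrow> integrable unit_measure (f j)"
  shows "(\<integral>x. (\<Prod>j\<in>{1..s}. f j (x j)) \<partial>cube_measure s) = (\<Prod>j\<in>{1..s}. integral\<^sup>L unit_measure (f j))"
  unfolding cube_measure_def by (rule cube.product_integral_prod) (use assms in auto)

lemma integrable_cube_prod:
  fixes f :: "nat \<Rightarrow> real \<Rightarrow> real"
  assumes "\<And>j. j \<in> {1..s} \<Longrightarrow> integrable unit_measure (f j)"
  shows "integrable (cube_measure s) (\<lambda>x. \<Prod>j\<in>{1..s}. f j (x j))"
  unfolding cube_measure_def by (rule cube.product_integrable_prod) (use assms in auto)

lemma measurable_cube_component:
  "j \<in> {1..s} \<Longrightarrow> f \<in> borel_measurable unit_measure \<Longrightarrow> (\<lambda>x. f (x j)) \<in> borel_measurable (cube_measure s)"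
  unfolding cube_measure_def
  by (rule measurable_compose[OF measurable_component_singleton[of j "{1..s}" "\<lambda>_. unit_measure"]])

definition node :: "nat \<Rightarrow> nat \<Rightarrow> (nat \<Rightarrow> nat) \<Rightarrow> (nat \<Rightarrow> real)" where
  "node s M g = (\<lambda>j\<in>{1..s}. real (g j) / real M)"

definition grid :: "nat \<Rightarrow> nat \<Rightarrow> (nat \<Rightarrow> nat) set" where
  "grid s M = PiE {1..s} (\<lambda>_. {..<M})"

lemma finite_grid [simp]: "finite (grid s M)"
  by (simp add: grid_def finite_PiE)

lemma card_grid: "card (grid s M) = M ^ s"
  by (simp add: grid_def card_PiE)

lemma node_in_cube: "g \<in> grid s M \<Longrightarrow> node s M g \<in> cube s"
  by (auto simp: grid_def node_def cube_def PiE_iff)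

definition cell_index :: "nat \<Rightarrow> nat \<Rightarrow> (nat \<Rightarrow> real) \<Rightarrow> (nat \<Rightarrow> nat)" where
  "cell_index s M x = (\<lambda>j\<in>{1..s}. nat \<lfloor>x j * real M\<rfloor>)"

lemma cell_index_grid: "x \<in> cube s \<Longrightarrow> M > 0 \<Longrightarrow> cell_index s M x \<in> grid s M"
  by (auto simp: cell_index_def grid_def cube_def PiE_iff floor_less_iff nat_less_iff zero_le_floor)

lemma cell_index_iff:
  assumes "x \<in> cube s" "M > 0" "g \<in> grid s M"
  shows "(\<Prod>j\<in>{1..s}. indicat_real {real (g j) / real M..<real (Suc (g j)) / real M} (x j)) = (if g = cell_index s M x then 1 else 0)"
proof -
  have cell: "x j \<in> {real (g j) / real M..<real (Suc (g j)) / real M} \<longleftrightarrow> g j = cell_index s M x j" if "j \<in> {1..s}" for j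
  proof -
    have "x j \<ge> 0" using assms(1) that by (auto simp: cube_def PiE_iff)
    then have "0 \<le> \<lfloor>x j * real M\<rfloor>" by simp
    have "x j \<in> {real (g j) / real M..<real (Suc (g j)) / real M} \<longleftrightarrow> real (g j) \<le> x j * real M \<and> x j * real M < real (g j) + 1"
      using assms(2) by (simp add: divide_le_eq less_divide_eq add.commute)
    also have "\<dots> \<longleftrightarrow> \<lfloor>x j * real M\<rfloor> = int (g j)" by (simp add: floor_eq_iff)
    also have "\<dots> \<longleftrightarrow> g j = nat \<lfloor>x j * real M\<rfloor>" using \<open>0 \<le> \<lfloor>x j * real M\<rfloor>\<close> by auto
    finally show ?thesis using that by (simp add: cell_index_def)
  qed
  show ?thesis
  proof (cases "g = cell_index s M x")
    case True
    then show ?thesis using cell by (simp add: indicator_def)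
  next
    case False
    have "\<exists>j\<in>{1..s}. g j \<noteq> cell_index s M x j"
    proof (rule ccontr)
      assume "\<not> ?thesis"
      then have "g = cell_index s M x"
        by (intro PiE_ext[OF assms(3)[unfolded grid_def] cell_index_grid[OF assms(1,2), unfolded grid_def]]) simp
      with False show False by simp
    qed
    then obtain j where j: "j \<in> {1..s}" "g j \<noteq> cell_index s M x j" by blast
    have "(\<Prod>j\<in>{1..s}. indicat_real {real (g j) / real M..<real (Suc (g j)) / real M} (x j)) = 0"
      by (rule prod_zero) (use cell[OF j(1)] j in \<open>auto simp: indicator_def\<close>)
    then show ?thesis using False by simp
  qed
qed

lemma integral_unit_indicator:
  assumes "0 \<le> c" "c \<le> d" "d \<le> 1"
  shows "integrable unit_measure (indicat_real {c..<d})" "integral\<^sup>L unit_measure (indicat_real {c..<d}) = d - c"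
proof -
  have sets: "{c..<d} \<in> sets unit_measure"
    using assms by (auto simp: sets_restrict_space_iff)
  then show "integrable unit_measure (indicat_real {c..<d})"
    by (intro integrable_unit[where B = 1]) (auto simp: indicator_def)
  have "{c..<d} \<inter> space unit_measure = {c..<d}" using assms by auto
  then have "integral\<^sup>L unit_measure (indicat_real {c..<d}) = measure unit_measure {c..<d}"
    by (simp only: Bochner_Integration.integral_indicator)
  also have "\<dots> = measure lborel {c..<d}"
    by (rule measure_restrict_space) (use assms in auto)
  also have "\<dots> = d - c" using assms by simp
  finally show "integral\<^sup>L unit_measure (indicat_real {c..<d}) = d - c" .
qed

text \<open>Step functions on the cells converge pointwise and boundedly. Elements of the Hilbert
  space are not measurable by definition; measurability of \<open>f\<close> comes from this limit,
  for which convergence along the lower corners of the cells is enough.\<close>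

lemma grid_average_tendsto:
  fixes f :: "(nat \<Rightarrow> real) \<Rightarrow> real"
  assumes bound: "\<And>x. x \<in> cube s \<Longrightarrow> \<bar>f x\<bar> \<le> B"
    and cont: "\<And>x. x \<in> cube s \<Longrightarrow> (\<lambda>i. f (node s (Suc i) (cell_index s (Suc i) x))) \<longlonglongrightarrow> f x"
  shows "(\<lambda>i. (\<Sum>g\<in>grid s (Suc i). f (node s (Suc i) g)) / real (Suc i) ^ s) \<longlonglongrightarrow> integral\<^sup>L (cube_measure s) f"
proof -
  interpret prob_space "cube_measure s" by (rule prob_space_cube)
  define F where "F M x = (\<Sum>g\<in>grid s M. f (node s M g) * (\<Prod>j\<in>{1..s}. indicat_real {real (g j) / real M..<real (Suc (g j)) / real M} (x j)))" for M x
  have F_eq: "F M x = f (node s M (cell_index s M x))" if "x \<in> cube s" "M > 0" for M x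
  proof -
    have "F M x = (\<Sum>g\<in>grid s M. if g = cell_index s M x then f (node s M g) else 0)"
      unfolding F_def using cell_index_iff[OF that] by (intro sum.cong refl) simp
    then show ?thesis using cell_index_grid[OF that] by (simp add: sum.delta)
  qed
  have ind: "indicat_real {real (g j) / real M..<real (Suc (g j)) / real M} \<in> borel_measurable unit_measure" for g j M
    by (rule measurable_unit) simp
  have F_meas: "F M \<in> borel_measurable (cube_measure s)" for M
    unfolding F_def[abs_def]
    by (intro borel_measurable_sum borel_measurable_times borel_measurable_const borel_measurable_prod
        measurable_cube_component ind) auto
  have F_lim: "(\<lambda>i. F (Suc i) x) \<longlonglongrightarrow> f x" if "x \<in> cube s" for x
    using cont[OF that] F_eq[OF that] by simp
  have f_meas: "f \<in> borel_measurable (cube_measure s)"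
    by (rule borel_measurable_LIMSEQ_metric[where f = "\<lambda>i. F (Suc i)"])
      (auto intro: F_meas F_lim simp: space_cube_measure)
  have "(\<lambda>i. integral\<^sup>L (cube_measure s) (F (Suc i))) \<longlonglongrightarrow> integral\<^sup>L (cube_measure s) f"
  proof (rule integral_dominated_convergence[where w = "\<lambda>_. B"])
    show "AE x in cube_measure s. (\<lambda>i. F (Suc i) x) \<longlonglongrightarrow> f x"
      using F_lim by (auto simp: space_cube_measure)
    show "AE x in cube_measure s. norm (F (Suc i) x) \<le> B" for i
      using F_eq bound node_in_cube cell_index_grid by (auto simp: space_cube_measure)
  qed (use F_meas f_meas in auto)
  also have "(\<lambda>i. integral\<^sup>L (cube_measure s) (F (Suc i))) = (\<lambda>i. (\<Sum>g\<in>grid s (Suc i). f (node s (Suc i) g)) / real (Suc i) ^ s)"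
  proof
    fix i
    define M where "M = Suc i"
    have M: "M > 0" by (simp add: M_def)
    have cell: "0 \<le> real (g j) / real M" "real (g j) / real M \<le> real (Suc (g j)) / real M" "real (Suc (g j)) / real M \<le> 1"
      if "g \<in> grid s M" "j \<in> {1..s}" for g j
    proof -
      have "Suc (g j) \<le> M" using that by (auto simp: grid_def PiE_iff Suc_le_eq)
      then have "real (Suc (g j)) \<le> real M" by (simp only: of_nat_le_iff)
      then show "0 \<le> real (g j) / real M" "real (g j) / real M \<le> real (Suc (g j)) / real M" "real (Suc (g j)) / real M \<le> 1"
        using M by (auto simp: divide_le_eq intro!: divide_right_mono)
    qed
    have "integral\<^sup>L (cube_measure s) (F M) = (\<Sum>g\<in>grid s M. f (node s M g) *
        (\<integral>x. (\<Prod>j\<in>{1..s}. indicat_real {real (g j) / real M..<real (Suc (g j)) / real M} (x j)) \<partial>cube_measure s))"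
      unfolding F_def
    proof (subst Bochner_Integration.integral_sum)
      fix g
      have "(\<lambda>x. \<Prod>j\<in>{1..s}. indicat_real {real (g j) / real M..<real (Suc (g j)) / real M} (x j)) \<in> borel_measurable (cube_measure s)"
        by (intro borel_measurable_prod measurable_cube_component ind) auto
      then show "integrable (cube_measure s) (\<lambda>x. f (node s M g) * (\<Prod>j\<in>{1..s}. indicat_real {real (g j) / real M..<real (Suc (g j)) / real M} (x j)))"
        by (intro integrable_mult_right integrable_const_bound[where B = 1])
          (auto simp: abs_prod intro!: prod_le_1 split: split_indicator)
    qed simp
    also have "\<dots> = (\<Sum>g\<in>grid s M. f (node s M g) * (1 / real M) ^ s)"
    proof (rule sum.cong[OF refl])
      fix g assume g: "g \<in> grid s M"
      have "(\<integral>x. (\<Prod>j\<in>{1..s}. indicat_real {real (g j) / real M..<real (Suc (g j)) / real M} (x j)) \<partial>cube_measure s)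
         = (\<Prod>j\<in>{1..s}. integral\<^sup>L unit_measure (indicat_real {real (g j) / real M..<real (Suc (g j)) / real M}))"
        by (rule integral_cube_prod) (rule integral_unit_indicator(1)[OF cell[OF g]])
      also have "\<dots> = (\<Prod>j\<in>{1..s}. real (Suc (g j)) / real M - real (g j) / real M)"
        by (intro prod.cong refl integral_unit_indicator(2) cell g)
      also have "\<dots> = (1 / real M) ^ s" by (simp add: diff_divide_distrib[symmetric])
      finally show "f (node s M g) * (\<integral>x. (\<Prod>j\<in>{1..s}. indicat_real {real (g j) / real M..<real (Suc (g j)) / real M} (x j)) \<partial>cube_measure s)
        = f (node s M g) * (1 / real M) ^ s" by simp
    qed
    finally show "integral\<^sup>L (cube_measure s) (F (Suc i)) = (\<Sum>g\<in>grid s (Suc i). f (node s (Suc i) g)) / real (Suc i) ^ s"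
      unfolding M_def by (simp only: sum_distrib_right[symmetric] power_one_over) simp
  qed
  finally show ?thesis .
qed

lemma sobolev_kernel_commute: "sobolev_kernel \<alpha> s \<gamma> x y = sobolev_kernel \<alpha> s \<gamma> y x"
  unfolding sobolev_kernel_eq by (simp only: kern_commute)

lemma tendsto_sobolev_kernel:
  assumes "\<And>j. j \<in> {1..s} \<Longrightarrow> ((\<lambda>i. X i j) \<longlongrightarrow> x j) F" "\<And>j. j \<in> {1..s} \<Longrightarrow> ((\<lambda>i. Y i j) \<longlongrightarrow> y j) F"
  shows "((\<lambda>i. sobolev_kernel \<alpha> s \<gamma> (X i) (Y i)) \<longlongrightarrow> sobolev_kernel \<alpha> s \<gamma> x y) F"
  unfolding sobolev_kernel_eq
  by (intro tendsto_sum tendsto_mult tendsto_const tendsto_prod tendsto_kern assms) auto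

lemma sobolev_kernel_bounded: "\<exists>B. \<forall>x\<in>cube s. \<bar>sobolev_kernel \<alpha> s \<gamma> x x\<bar> \<le> B"
proof -
  obtain C where C: "\<And>x y. x \<in> {0..1} \<Longrightarrow> y \<in> {0..1} \<Longrightarrow> \<bar>kern \<alpha> x y\<bar> \<le> C"
    using kern_bounded by blast
  have "\<bar>sobolev_kernel \<alpha> s \<gamma> x x\<bar> \<le> (\<Sum>u\<in>Pow {1..s}. \<bar>\<gamma> u\<bar> * (\<Prod>j\<in>u. C))" if x: "x \<in> cube s" for x
    unfolding sobolev_kernel_eq
  proof (rule order_trans[OF sum_abs sum_mono])
    fix u assume "u \<in> Pow {1..s}"
    then have "x j \<in> {0..1}" if "j \<in> u" for j
      using x that by (force simp: cube_def PiE_iff)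
    then show "\<bar>\<gamma> u * (\<Prod>j\<in>u. kern \<alpha> (x j) (x j))\<bar> \<le> \<bar>\<gamma> u\<bar> * (\<Prod>j\<in>u. C)"
      unfolding abs_mult abs_prod by (intro mult_left_mono prod_mono conjI C) auto
  qed
  then show ?thesis by blast
qed

definition grid_average :: "nat \<Rightarrow> nat \<Rightarrow> ((nat \<Rightarrow> real) \<Rightarrow> real) \<Rightarrow> real" where
  "grid_average s M f = (\<Sum>g\<in>grid s M. f (node s M g)) / real M ^ s"

text \<open>The average factors over the coordinates and each factor is small by
  \<open>kern_quadrature\<close>, so only the empty set survives. In the limit, integration is
  represented by the constant function \<open>\<gamma> {}\<close>.\<close>

lemma sobolev_kernel_grid_average:
  assumes \<alpha>: "\<alpha> \<ge> 1"
  shows "\<exists>C\<ge>0. \<forall>M>0. \<forall>x\<in>cube s. \<bar>grid_average s M (sobolev_kernel \<alpha> s \<gamma> x) - \<gamma> {}\<bar> \<le> C / real M"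
proof -
  obtain C where C: "C > 0" "\<And>M \<theta> x. M > 0 \<Longrightarrow> \<theta> \<in> {0..1} \<Longrightarrow> x \<in> {0..1} \<Longrightarrow>
     \<bar>(\<Sum>y<M. kern \<alpha> x ((real y + \<theta>) / real M)) / real M\<bar> \<le> C / real M"
    using kern_quadrature[OF \<alpha>] by blast
  define B where "B = (\<Sum>u\<in>Pow {1..s} - {{}}. \<bar>\<gamma> u\<bar> * C ^ card u)"
  have "\<bar>grid_average s M (sobolev_kernel \<alpha> s \<gamma> x) - \<gamma> {}\<bar> \<le> B / real M" if M: "M > 0" and x: "x \<in> cube s" for M x
  proof -
    define k where "k j = (\<Sum>y<M. kern \<alpha> (x j) (real y / real M)) / real M" for j
    have k: "\<bar>k j\<bar> \<le> C / real M" if "j \<in> {1..s}" for j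
      using C(2)[OF M, of 0 "x j"] x that by (force simp: k_def cube_def PiE_iff)
    have prod: "(\<Sum>g\<in>grid s M. \<Prod>j\<in>u. kern \<alpha> (x j) (node s M g j)) / real M ^ s = (\<Prod>j\<in>u. k j)" if u: "u \<subseteq> {1..s}" for u
    proof -
      have "(\<Sum>g\<in>grid s M. \<Prod>j\<in>u. kern \<alpha> (x j) (node s M g j)) =
          (\<Sum>g\<in>grid s M. \<Prod>j\<in>{1..s}. if j \<in> u then kern \<alpha> (x j) (real (g j) / real M) else 1)"
        using u by (intro sum.cong refl prod.mono_neutral_cong_left) (auto simp: node_def)
      also have "\<dots> = (\<Prod>j\<in>{1..s}. \<Sum>y<M. if j \<in> u then kern \<alpha> (x j) (real y / real M) else 1)"
        unfolding grid_def by (rule prod_sum_PiE[symmetric]) auto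
      also have "\<dots> = (\<Prod>j\<in>{1..s}. real M * (if j \<in> u then k j else 1))"
        using M by (intro prod.cong refl) (simp add: k_def)
      also have "\<dots> = real M ^ s * (\<Prod>j\<in>{1..s}. if j \<in> u then k j else 1)"
        by (simp add: prod.distrib)
      also have "(\<Prod>j\<in>{1..s}. if j \<in> u then k j else 1) = (\<Prod>j\<in>u. k j)"
        by (rule prod.mono_neutral_cong_right) (use u in auto)
      finally show ?thesis using M by simp
    qed
    have "grid_average s M (sobolev_kernel \<alpha> s \<gamma> x) = (\<Sum>u\<in>Pow {1..s}. \<gamma> u * ((\<Sum>g\<in>grid s M. \<Prod>j\<in>u. kern \<alpha> (x j) (node s M g j)) / real M ^ s))"
      unfolding grid_average_def sobolev_kernel_eq
      by (subst sum.swap) (simp add: sum_divide_distrib sum_distrib_left)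
    also have "\<dots> = (\<Sum>u\<in>Pow {1..s}. \<gamma> u * (\<Prod>j\<in>u. k j))"
      using prod by (intro sum.cong refl) simp
    also have "\<dots> = \<gamma> {} + (\<Sum>u\<in>Pow {1..s} - {{}}. \<gamma> u * (\<Prod>j\<in>u. k j))"
      by (subst sum.remove[of _ "{}"]) auto
    finally have "\<bar>grid_average s M (sobolev_kernel \<alpha> s \<gamma> x) - \<gamma> {}\<bar> = \<bar>\<Sum>u\<in>Pow {1..s} - {{}}. \<gamma> u * (\<Prod>j\<in>u. k j)\<bar>"
      by simp
    also have "\<dots> \<le> (\<Sum>u\<in>Pow {1..s} - {{}}. \<bar>\<gamma> u\<bar> * C ^ card u / real M)"
    proof (rule order_trans[OF sum_abs sum_mono])
      fix u assume u: "u \<in> Pow {1..s} - {{}}"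
      then have fin: "finite u" using finite_subset by auto
      then have "card u \<noteq> 0" using u by auto
      have "\<bar>\<Prod>j\<in>u. k j\<bar> \<le> (\<Prod>j\<in>u. C / real M)"
        unfolding abs_prod using u k by (intro prod_mono) auto
      also have "\<dots> = C ^ card u / real M ^ card u" by (simp add: power_divide)
      also have "\<dots> \<le> C ^ card u / real M"
      proof (rule divide_left_mono)
        show "real M \<le> real M ^ card u" using M \<open>card u \<noteq> 0\<close> self_le_power[of "real M" "card u"] by simp
      qed (use C M in auto)
      finally show "\<bar>\<gamma> u * (\<Prod>j\<in>u. k j)\<bar> \<le> \<bar>\<gamma> u\<bar> * C ^ card u / real M"
        unfolding abs_mult times_divide_eq_right[symmetric] by (intro mult_left_mono) auto
    qed
    also have "\<dots> = B / real M" by (simp add: B_def sum_divide_distrib)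
    finally show ?thesis .
  qed
  moreover have "B \<ge> 0" unfolding B_def using C by (intro sum_nonneg mult_nonneg_nonneg) auto
  ultimately show ?thesis by blast
qed

text \<open>
  The integral is the limit of averages over grids, and the grid averages are inner products with
  finite kernel sums; so Cauchy-Schwarz is only needed for finite kernel sums.
\<close>

lemma sobolev_worst_case:
  assumes rkhs: "rkhs (cube s) (sobolev_kernel \<alpha> s \<gamma>) H ip" and \<alpha>: "\<alpha> \<ge> 1"
    and f: "f \<in> H" "ip f f \<le> 1"
    and N: "N > 0" and p: "\<And>h. h < N \<Longrightarrow> p h \<in> cube s"
  shows "((\<Sum>h<N. f (p h)) / real N - integral\<^sup>L (cube_measure s) f)\<^sup>2
    \<le> (\<Sum>u\<in>Pow {1..s} - {{}}. \<gamma> u * ((\<Sum>h<N. \<Sum>h'<N. \<Prod>j\<in>u. kern \<alpha> (p h j) (p h' j)) / (real N)\<^sup>2))"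
proof -
  interpret rkhs "cube s" "sobolev_kernel \<alpha> s \<gamma>" H ip by (rule rkhs)
  define K where "K = sobolev_kernel \<alpha> s \<gamma>"
  obtain B where B: "\<And>x. x \<in> cube s \<Longrightarrow> \<bar>K x x\<bar> \<le> B"
    unfolding K_def using sobolev_kernel_bounded by blast
  \<comment> \<open>Two rules with a single node each, indexed by the unit type. Through this
    estimate \<open>f\<close> inherits continuity from the kernel.\<close>
  have diff_le: "(f x - f y)\<^sup>2 \<le> K x x - K y x - K x y + K y y" if "x \<in> cube s" "y \<in> cube s" for x y
    using kernel_sum_diff[of "{()}" "\<lambda>_. x" "{()}" "\<lambda>_. y" f "\<lambda>_. 1" "\<lambda>_. 1"] that f
    by (simp add: K_def)
  have f_bound: "\<bar>f x\<bar> \<le> sqrt B" if "x \<in> cube s" for x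
  proof -
    have "(f x)\<^sup>2 \<le> K x x"
      using kernel_sum_diff[of "{()}" "\<lambda>_. x" "{}::unit set" "\<lambda>_. x" f "\<lambda>_. 1" "\<lambda>_. 1"] that f
      by (simp add: K_def)
    also have "\<dots> \<le> B" using B[OF that] by simp
    finally have "sqrt ((f x)\<^sup>2) \<le> sqrt B" by (rule real_sqrt_le_mono)
    then show ?thesis by simp
  qed
  have f_cont: "(\<lambda>i. f (node s (Suc i) (cell_index s (Suc i) x))) \<longlonglongrightarrow> f x" if x: "x \<in> cube s" for x
  proof -
    define Y where "Y i = node s (Suc i) (cell_index s (Suc i) x)" for i
    have Y_cube: "Y i \<in> cube s" for i
      unfolding Y_def by (intro node_in_cube cell_index_grid x) simp
    have Y_lim: "(\<lambda>i. Y i j) \<longlonglongrightarrow> x j" if j: "j \<in> {1..s}" for j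
    proof (rule Lim_null[THEN iffD2])
      have "\<bar>Y i j - x j\<bar> \<le> 1 / real (Suc i)" for i
      proof -
        have "x j \<ge> 0" using x j by (auto simp: cube_def PiE_iff)
        then have "0 \<le> \<lfloor>x j * real (Suc i)\<rfloor>" by simp
        then have "Y i j = real_of_int \<lfloor>x j * real (Suc i)\<rfloor> / real (Suc i)"
          using j by (simp add: Y_def node_def cell_index_def del: of_nat_Suc)
        then have "Y i j - x j = (real_of_int \<lfloor>x j * real (Suc i)\<rfloor> - x j * real (Suc i)) / real (Suc i)"
          by (simp add: diff_divide_distrib del: of_nat_Suc)
        moreover have "\<bar>real_of_int \<lfloor>x j * real (Suc i)\<rfloor> - x j * real (Suc i)\<bar> \<le> 1" by linarith
        ultimately show ?thesis
          by (simp only: abs_divide abs_of_nat) (rule divide_right_mono, simp_all)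
      qed
      then have "\<forall>i. norm (Y i j - x j) \<le> inverse (real (Suc i))"
        by (simp only: real_norm_def inverse_eq_divide) simp
      then show "(\<lambda>i. Y i j - x j) \<longlonglongrightarrow> 0"
        by (intro Lim_null_comparison[OF _ LIMSEQ_inverse_real_of_nat] always_eventually)
    qed
    have "(\<lambda>i. K (Y i) x) \<longlonglongrightarrow> K x x" "(\<lambda>i. K x (Y i)) \<longlonglongrightarrow> K x x" "(\<lambda>i. K (Y i) (Y i)) \<longlonglongrightarrow> K x x"
      unfolding K_def by (auto intro!: tendsto_sobolev_kernel Y_lim)
    then have "(\<lambda>i. K x x - K (Y i) x - K x (Y i) + K (Y i) (Y i)) \<longlonglongrightarrow> K x x - K x x - K x x + K x x"
      by (intro tendsto_add tendsto_diff tendsto_const)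
    from tendsto_real_sqrt[OF this]
    have lim0: "(\<lambda>i. sqrt (K x x - K (Y i) x - K x (Y i) + K (Y i) (Y i))) \<longlonglongrightarrow> 0"
      by simp
    have "norm (f (Y i) - f x) \<le> sqrt (K x x - K (Y i) x - K x (Y i) + K (Y i) (Y i))" for i
    proof -
      have "sqrt ((f x - f (Y i))\<^sup>2) \<le> sqrt (K x x - K (Y i) x - K x (Y i) + K (Y i) (Y i))"
        by (intro real_sqrt_le_mono diff_le x Y_cube)
      then show ?thesis by (simp add: abs_minus_commute)
    qed
    then have "\<forall>i. norm (f (Y i) - f x) \<le> sqrt (K x x - K (Y i) x - K x (Y i) + K (Y i) (Y i))" ..
    then have "(\<lambda>i. f (Y i) - f x) \<longlonglongrightarrow> 0"
      by (intro Lim_null_comparison[OF _ lim0] always_eventually)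
    then show ?thesis unfolding Y_def by (rule Lim_null[THEN iffD2])
  qed
  define Q where "Q = (\<Sum>h<N. f (p h)) / real N"
  define E where "E = (\<Sum>h<N. \<Sum>h'<N. K (p h) (p h')) / (real N)\<^sup>2"
  obtain C where "C \<ge> 0" and C_all: "\<forall>M>0. \<forall>x\<in>cube s. \<bar>grid_average s M (K x) - \<gamma> {}\<bar> \<le> C / real M"
    unfolding K_def using sobolev_kernel_grid_average[OF \<alpha>, of s \<gamma>] by blast
  have C: "\<bar>grid_average s M (K x) - \<gamma> {}\<bar> \<le> C / real M" if "M > 0" "x \<in> cube s" for M x
    using C_all that by blast
  \<comment> \<open>The mixed sums \<open>G\<close>, occurring twice, and the grid sum
    \<open>GG\<close> are each within \<open>C / M\<close> of \<open>\<gamma> {}\<close> on the side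
    that matters, which adds up to \<open>3 * C / M\<close>.\<close>
  have approx: "(Q - grid_average s M f)\<^sup>2 \<le> E - \<gamma> {} + 3 * C / real M" if M: "M > 0" for M
  proof -
    define G where "G = (\<Sum>h<N. grid_average s M (K (p h))) / real N"
    define GG where "GG = (\<Sum>g\<in>grid s M. grid_average s M (K (node s M g))) / real M ^ s"
    have "((\<Sum>h<N. 1 / real N * f (p h)) - (\<Sum>g\<in>grid s M. 1 / real M ^ s * f (node s M g)))\<^sup>2
      \<le> (\<Sum>h<N. 1 / real N * (\<Sum>h'<N. 1 / real N * K (p h) (p h')))
       - (\<Sum>g\<in>grid s M. 1 / real M ^ s * (\<Sum>h<N. 1 / real N * K (node s M g) (p h)))
       - (\<Sum>h<N. 1 / real N * (\<Sum>g\<in>grid s M. 1 / real M ^ s * K (p h) (node s M g)))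
       + (\<Sum>g\<in>grid s M. 1 / real M ^ s * (\<Sum>g'\<in>grid s M. 1 / real M ^ s * K (node s M g) (node s M g')))"
      unfolding K_def using p f node_in_cube by (intro kernel_sum_diff) auto
    also have "(\<Sum>h<N. 1 / real N * f (p h)) = Q" by (simp add: Q_def sum_divide_distrib)
    also have "(\<Sum>g\<in>grid s M. 1 / real M ^ s * f (node s M g)) = grid_average s M f"
      by (simp add: grid_average_def sum_divide_distrib)
    also have "(\<Sum>h<N. 1 / real N * (\<Sum>h'<N. 1 / real N * K (p h) (p h'))) = E"
      by (simp add: E_def power2_eq_square sum_divide_distrib)
    also have "(\<Sum>g\<in>grid s M. 1 / real M ^ s * (\<Sum>h<N. 1 / real N * K (node s M g) (p h))) = G"
    proof -
      have "(\<Sum>g\<in>grid s M. 1 / real M ^ s * (\<Sum>h<N. 1 / real N * K (node s M g) (p h)))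
        = (\<Sum>h<N. \<Sum>g\<in>grid s M. 1 / real M ^ s * (1 / real N * K (p h) (node s M g)))"
        unfolding sum_distrib_left K_def by (subst sum.swap) (simp only: sobolev_kernel_commute)
      then show ?thesis by (simp add: G_def grid_average_def sum_divide_distrib)
    qed
    also have "(\<Sum>h<N. 1 / real N * (\<Sum>g\<in>grid s M. 1 / real M ^ s * K (p h) (node s M g))) = G"
      by (simp add: G_def grid_average_def sum_divide_distrib)
    also have "(\<Sum>g\<in>grid s M. 1 / real M ^ s * (\<Sum>g'\<in>grid s M. 1 / real M ^ s * K (node s M g) (node s M g'))) = GG"
      by (simp add: GG_def grid_average_def sum_divide_distrib)
    finally have main: "(Q - grid_average s M f)\<^sup>2 \<le> E - G - G + GG" .
    have "(\<Sum>h<N. \<gamma> {} - C / real M) \<le> (\<Sum>h<N. grid_average s M (K (p h)))"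
      by (rule sum_mono) (use C[OF M p] in \<open>force simp: abs_le_iff\<close>)
    then have G: "\<gamma> {} - C / real M \<le> G"
      using N by (simp add: G_def le_divide_eq mult.commute)
    have "(\<Sum>g\<in>grid s M. grid_average s M (K (node s M g))) \<le> (\<Sum>g\<in>grid s M. \<gamma> {} + C / real M)"
      by (rule sum_mono) (use C[OF M node_in_cube] in \<open>force simp: abs_le_iff\<close>)
    then have GG: "GG \<le> \<gamma> {} + C / real M"
      using M by (simp add: GG_def divide_le_eq card_grid mult.commute)
    show ?thesis using main G GG by simp
  qed
  have lim_avg: "(\<lambda>i. grid_average s (Suc i) f) \<longlonglongrightarrow> integral\<^sup>L (cube_measure s) f"
    unfolding grid_average_def by (rule grid_average_tendsto[OF f_bound f_cont])
  have "(Q - integral\<^sup>L (cube_measure s) f)\<^sup>2 \<le> E - \<gamma> {} + 3 * C * 0"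
  proof (rule LIMSEQ_le)
    show "(\<lambda>i. (Q - grid_average s (Suc i) f)\<^sup>2) \<longlonglongrightarrow> (Q - integral\<^sup>L (cube_measure s) f)\<^sup>2"
      by (intro tendsto_intros lim_avg)
    show "(\<lambda>i. E - \<gamma> {} + 3 * C * inverse (real (Suc i))) \<longlonglongrightarrow> E - \<gamma> {} + 3 * C * 0"
      by (intro tendsto_intros LIMSEQ_inverse_real_of_nat)
    show "\<exists>N. \<forall>i\<ge>N. (Q - grid_average s (Suc i) f)\<^sup>2 \<le> E - \<gamma> {} + 3 * C * inverse (real (Suc i))"
      using approx[of "Suc i" for i] by (auto simp: divide_inverse)
  qed
  also have "E = (\<Sum>u\<in>Pow {1..s}. \<gamma> u * ((\<Sum>h<N. \<Sum>h'<N. \<Prod>j\<in>u. kern \<alpha> (p h j) (p h' j)) / (real N)\<^sup>2))"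
  proof -
    have "(\<Sum>h<N. \<Sum>h'<N. K (p h) (p h')) = (\<Sum>u\<in>Pow {1..s}. \<Sum>h<N. \<Sum>h'<N. \<gamma> u * (\<Prod>j\<in>u. kern \<alpha> (p h j) (p h' j)))"
    proof -
      have "(\<Sum>h<N. \<Sum>h'<N. K (p h) (p h')) = (\<Sum>h<N. \<Sum>u\<in>Pow {1..s}. \<Sum>h'<N. \<gamma> u * (\<Prod>j\<in>u. kern \<alpha> (p h j) (p h' j)))"
        unfolding K_def sobolev_kernel_eq by (rule sum.cong[OF refl], rule sum.swap)
      then show ?thesis by (subst (asm) sum.swap)
    qed
    then show ?thesis
      by (simp only: E_def sum_divide_distrib[of _ "Pow {1..s}"] sum_distrib_left[symmetric] times_divide_eq_right)
  qed
  \<comment> \<open>The product over the empty set is 1, so this summand is exactly the constant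
    that was subtracted.\<close>
  also have "\<dots> = \<gamma> {} + (\<Sum>u\<in>Pow {1..s} - {{}}. \<gamma> u * ((\<Sum>h<N. \<Sum>h'<N. \<Prod>j\<in>u. kern \<alpha> (p h j) (p h' j)) / (real N)\<^sup>2))"
    using N by (subst sum.remove[of _ "{}"]) (auto simp: power2_eq_square)
  finally show ?thesis unfolding Q_def by simp
qed

section \<open>Digital shifts of the net\<close>

text \<open>With \<open>M = b ^ n\<close>, \<open>S\<close> holds the first \<open>n\<close> digits
  of the integration variable and \<open>\<tau>\<close> the remaining ones.\<close>

lemma integral_unit_cells:
  fixes g :: "real \<Rightarrow> real"
  assumes M: "M > 0" and meas: "g \<in> borel_measurable unit_measure" and bound: "\<And>x. x \<in> {0..<1} \<Longrightarrow> \<bar>g x\<bar> \<le> B"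
  shows "integral\<^sup>L unit_measure g = (\<Sum>S<M. \<integral>\<tau>. g ((real S + \<tau>) / real M) \<partial>unit_measure) / real M"
proof -
  define G where "G x = indicat_real {0..<1} x * g x" for x
  have G_meas [measurable]: "G \<in> borel_measurable lborel"
    using meas by (simp add: G_def[abs_def] borel_measurable_restrict_space_iff mult.commute)
  have cell: "(\<integral>x. indicat_real {real S / real M..<real (Suc S) / real M} x * G x \<partial>lborel)
      = (\<integral>\<tau>. g ((real S + \<tau>) / real M) \<partial>unit_measure) / real M" if S: "S < M" for S
  proof -
    have "(\<integral>x. indicat_real {real S / real M..<real (Suc S) / real M} x * G x \<partial>lborel)
       = \<bar>1 / real M\<bar> *\<^sub>R (\<integral>x. indicat_real {real S / real M..<real (Suc S) / real M} (real S / real M + 1 / real M * x) * G (real S / real M + 1 / real M * x) \<partial>lborel)"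
      using M by (intro lborel_integral_real_affine) auto
    also have "(\<lambda>x. indicat_real {real S / real M..<real (Suc S) / real M} (real S / real M + 1 / real M * x) * G (real S / real M + 1 / real M * x))
       = (\<lambda>x. indicat_real {0..<1} x * g ((real S + x) / real M))"
    proof
      fix x
      have eq: "real S / real M + 1 / real M * x = (real S + x) / real M" by (simp add: add_divide_distrib)
      have "Suc S \<le> M" using S by simp
      then have "real S + 1 \<le> real M" by (metis of_nat_Suc of_nat_le_iff add.commute)
      then show "indicat_real {real S / real M..<real (Suc S) / real M} (real S / real M + 1 / real M * x) * G (real S / real M + 1 / real M * x)
         = indicat_real {0..<1} x * g ((real S + x) / real M)"
        unfolding eq using M by (auto simp: indicator_def G_def divide_le_eq le_divide_eq divide_less_eq less_divide_eq)
    qed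
    finally show ?thesis
      using M by (simp add: integral_restrict_space)
  qed
  have integ: "integrable lborel (\<lambda>x. indicat_real {real S / real M..<real (Suc S) / real M} x * G x)" for S
  proof (rule Bochner_Integration.integrable_bound[where f = "\<lambda>x. B * indicat_real {0..<1::real} x"])
    show "AE x in lborel. norm (indicat_real {real S / real M..<real (Suc S) / real M} x * G x) \<le> norm (B * indicat_real {0..<1} x)"
      using bound by (intro always_eventually) (auto simp: G_def indicator_def intro: order_trans[OF _ abs_ge_self])
  qed auto
  have "integral\<^sup>L unit_measure g = (\<integral>x. G x \<partial>lborel)"
    by (simp add: integral_restrict_space G_def)
  also have "\<dots> = (\<integral>x. (\<Sum>S<M. indicat_real {real S / real M..<real (Suc S) / real M} x * G x) \<partial>lborel)"
  proof (rule Bochner_Integration.integral_cong[OF refl])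
    fix x :: real
    have "(\<Sum>S<M. indicat_real {real S / real M..<real (Suc S) / real M} x) = indicat_real {0..<1} x"
    proof (cases "x \<in> {0..<1}")
      case True
      define S0 where "S0 = nat \<lfloor>x * real M\<rfloor>"
      have fl: "0 \<le> \<lfloor>x * real M\<rfloor>" using True by simp
      have S0: "S0 < M" using True M fl by (simp add: S0_def nat_less_iff floor_less_iff)
      have "x \<in> {real S / real M..<real (Suc S) / real M} \<longleftrightarrow> S = S0" for S
      proof -
        have "x \<in> {real S / real M..<real (Suc S) / real M} \<longleftrightarrow> real S \<le> x * real M \<and> x * real M < real S + 1"
          using M by (simp add: divide_le_eq less_divide_eq add.commute)
        also have "\<dots> \<longleftrightarrow> \<lfloor>x * real M\<rfloor> = int S" by (simp add: floor_eq_iff)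
        also have "\<dots> \<longleftrightarrow> S = S0" using fl by (auto simp: S0_def)
        finally show ?thesis .
      qed
      then have "(\<Sum>S<M. indicat_real {real S / real M..<real (Suc S) / real M} x) = (\<Sum>S<M. if S = S0 then 1 else 0)"
        by (intro sum.cong refl) (simp add: indicator_def)
      then show ?thesis using True S0 by simp
    next
      case False
      have "indicat_real {real S / real M..<real (Suc S) / real M} x = 0" if "S < M" for S
      proof -
        have "Suc S \<le> M" using that by simp
        then have "real (Suc S) / real M \<le> 1" using M by (simp add: divide_le_eq del: of_nat_Suc)
        have lower: "0 \<le> real S / real M" by simp
        have "x \<notin> {real S / real M..<real (Suc S) / real M}"
        proof
          assume "x \<in> {real S / real M..<real (Suc S) / real M}"
          then have "real S / real M \<le> x" "x < real (Suc S) / real M" by auto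
          then have "0 \<le> x" "x < 1" using lower \<open>real (Suc S) / real M \<le> 1\<close> by linarith+
          with False show False by simp
        qed
        then show ?thesis by simp
      qed
      then show ?thesis using False by simp
    qed
    then show "G x = (\<Sum>S<M. indicat_real {real S / real M..<real (Suc S) / real M} x * G x)"
      by (simp only: sum_distrib_right[symmetric]) (simp add: G_def indicator_def)
  qed
  also have "\<dots> = (\<Sum>S<M. \<integral>x. indicat_real {real S / real M..<real (Suc S) / real M} x * G x \<partial>lborel)"
    by (rule Bochner_Integration.integral_sum) (rule integ)
  also have "\<dots> = (\<Sum>S<M. \<integral>\<tau>. g ((real S + \<tau>) / real M) \<partial>unit_measure) / real M"
    using cell by (simp add: sum_divide_distrib)
  finally show ?thesis .
qed

lemma borel_measurable_digital_add [measurable]: "digital_add b x \<in> borel_measurable borel"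
  unfolding digital_add_def[abs_def] digit_def by measurable

context digit_base
begin

text \<open>Addition without carries in the group of \<open>n\<close>-digit numbers, by recursion on
  the last digit as for \<open>chi\<close>.\<close>

primrec dadd :: "nat \<Rightarrow> nat \<Rightarrow> nat \<Rightarrow> nat" where
  "dadd 0 X S = 0"
| "dadd (Suc n) X S = (X mod b + S mod b) mod b + dadd n (X div b) (S div b) * b"

lemma div_less_power: "X < b ^ Suc n \<Longrightarrow> X div b < b ^ n"
  using b_pos by (simp add: div_less_iff_less_mult mult.commute)

lemma dadd_div_mod: "dadd (Suc n) X S mod b = (X mod b + S mod b) mod b" "dadd (Suc n) X S div b = dadd n (X div b) (S div b)"
  using b_pos by simp_all

lemma dadd_less: "dadd n X S < b ^ n"
proof (induction n arbitrary: X S)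
  case (Suc n)
  have "dadd n (X div b) (S div b) + 1 \<le> b ^ n" using Suc[of "X div b" "S div b"] by simp
  then have "(dadd n (X div b) (S div b) + 1) * b \<le> b ^ n * b" by (rule mult_right_mono) simp
  moreover have "(X mod b + S mod b) mod b < b" using b_pos by simp
  ultimately show ?case by (simp add: algebra_simps)
qed simp

lemma dadd_commute: "dadd n X S = dadd n S X"
  by (induction n arbitrary: X S) (auto simp: add.commute)

lemma dadd_assoc: "dadd n (dadd n X S) T = dadd n X (dadd n S T)"
  by (induction n arbitrary: X S T) (auto simp: dadd_div_mod mod_simps add.assoc simp del: dadd.simps(2) simp: dadd.simps(2)[of _ "dadd _ _ _"] dadd.simps(2)[of _ _ "dadd _ _ _"])

lemma dadd_inj: "S < b ^ n \<Longrightarrow> S' < b ^ n \<Longrightarrow> dadd n X S = dadd n X S' \<Longrightarrow> S = S'"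
proof (induction n arbitrary: X S S')
  case (Suc n)
  have "dadd n (X div b) (S div b) = dadd n (X div b) (S' div b)"
    using Suc.prems(3) dadd_div_mod(2)[of n X] by metis
  then have "S div b = S' div b"
    using Suc.IH div_less_power Suc.prems(1,2) by blast
  moreover have "[X mod b + S mod b = X mod b + S' mod b] (mod b)"
    using Suc.prems(3) dadd_div_mod(1)[of n X] unfolding cong_def by metis
  then have "[S mod b = S' mod b] (mod b)" by (rule cong_add_lcancel_nat[THEN iffD1])
  then have "S mod b = S' mod b" by (simp add: cong_def)
  ultimately show ?case by (metis mult_div_mod_eq)
qed simp

lemma bij_betw_dadd: "bij_betw (dadd n X) {..<b ^ n} {..<b ^ n}"
proof -
  have "inj_on (dadd n X) {..<b ^ n}" by (rule inj_onI) (use dadd_inj in auto)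
  moreover have "dadd n X ` {..<b ^ n} \<subseteq> {..<b ^ n}" using dadd_less by auto
  ultimately show ?thesis by (simp add: bij_betw_def endo_inj_surj)
qed

lemma chi_dadd: "chi n k (int (dadd n X S)) = chi n k (int X) * chi n k (int S)"
proof (induction n arbitrary: X S)
  case (Suc n)
  define z where "z = (X mod b + S mod b) mod b"
  have z: "z < b" using b_pos by (simp add: z_def)
  have "\<omega> ^ (k (Suc n) * z) = \<omega> ^ (k (Suc n) * (X mod b)) * \<omega> ^ (k (Suc n) * (S mod b))"
  proof -
    have "\<omega> ^ (k (Suc n) * z) = (\<omega> ^ z) ^ k (Suc n)" by (simp add: power_mult[symmetric] mult.commute)
    also have "\<omega> ^ z = \<omega> ^ (X mod b) * \<omega> ^ (S mod b)"
      unfolding z_def omega_power_mod power_add ..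
    also have "(\<omega> ^ (X mod b) * \<omega> ^ (S mod b)) ^ k (Suc n) = \<omega> ^ (k (Suc n) * (X mod b)) * \<omega> ^ (k (Suc n) * (S mod b))"
      by (simp add: power_mult_distrib power_mult[symmetric] mult.commute)
    finally show ?thesis .
  qed
  moreover have "chi (Suc n) k (int X) = chi n k (int (X div b)) * \<omega> ^ (k (Suc n) * (X mod b))" for X
    by (simp add: zdiv_int[symmetric] nat_mod_distrib of_nat_mod[symmetric])
  moreover have "chi (Suc n) k (int (dadd (Suc n) X S)) = chi n k (int (dadd n (X div b) (S div b))) * \<omega> ^ (k (Suc n) * z)"
    unfolding dadd.simps z_def[symmetric] by (rule chi_Suc_nat[OF z])
  ultimately show ?case by (simp add: Suc mult_ac)
qed simp

lemma dadd_digits: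
  "dadd n X S = (\<Sum>i=1..n. ((X div b ^ (n - i) mod b + S div b ^ (n - i) mod b) mod b) * b ^ (n - i))"
proof (induction n arbitrary: X S)
  case (Suc n)
  have eq: "X div b div b ^ (n - i) = X div b ^ (Suc n - i)" if "i \<in> {1..n}" for X i
  proof -
    have "Suc n - i = Suc (n - i)" using that by auto
    then show ?thesis by (simp add: div_mult2_eq)
  qed
  have "dadd n (X div b) (S div b) * b = (\<Sum>i=1..n. ((X div b div b ^ (n - i) mod b + S div b div b ^ (n - i) mod b) mod b) * b ^ (n - i) * b)"
    unfolding Suc sum_distrib_right ..
  also have "\<dots> = (\<Sum>i=1..n. ((X div b ^ (Suc n - i) mod b + S div b ^ (Suc n - i) mod b) mod b) * b ^ (Suc n - i))"
  proof (rule sum.cong[OF refl])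
    fix i assume i: "i \<in> {1..n}"
    then have "b ^ (n - i) * b = b ^ (Suc n - i)" by (simp add: Suc_diff_le)
    then show "((X div b div b ^ (n - i) mod b + S div b div b ^ (n - i) mod b) mod b) * b ^ (n - i) * b =
      ((X div b ^ (Suc n - i) mod b + S div b ^ (Suc n - i) mod b) mod b) * b ^ (Suc n - i)"
      unfolding eq[OF i] by (simp only: mult.assoc)
  qed
  finally show ?case by simp
qed simp

lemma digit_grid:
  assumes "\<tau> \<in> {0..<1}" "i \<in> {1..n}"
  shows "digit b ((real S + \<tau>) / real (b ^ n)) i = S div b ^ (n - i) mod b"
proof -
  have "real (b ^ n) = real (b ^ (n - i)) * real (b ^ i)"
    using assms by (simp add: power_add[symmetric])
  then have "(real S + \<tau>) / real (b ^ n) * real b ^ i = (real S + \<tau>) / real_of_int (int (b ^ (n - i)))"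
    using b_pos by simp
  then have "\<lfloor>(real S + \<tau>) / real (b ^ n) * real b ^ i\<rfloor> = \<lfloor>real S + \<tau>\<rfloor> div int (b ^ (n - i))"
    by (simp only:) (rule floor_divide_real_eq_div, simp)
  also have "\<lfloor>real S + \<tau>\<rfloor> = int S" using assms by (simp add: floor_eq_iff)
  finally show ?thesis
    by (simp add: digit_def zdiv_int[symmetric] zmod_int[symmetric] del: of_nat_power)
qed

lemma digit_grid_tail:
  assumes "i \<ge> 1"
  shows "digit b ((real S + \<tau>) / real (b ^ n)) (n + i) = digit b \<tau> i"
proof -
  have "(real S + \<tau>) / real (b ^ n) * real b ^ (n + i) = \<tau> * real b ^ i + of_int (int (S * b ^ i))"
    using b_pos by (simp add: power_add field_simps)
  then have "\<lfloor>(real S + \<tau>) / real (b ^ n) * real b ^ (n + i)\<rfloor> = \<lfloor>\<tau> * real b ^ i\<rfloor> + int (S * b ^ i)"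
    by (simp only: floor_add_int)
  moreover have "int b dvd int (S * b ^ i)" using assms by (simp add: dvd_power dvd_mult)
  ultimately show ?thesis by (simp add: digit_def mod_add_right_eq dvd_eq_mod_eq_0 del: of_nat_mult of_nat_power)
     (metis add.right_neutral mod_add_right_eq)
qed

text \<open>A grid point has no digits after position \<open>n\<close>, so those of the shift pass
  unchanged. This is why all net points under the same shift have the same offset
  \<open>\<tau>\<close>.\<close>

lemma digital_add_grid:
  assumes \<tau>: "\<tau> \<in> {0..<1}"
  shows "digital_add b (real X / real (b ^ n)) ((real S + \<tau>) / real (b ^ n)) = (real (dadd n X S) + \<tau>) / real (b ^ n)"
proof -
  define a where "a i = real ((digit b (real X / real (b ^ n)) (Suc i) + digit b ((real S + \<tau>) / real (b ^ n)) (Suc i)) mod b) / real b ^ Suc i" for i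
  have tail: "a (i + n) = real (digit b \<tau> (Suc i)) / real b ^ Suc i * (1 / real (b ^ n))" for i
  proof -
    have "digit b (real X / real (b ^ n)) (n + Suc i) = digit b 0 (Suc i)"
      using digit_grid_tail[of "Suc i" X 0 n] by simp
    moreover have "digit b ((real S + \<tau>) / real (b ^ n)) (n + Suc i) = digit b \<tau> (Suc i)"
      by (rule digit_grid_tail) simp
    moreover have "digit b 0 (Suc i) = 0" by (simp add: digit_def)
    moreover have "digit b \<tau> (Suc i) mod b = digit b \<tau> (Suc i)" using digit_less[OF b_pos] by simp
    ultimately show ?thesis
      by (simp add: a_def add.commute[of i] power_add)
  qed
  have "(\<lambda>i. a (i + n)) sums (\<tau> * (1 / real (b ^ n)))"
    unfolding tail by (intro sums_mult2 digit_sums b_ge_2 \<tau>)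
  then have "a sums (\<tau> * (1 / real (b ^ n)) + (\<Sum>i<n. a i))"
    by (rule sums_iff_shift[THEN iffD1])
  moreover have "(\<Sum>i<n. a i) = real (dadd n X S) / real (b ^ n)"
  proof -
    have "(\<Sum>i<n. a i) = (\<Sum>i=1..n. real (((X div b ^ (n - i) mod b + S div b ^ (n - i) mod b) mod b) * b ^ (n - i)) / real (b ^ n))"
    proof (rule sum.reindex_bij_witness[of _ "\<lambda>i. i - 1" Suc])
      fix i assume "i \<in> {..<n}"
      then have i: "Suc i \<in> {1..n}" by auto
      have "real (b ^ n) = real (b ^ (n - Suc i)) * real b ^ Suc i"
        using i by (simp add: power_add[symmetric] del: power_Suc)
      then show "real (((X div b ^ (n - Suc i) mod b + S div b ^ (n - Suc i) mod b) mod b) * b ^ (n - Suc i)) / real (b ^ n) = a i"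
        using digit_grid[OF _ i, of 0 X] digit_grid[OF \<tau> i, of S] b_pos by (simp add: a_def)
    qed auto
    then show ?thesis unfolding dadd_digits by (simp add: sum_divide_distrib)
  qed
  ultimately show ?thesis
    unfolding digital_add_def a_def[symmetric] by (simp add: sums_iff add_divide_distrib)
qed

section \<open>Character expansion of the shift-averaged kernel\<close>

lemma sum_omega_orthogonal:
  assumes "z < b" "z' < b"
  shows "(\<Sum>c<b. \<omega> ^ (c * z) * cnj (\<omega> ^ (c * z'))) = (if z = z' then of_nat b else 0)"
proof (cases "z = z'")
  case True
  have "\<omega> ^ j * cnj (\<omega> ^ j) = 1" for j
    by (metis complex_norm_square norm_omega_power of_real_1 one_power2)
  with True show ?thesis by (simp del: complex_cnj_power)
next
  case False
  define q where "q = \<omega> ^ z * cnj (\<omega> ^ z')"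
  have "\<omega> ^ (c * z) * cnj (\<omega> ^ (c * z')) = q ^ c" for c
    by (simp add: q_def power_mult_distrib power_mult[symmetric] mult.commute)
  moreover have "q ^ b = 1"
  proof -
    have "\<omega> ^ (z * b) = 1" for z
      by (simp add: mult.commute[of z] power_mult)
    then show ?thesis
      by (simp add: q_def power_mult_distrib power_mult[symmetric] flip: complex_cnj_power)
  qed
  moreover have "q \<noteq> 1"
  proof
    assume "q = 1"
    have inv: "cnj (\<omega> ^ z') * \<omega> ^ z' = 1"
      by (metis complex_norm_square mult.commute norm_omega_power of_real_1 one_power2)
    have "\<omega> ^ z = q * \<omega> ^ z'"
      unfolding q_def by (simp only: mult.assoc inv mult_1_right)
    with \<open>q = 1\<close> have "\<omega> ^ z = \<omega> ^ z'" by simp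
    then have "z mod b = z' mod b"
      using complex_root_unity_eq[of b z z'] b_pos by (simp add: omega_power)
    then show False using assms False by simp
  qed
  ultimately show ?thesis using False geometric_sum[of q b] by simp
qed

lemma chi_cong: "(\<And>i. i \<in> {1..n} \<Longrightarrow> k i = k' i) \<Longrightarrow> chi n k X = chi n k' X"
  by (induction n arbitrary: X) auto

text \<open>The sum runs over the frequencies: this is the completeness relation, as needed to
  recover a function from its coefficients.\<close>

lemma chi_orthogonal:
  assumes "Z < b ^ n" "Z' < b ^ n"
  shows "(\<Sum>k\<in>digits n. chi n k (int Z) * cnj (chi n k (int Z'))) = (if Z = Z' then of_nat (b ^ n) else 0)"
  using assms
proof (induction n arbitrary: Z Z')
  case 0
  then show ?case by (simp add: digits_0)
next
  case (Suc n)
  have upd: "chi n (h(Suc n := c)) X = chi n h X" for h c X by (rule chi_cong) auto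
  have chi: "chi (Suc n) (h(Suc n := c)) (int X) = chi n h (int (X div b)) * \<omega> ^ (c * (X mod b))" for h c X
    using chi_Suc_nat[of "X mod b" n "h(Suc n := c)" "X div b"] b_pos
    by (simp only: upd fun_upd_same) (simp del: chi.simps)
  have "(\<Sum>k\<in>digits (Suc n). chi (Suc n) k (int Z) * cnj (chi (Suc n) k (int Z')))
    = (\<Sum>c<b. \<Sum>h\<in>digits n. (\<omega> ^ (c * (Z mod b)) * cnj (\<omega> ^ (c * (Z' mod b)))) * (chi n h (int (Z div b)) * cnj (chi n h (int (Z' div b)))))"
    unfolding sum_digits_Suc chi by (simp add: mult_ac)
  also have "\<dots> = (\<Sum>c<b. \<omega> ^ (c * (Z mod b)) * cnj (\<omega> ^ (c * (Z' mod b)))) * (\<Sum>h\<in>digits n. chi n h (int (Z div b)) * cnj (chi n h (int (Z' div b))))"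
    by (simp only: sum_product)
  also have "\<dots> = (if Z mod b = Z' mod b then of_nat b else 0) * (if Z div b = Z' div b then of_nat (b ^ n) else 0)"
    using b_pos Suc.prems by (subst sum_omega_orthogonal Suc.IH; simp add: div_less_power)+
  also have "\<dots> = (if Z = Z' then of_nat (b ^ Suc n) else 0)"
  proof -
    have "Z = Z' \<longleftrightarrow> Z mod b = Z' mod b \<and> Z div b = Z' div b" by (metis mult_div_mod_eq)
    then show ?thesis by simp
  qed
  finally show ?case .
qed

text \<open>The average over the shift is taken in two stages: here over the digits after position
  \<open>n\<close>, in \<open>kern_shift\<close> over the first \<open>n\<close> digits. Only the
  second stage uses the digit group.\<close>

definition kern_avg :: "nat \<Rightarrow> nat \<Rightarrow> nat \<Rightarrow> nat \<Rightarrow> real" where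
  "kern_avg a n X Y = (\<integral>\<tau>. kern a ((real X + \<tau>) / real (b ^ n)) ((real Y + \<tau>) / real (b ^ n)) \<partial>unit_measure)"

definition kern_shift :: "nat \<Rightarrow> nat \<Rightarrow> nat \<Rightarrow> nat \<Rightarrow> real" where
  "kern_shift a n X Y = (\<Sum>S<b ^ n. kern_avg a n (dadd n X S) (dadd n Y S)) / real (b ^ n)"

definition shift_coeff :: "nat \<Rightarrow> nat \<Rightarrow> (nat \<Rightarrow> nat) \<Rightarrow> complex" where
  "shift_coeff a n k = (\<Sum>X<b ^ n. \<Sum>Y<b ^ n. of_real (kern_avg a n X Y) * cnj (chi n k (int X)) * chi n k (int Y)) / of_nat (b ^ n) ^ 2"

lemma grid_point_less: "X < b ^ n \<Longrightarrow> \<tau> \<in> {0..<1} \<Longrightarrow> (real X + \<tau>) / real (b ^ n) \<in> {0..<1}"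
proof -
  assume "X < b ^ n" "\<tau> \<in> {0..<1}"
  then have "real X + 1 \<le> real (b ^ n)" by (metis Suc_leI of_nat_Suc of_nat_le_iff add.commute)
  then show ?thesis using \<open>\<tau> \<in> {0..<1}\<close> b_pos by (auto simp: divide_less_eq)
qed

lemma integrable_kern_grid:
  assumes "X < b ^ n" "Y < b ^ n"
  shows "integrable unit_measure (\<lambda>\<tau>. kern a ((real X + \<tau>) / real (b ^ n)) ((real Y + \<tau>) / real (b ^ n)))"
proof -
  obtain C where C: "\<And>x y. x \<in> {0..1} \<Longrightarrow> y \<in> {0..1} \<Longrightarrow> \<bar>kern a x y\<bar> \<le> C"
    using kern_bounded by blast
  show ?thesis
  proof (rule integrable_unit[where B = C])
    show "(\<lambda>\<tau>. kern a ((real X + \<tau>) / real (b ^ n)) ((real Y + \<tau>) / real (b ^ n))) \<in> borel_measurable unit_measure"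
      by (rule measurable_unit) measurable
    fix \<tau> :: real assume "\<tau> \<in> {0..<1}"
    then have "(real X + \<tau>) / real (b ^ n) \<in> {0..<1}" "(real Y + \<tau>) / real (b ^ n) \<in> {0..<1}"
      using grid_point_less assms by blast+
    then show "norm (kern a ((real X + \<tau>) / real (b ^ n)) ((real Y + \<tau>) / real (b ^ n))) \<le> C"
      using C by auto
  qed
qed

lemma shift_coeff_bound:
  assumes bound: "\<And>\<tau>. \<tau> \<in> {0..<1} \<Longrightarrow> norm (kern_coeff a n \<tau> k) \<le> B"
  shows "norm (shift_coeff a n k) \<le> B"
proof -
  define M where "M = b ^ n"
  define F where "F X Y \<tau> = complex_of_real (kern a ((real X + \<tau>) / real M) ((real Y + \<tau>) / real M)) * (cnj (chi n k (int X)) * chi n k (int Y))" for X Y \<tau>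
  have int_F: "integrable unit_measure (F X Y)" if "X < M" "Y < M" for X Y
    unfolding F_def[abs_def] using integrable_kern_grid[of X n Y a] that unfolding M_def
    by (intro integrable_mult_left integrable_of_real) auto
  have coeff: "kern_coeff a n \<tau> k = (\<Sum>X<M. \<Sum>Y<M. F X Y \<tau>) / of_nat M ^ 2" for \<tau>
    by (simp add: kern_coeff_def M_def F_def mult.assoc)
  have "(\<integral>\<tau>. kern_coeff a n \<tau> k \<partial>unit_measure) = (\<Sum>X<M. \<Sum>Y<M. (\<integral>\<tau>. F X Y \<tau> \<partial>unit_measure)) / of_nat M ^ 2"
  proof -
    have "(\<integral>\<tau>. (\<Sum>X<M. \<Sum>Y<M. F X Y \<tau>) \<partial>unit_measure) = (\<Sum>X<M. \<integral>\<tau>. (\<Sum>Y<M. F X Y \<tau>) \<partial>unit_measure)"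
      by (rule Bochner_Integration.integral_sum, rule Bochner_Integration.integrable_sum) (use int_F in auto)
    also have "\<dots> = (\<Sum>X<M. \<Sum>Y<M. (\<integral>\<tau>. F X Y \<tau> \<partial>unit_measure))"
      by (rule sum.cong[OF refl], rule Bochner_Integration.integral_sum) (use int_F in auto)
    finally show ?thesis unfolding coeff by simp
  qed
  also have "\<dots> = shift_coeff a n k"
    unfolding shift_coeff_def M_def[symmetric]
    by (simp add: F_def kern_avg_def M_def mult.assoc)
  finally have eq: "shift_coeff a n k = (\<integral>\<tau>. kern_coeff a n \<tau> k \<partial>unit_measure)" ..
  have int_coeff: "integrable unit_measure (\<lambda>\<tau>. kern_coeff a n \<tau> k)"
    unfolding coeff using int_F by (intro integrable_divide Bochner_Integration.integrable_sum) auto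
  have "norm (shift_coeff a n k) \<le> (\<integral>\<tau>. norm (kern_coeff a n \<tau> k) \<partial>unit_measure)"
    unfolding eq by (rule integral_norm_bound)
  also have "\<dots> \<le> (\<integral>\<tau>. B \<partial>unit_measure)"
    using bound int_coeff by (intro integral_mono) (auto intro: unit.integrable_const)
  also have "\<dots> = B" using unit.prob_space by simp
  finally show ?thesis .
qed

text \<open>Averaging over \<open>S\<close> makes the kernel invariant under simultaneous
  translation in the digit group, so only diagonal products of characters occur. The proof goes
  backwards: after the coefficients are inserted, orthogonality selects the pairs \<open>Y\<close>,
  \<open>Y'\<close> that arise from \<open>X\<close>, \<open>X'\<close> by a common
  translation.\<close>

lemma kern_shift_expansion:
  assumes X: "X < b ^ n" "X' < b ^ n"
  shows "of_real (kern_shift a n X X') = (\<Sum>k\<in>digits n. shift_coeff a n k * (chi n k (int X) * cnj (chi n k (int X'))))"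
proof -
  define M where "M = b ^ n"
  have M: "M > 0" using b_pos by (simp add: M_def)
  define A where "A Y Y' = complex_of_real (kern_avg a n Y Y')" for Y Y'
  have "(\<Sum>k\<in>digits n. shift_coeff a n k * (chi n k (int X) * cnj (chi n k (int X'))))
     = (\<Sum>k\<in>digits n. \<Sum>Y<M. \<Sum>Y'<M. A Y Y' * (chi n k (int (dadd n X Y')) * cnj (chi n k (int (dadd n X' Y))))) / of_nat M ^ 2"
    unfolding shift_coeff_def M_def[symmetric] A_def[symmetric]
    unfolding sum_divide_distrib[of _ "digits n"]
    by (intro sum.cong refl) (simp add: sum_divide_distrib sum_distrib_right sum_distrib_left chi_dadd mult_ac)
  also have "(\<Sum>k\<in>digits n. \<Sum>Y<M. \<Sum>Y'<M. A Y Y' * (chi n k (int (dadd n X Y')) * cnj (chi n k (int (dadd n X' Y)))))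
     = (\<Sum>Y<M. \<Sum>Y'<M. A Y Y' * (\<Sum>k\<in>digits n. chi n k (int (dadd n X Y')) * cnj (chi n k (int (dadd n X' Y)))))"
  proof -
    have "(\<Sum>k\<in>digits n. \<Sum>Y<M. \<Sum>Y'<M. f k Y Y') = (\<Sum>Y<M. \<Sum>Y'<M. \<Sum>k\<in>digits n. f k Y Y')" for f :: "(nat \<Rightarrow> nat) \<Rightarrow> nat \<Rightarrow> nat \<Rightarrow> complex"
    proof -
      have "(\<Sum>k\<in>digits n. \<Sum>Y<M. \<Sum>Y'<M. f k Y Y') = (\<Sum>Y<M. \<Sum>k\<in>digits n. \<Sum>Y'<M. f k Y Y')"
        by (rule sum.swap)
      also have "\<dots> = (\<Sum>Y<M. \<Sum>Y'<M. \<Sum>k\<in>digits n. f k Y Y')"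
        by (rule sum.cong[OF refl], rule sum.swap)
      finally show ?thesis .
    qed
    then show ?thesis by (simp only: sum_distrib_left)
  qed
  also have "\<dots> = (\<Sum>Y<M. \<Sum>Y'<M. A Y Y' * (if dadd n X Y' = dadd n X' Y then of_nat M else 0))"
    by (simp only: chi_orthogonal[OF dadd_less dadd_less] M_def)
  \<comment> \<open>Writing \<open>Y\<close> as the digitwise sum of \<open>X\<close> and
    \<open>S\<close>, and \<open>Y'\<close> as that of \<open>X'\<close> and \<open>S'\<close>,
    turns the surviving condition into \<open>S' = S\<close>.\<close>
  also have "\<dots> = (\<Sum>S<M. \<Sum>S'<M. A (dadd n X S) (dadd n X' S') * (if dadd n X (dadd n X' S') = dadd n X' (dadd n X S) then of_nat M else 0))"
  proof -
    have "(\<Sum>Y<M. f Y) = (\<Sum>S<M. f (dadd n X S))" for f :: "nat \<Rightarrow> complex" and X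
      unfolding M_def by (rule sum.reindex_bij_betw[OF bij_betw_dadd, symmetric])
    from this[of "\<lambda>Y. \<Sum>Y'<M. A Y Y' * (if dadd n X Y' = dadd n X' Y then of_nat M else 0)" X]
      this[of "\<lambda>Y'. A (dadd n X S) Y' * (if dadd n X Y' = dadd n X' (dadd n X S) then of_nat M else 0)" X' for S]
    show ?thesis by simp
  qed
  also have "\<dots> = (\<Sum>S<M. \<Sum>S'<M. if S' = S then A (dadd n X S) (dadd n X' S') * of_nat M else 0)"
  proof (intro sum.cong refl)
    fix S S' assume S: "S \<in> {..<M}" "S' \<in> {..<M}"
    have "dadd n X (dadd n X' S') = dadd n (dadd n X X') S'" "dadd n X' (dadd n X S) = dadd n (dadd n X X') S"
      using dadd_assoc[of n X' X S] dadd_commute[of n X' X] by (simp_all add: dadd_assoc)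
    then have "dadd n X (dadd n X' S') = dadd n X' (dadd n X S) \<longleftrightarrow> S' = S"
      using dadd_inj[of S' n S] S by (auto simp: M_def)
    then show "A (dadd n X S) (dadd n X' S') * (if dadd n X (dadd n X' S') = dadd n X' (dadd n X S) then of_nat M else 0)
      = (if S' = S then A (dadd n X S) (dadd n X' S') * of_nat M else 0)" by simp
  qed
  also have "\<dots> = (\<Sum>S<M. A (dadd n X S) (dadd n X' S)) * of_nat M"
    by (simp add: sum_distrib_right)
  finally show ?thesis
    using M by (simp add: kern_shift_def M_def A_def power2_eq_square)
qed

lemma digital_add_in_unit:
  assumes \<sigma>: "\<sigma> \<in> {0..<1}"
  shows "digital_add b (real X / real (b ^ n)) \<sigma> \<in> {0..<1}"
proof -
  define S where "S = nat \<lfloor>\<sigma> * real (b ^ n)\<rfloor>"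
  define \<tau> where "\<tau> = \<sigma> * real (b ^ n) - real S"
  have "real S = of_int \<lfloor>\<sigma> * real (b ^ n)\<rfloor>" using \<sigma> by (simp add: S_def)
  then have \<tau>: "\<tau> \<in> {0..<1}" by (simp only: \<tau>_def) (simp, linarith)
  have "\<sigma> = (real S + \<tau>) / real (b ^ n)" using b_pos by (simp add: \<tau>_def)
  then show ?thesis using digital_add_grid[OF \<tau>] grid_point_less[OF dadd_less \<tau>] by simp
qed

lemma integral_kern_digital_add:
  assumes X: "X < b ^ n" "Y < b ^ n"
  shows "(\<lambda>\<sigma>. kern a (digital_add b (real X / real (b ^ n)) \<sigma>) (digital_add b (real Y / real (b ^ n)) \<sigma>)) \<in> borel_measurable unit_measure"
    and "\<exists>C. \<forall>\<sigma>\<in>{0..<1}. \<bar>kern a (digital_add b (real X / real (b ^ n)) \<sigma>) (digital_add b (real Y / real (b ^ n)) \<sigma>)\<bar> \<le> C"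
    and "(\<integral>\<sigma>. kern a (digital_add b (real X / real (b ^ n)) \<sigma>) (digital_add b (real Y / real (b ^ n)) \<sigma>) \<partial>unit_measure) = kern_shift a n X Y"
proof -
  define g where "g \<sigma> = kern a (digital_add b (real X / real (b ^ n)) \<sigma>) (digital_add b (real Y / real (b ^ n)) \<sigma>)" for \<sigma>
  have M: "b ^ n > 0" using b_pos by simp
  have meas: "g \<in> borel_measurable unit_measure"
    unfolding g_def[abs_def] by (rule measurable_unit) measurable
  then show "(\<lambda>\<sigma>. kern a (digital_add b (real X / real (b ^ n)) \<sigma>) (digital_add b (real Y / real (b ^ n)) \<sigma>)) \<in> borel_measurable unit_measure"
    by (simp add: g_def[abs_def])
  obtain C where C: "\<And>x y. x \<in> {0..1} \<Longrightarrow> y \<in> {0..1} \<Longrightarrow> \<bar>kern a x y\<bar> \<le> C"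
    using kern_bounded by blast
  have bound: "\<bar>g \<sigma>\<bar> \<le> C" if "\<sigma> \<in> {0..<1}" for \<sigma>
    unfolding g_def using digital_add_in_unit[OF that] by (intro C) (auto simp: less_imp_le)
  then show "\<exists>C. \<forall>\<sigma>\<in>{0..<1}. \<bar>kern a (digital_add b (real X / real (b ^ n)) \<sigma>) (digital_add b (real Y / real (b ^ n)) \<sigma>)\<bar> \<le> C"
    unfolding g_def by blast
  have "integral\<^sup>L unit_measure g = (\<Sum>S<b ^ n. \<integral>\<tau>. g ((real S + \<tau>) / real (b ^ n)) \<partial>unit_measure) / real (b ^ n)"
    by (rule integral_unit_cells[OF M meas bound])
  moreover have "(\<integral>\<tau>. g ((real S + \<tau>) / real (b ^ n)) \<partial>unit_measure) = kern_avg a n (dadd n X S) (dadd n Y S)" for S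
    unfolding kern_avg_def
    by (rule Bochner_Integration.integral_cong) (auto simp: g_def digital_add_grid simp del: of_nat_power)
  ultimately have "integral\<^sup>L unit_measure g = kern_shift a n X Y"
    by (simp only: kern_shift_def)
  then show "(\<integral>\<sigma>. kern a (digital_add b (real X / real (b ^ n)) \<sigma>) (digital_add b (real Y / real (b ^ n)) \<sigma>) \<partial>unit_measure) = kern_shift a n X Y"
    unfolding g_def[abs_def] .
qed

section \<open>The mean square worst-case error\<close>

definition net_num :: "nat \<Rightarrow> nat \<Rightarrow> (nat \<Rightarrow> nat \<Rightarrow> nat \<Rightarrow> nat) \<Rightarrow> nat \<Rightarrow> nat \<Rightarrow> nat" where
  "net_num n m C h j = (\<Sum>i=1..n. net_digit b m C j i h * b ^ (n - i))"

lemma net_digit_less: "net_digit b m C j i h < b"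
  using b_pos by (simp add: net_digit_def)

lemma digits_num_Suc:
  "(\<Sum>i=1..Suc n. d i * b ^ (Suc n - i)) = d (Suc n) + (\<Sum>i=1..n. d i * b ^ (n - i)) * b"
proof -
  have "(\<Sum>i=1..n. d i * b ^ (Suc n - i)) = (\<Sum>i=1..n. d i * b ^ (n - i) * b)"
    by (intro sum.cong refl) (simp add: Suc_diff_le)
  then show ?thesis by (simp add: sum_distrib_right)
qed

lemma digits_num_less: "(\<And>i. i \<in> {1..n} \<Longrightarrow> d i < b) \<Longrightarrow> (\<Sum>i=1..n. d i * b ^ (n - i)) < b ^ n"
proof (induction n)
  case (Suc n)
  have "(\<Sum>i=1..n. d i * b ^ (n - i)) + 1 \<le> b ^ n" using Suc by simp
  then have "((\<Sum>i=1..n. d i * b ^ (n - i)) + 1) * b \<le> b ^ n * b" by (rule mult_right_mono) simp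
  then show ?case unfolding digits_num_Suc using Suc.prems[of "Suc n"] by (simp add: algebra_simps)
qed simp

lemma chi_digits_num:
  "(\<And>i. i \<in> {1..n} \<Longrightarrow> d i < b) \<Longrightarrow> chi n k (int (\<Sum>i=1..n. d i * b ^ (n - i))) = (\<Prod>i=1..n. \<omega> ^ (k i * d i))"
proof (induction n)
  case (Suc n)
  have "chi (Suc n) k (int (\<Sum>i=1..Suc n. d i * b ^ (Suc n - i))) = chi n k (int (\<Sum>i=1..n. d i * b ^ (n - i))) * \<omega> ^ (k (Suc n) * d (Suc n))"
    unfolding digits_num_Suc by (rule chi_Suc_nat) (use Suc.prems in simp)
  then show ?case using Suc by simp
qed simp

lemma net_num_less: "net_num n m C h j < b ^ n"
  unfolding net_num_def by (rule digits_num_less) (rule net_digit_less)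

lemma net_point_eq:
  assumes "j \<in> {1..s}"
  shows "net_point b n m s C h j = real (net_num n m C h j) / real (b ^ n)"
proof -
  have "real (net_digit b m C j i h) / real b ^ i = real (net_digit b m C j i h * b ^ (n - i)) / real (b ^ n)" if "i \<in> {1..n}" for i
  proof -
    have "real (b ^ n) = real b ^ (n - i) * real b ^ i" using that by (simp add: power_add[symmetric])
    then show ?thesis using b_pos by simp
  qed
  then show ?thesis
    using assms by (simp add: net_point_def net_num_def sum_divide_distrib)
qed

lemma sum_prod_digits:
  fixes f :: "nat \<Rightarrow> nat \<Rightarrow> complex"
  shows "(\<Sum>h<b ^ m. \<Prod>p<m. f p (h div b ^ p mod b)) = (\<Prod>p<m. \<Sum>y<b. f p y)"
proof (induction m)
  case (Suc m)
  have "(\<Sum>h<b ^ Suc m. \<Prod>p<Suc m. f p (h div b ^ p mod b))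
     = (\<Sum>Y<b. \<Sum>z<b ^ m. \<Prod>p<Suc m. f p ((z + Y * b ^ m) div b ^ p mod b))"
    unfolding power_Suc sum_lessThan_mult ..
  also have "\<dots> = (\<Sum>Y<b. \<Sum>z<b ^ m. (\<Prod>p<m. f p (z div b ^ p mod b)) * f m Y)"
  proof (intro sum.cong refl)
    fix Y z assume "Y \<in> {..<b}" "z \<in> {..<b ^ m}"
    then have top: "(z + Y * b ^ m) div b ^ m mod b = Y" by simp
    have "(z + Y * b ^ m) div b ^ p mod b = z div b ^ p mod b" if "p < m" for p
    proof -
      have "Y * b ^ m = (Y * b ^ (m - Suc p) * b) * b ^ p"
        using that by (simp add: power_add[symmetric] mult.assoc flip: power_Suc)
      then have "(z + Y * b ^ m) div b ^ p = Y * b ^ (m - Suc p) * b + z div b ^ p"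
        using b_pos by (simp only:) simp
      then show ?thesis by simp
    qed
    with top show "(\<Prod>p<Suc m. f p ((z + Y * b ^ m) div b ^ p mod b)) = (\<Prod>p<m. f p (z div b ^ p mod b)) * f m Y"
      by simp
  qed
  also have "\<dots> = (\<Prod>p<Suc m. \<Sum>y<b. f p y)"
    using Suc by (simp add: sum_distrib_left[symmetric] sum_distrib_right[symmetric] mult.commute)
  finally show ?case .
qed simp

text \<open>As a function of the digits of \<open>h\<close>, the product is a character with the
  coefficients \<open>c p\<close>. One coefficient that is nonzero modulo \<open>b\<close>
  contributes a vanishing sum over a complete set of digits.\<close>

lemma net_character_sum:
  assumes "finite u" "p < m" "\<not> [(\<Sum>j\<in>u. \<Sum>i=1..n. k j i * C j i p) = 0] (mod b)"
  shows "(\<Sum>h<b ^ m. \<Prod>j\<in>u. chi n (k j) (int (net_num n m C h j))) = 0"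
proof -
  define c where "c p = (\<Sum>j\<in>u. \<Sum>i=1..n. k j i * C j i p)" for p
  have "(\<Prod>j\<in>u. chi n (k j) (int (net_num n m C h j))) = (\<Prod>p<m. \<omega> ^ (c p * (h div b ^ p mod b)))" for h
  proof -
    have "(\<Prod>j\<in>u. chi n (k j) (int (net_num n m C h j))) = (\<Prod>j\<in>u. \<Prod>i=1..n. \<omega> ^ (k j i * net_digit b m C j i h))"
      unfolding net_num_def by (intro prod.cong refl chi_digits_num net_digit_less)
    also have "\<dots> = (\<Prod>j\<in>u. \<Prod>i=1..n. \<omega> ^ (\<Sum>p<m. k j i * C j i p * (h div b ^ p mod b)))"
    proof (intro prod.cong refl)
      fix j i
      have "\<omega> ^ (k j i * net_digit b m C j i h) = (\<omega> ^ net_digit b m C j i h) ^ k j i"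
        by (simp add: power_mult[symmetric] mult.commute)
      also have "\<omega> ^ net_digit b m C j i h = \<omega> ^ (\<Sum>p<m. C j i p * (h div b ^ p mod b))"
        unfolding net_digit_def by (rule omega_power_mod)
      finally show "\<omega> ^ (k j i * net_digit b m C j i h) = \<omega> ^ (\<Sum>p<m. k j i * C j i p * (h div b ^ p mod b))"
        by (simp add: power_mult[symmetric] sum_distrib_left mult_ac)
    qed
    also have "\<dots> = \<omega> ^ (\<Sum>j\<in>u. \<Sum>i=1..n. \<Sum>p<m. k j i * C j i p * (h div b ^ p mod b))"
      by (simp add: power_sum)
    also have "(\<Sum>j\<in>u. \<Sum>i=1..n. \<Sum>p<m. k j i * C j i p * (h div b ^ p mod b)) = (\<Sum>p<m. c p * (h div b ^ p mod b))"
    proof -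
      have "(\<Sum>j\<in>u. \<Sum>i=1..n. \<Sum>p<m. k j i * C j i p * (h div b ^ p mod b))
         = (\<Sum>j\<in>u. \<Sum>p<m. \<Sum>i=1..n. k j i * C j i p * (h div b ^ p mod b))"
        by (rule sum.cong[OF refl], rule sum.swap)
      also have "\<dots> = (\<Sum>p<m. \<Sum>j\<in>u. \<Sum>i=1..n. k j i * C j i p * (h div b ^ p mod b))"
        by (rule sum.swap)
      finally show ?thesis by (simp add: c_def sum_distrib_right)
    qed
    finally show ?thesis by (simp add: power_sum)
  qed
  then have "(\<Sum>h<b ^ m. \<Prod>j\<in>u. chi n (k j) (int (net_num n m C h j))) = (\<Prod>p<m. \<Sum>y<b. \<omega> ^ (c p * y))"
    by (simp add: sum_prod_digits[of "\<lambda>p y. \<omega> ^ (c p * y)"])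
  also have "\<dots> = 0"
    using assms sum_omega_power[of "c p"] by (intro prod_zero) (auto simp: c_def cong_0_iff)
  finally show ?thesis .
qed

definition mean_square :: "nat \<Rightarrow> nat \<Rightarrow> nat \<Rightarrow> (nat \<Rightarrow> nat \<Rightarrow> nat \<Rightarrow> nat) \<Rightarrow> nat set \<Rightarrow> real" where
  "mean_square a n m C u = (\<Sum>h<b ^ m. \<Sum>h'<b ^ m. \<Prod>j\<in>u. kern_shift a n (net_num n m C h j) (net_num n m C h' j)) / (real (b ^ m))\<^sup>2"

text \<open>Each frequency contributes its coefficient times the squared modulus of a character sum
  over the net. This sum vanishes outside the dual net, and the trivial bound \<open>N\<close>
  cancels the normalisation.\<close>

lemma mean_square_le_dual_sum:
  assumes "finite u"
  shows "\<bar>mean_square a n m C u\<bar> \<le> (\<Sum>k\<in>dual n m C u. \<Prod>j\<in>u. norm (shift_coeff a n (k j)))"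
proof -
  define N where "N = b ^ m"
  have N: "N > 0" using b_pos by (simp add: N_def)
  define W where "W k h = (\<Prod>j\<in>u. chi n (k j) (int (net_num n m C h j)))" for k :: "nat \<Rightarrow> nat \<Rightarrow> nat" and h
  define c where "c k = (\<Prod>j\<in>u. shift_coeff a n (k j))" for k
  define P where "P = PiE u (\<lambda>_. digits n)"
  have finP: "finite P" unfolding P_def using assms by (intro finite_PiE) auto
  have "of_real (\<Prod>j\<in>u. kern_shift a n (net_num n m C h j) (net_num n m C h' j)) = (\<Sum>k\<in>P. c k * (W k h * cnj (W k h')))" for h h'
  proof -
    have "of_real (\<Prod>j\<in>u. kern_shift a n (net_num n m C h j) (net_num n m C h' j))
       = (\<Prod>j\<in>u. \<Sum>q\<in>digits n. shift_coeff a n q * (chi n q (int (net_num n m C h j)) * cnj (chi n q (int (net_num n m C h' j)))))"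
      unfolding of_real_prod by (intro prod.cong refl kern_shift_expansion net_num_less)
    also have "\<dots> = (\<Sum>k\<in>P. \<Prod>j\<in>u. shift_coeff a n (k j) * (chi n (k j) (int (net_num n m C h j)) * cnj (chi n (k j) (int (net_num n m C h' j)))))"
      unfolding P_def using assms by (intro prod_sum_PiE) auto
    also have "\<dots> = (\<Sum>k\<in>P. c k * (W k h * cnj (W k h')))"
      by (simp add: c_def W_def prod.distrib)
    finally show ?thesis .
  qed
  then have "of_real (\<Sum>h<N. \<Sum>h'<N. \<Prod>j\<in>u. kern_shift a n (net_num n m C h j) (net_num n m C h' j))
     = (\<Sum>h<N. \<Sum>h'<N. \<Sum>k\<in>P. c k * (W k h * cnj (W k h')))"
    by (simp only: of_real_sum)
  also have "\<dots> = (\<Sum>h<N. \<Sum>k\<in>P. \<Sum>h'<N. c k * (W k h * cnj (W k h')))"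
    by (rule sum.cong[OF refl], rule sum.swap)
  also have "\<dots> = (\<Sum>k\<in>P. \<Sum>h<N. \<Sum>h'<N. c k * (W k h * cnj (W k h')))"
    by (rule sum.swap)
  also have "\<dots> = (\<Sum>k\<in>P. c k * ((\<Sum>h<N. W k h) * cnj (\<Sum>h<N. W k h)))"
    by (simp only: cnj_sum sum_product) (simp only: sum_distrib_left)
  finally have "complex_of_real (mean_square a n m C u) = (\<Sum>k\<in>P. c k * ((\<Sum>h<N. W k h) * cnj (\<Sum>h<N. W k h))) / (of_nat N)\<^sup>2"
    by (simp add: mean_square_def N_def)
  from arg_cong[OF this, of norm]
  have "\<bar>mean_square a n m C u\<bar> = norm (\<Sum>k\<in>P. c k * ((\<Sum>h<N. W k h) * cnj (\<Sum>h<N. W k h))) / (real N)\<^sup>2"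
    by (simp only: norm_divide norm_of_nat norm_of_real norm_power)
  also have "\<dots> \<le> (\<Sum>k\<in>P. norm (c k) * (norm (\<Sum>h<N. W k h))\<^sup>2) / (real N)\<^sup>2"
    by (intro divide_right_mono sum_norm_le)
      (simp_all only: norm_mult complex_mod_cnj power2_eq_square order_refl mult.assoc zero_le_power2 zero_le_square)
  also have "(\<Sum>k\<in>P. norm (c k) * (norm (\<Sum>h<N. W k h))\<^sup>2) = (\<Sum>k\<in>dual n m C u. norm (c k) * (norm (\<Sum>h<N. W k h))\<^sup>2)"
  proof (rule sum.mono_neutral_right[OF finP])
    show "dual n m C u \<subseteq> P" by (auto simp: dual_def P_def)
    show "\<forall>k\<in>P - dual n m C u. norm (c k) * (norm (\<Sum>h<N. W k h))\<^sup>2 = 0"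
    proof
      fix k assume "k \<in> P - dual n m C u"
      then obtain p where "p < m" "\<not> [(\<Sum>j\<in>u. \<Sum>i=1..n. k j i * C j i p) = 0] (mod b)"
        unfolding dual_def P_def by blast
      then have "(\<Sum>h<N. W k h) = 0"
        unfolding W_def N_def using assms by (intro net_character_sum)
      then show "norm (c k) * (norm (\<Sum>h<N. W k h))\<^sup>2 = 0" by simp
    qed
  qed
  also have "(\<Sum>k\<in>dual n m C u. norm (c k) * (norm (\<Sum>h<N. W k h))\<^sup>2) / (real N)\<^sup>2 \<le> (\<Sum>k\<in>dual n m C u. norm (c k) * (real N)\<^sup>2) / (real N)\<^sup>2"
  proof (intro divide_right_mono sum_mono mult_left_mono power_mono)
    fix k
    have "norm (\<Sum>h<N. W k h) \<le> (\<Sum>h<N. 1)"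
      by (rule sum_norm_le) (simp add: W_def prod_norm[symmetric])
    then show "norm (\<Sum>h<N. W k h) \<le> real N" by simp
  qed auto
  also have "\<dots> = (\<Sum>k\<in>dual n m C u. norm (c k))"
    using N by (simp add: sum_distrib_right[symmetric])
  finally show ?thesis
    by (simp add: c_def prod_norm)
qed

text \<open>The zero frequency, which \<open>dual_sum_bound\<close> leaves out, is covered by the
  quadrature bound because \<open>n \<ge> \<beta> * m \<ge> 2 * a * m\<close>.\<close>

lemma mean_square_bound:
  assumes a: "a \<ge> 1" and u: "finite u" "u \<noteq> {}"
  shows "\<exists>K>0. \<forall>\<beta> m s n C. \<beta> \<ge> 2 * a \<longrightarrow> m \<ge> 1 \<longrightarrow> n \<ge> \<beta> * m \<longrightarrow> u \<subseteq> {1..s} \<longrightarrow> net_rows b \<beta> t m s n C \<longrightarrow>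
     \<bar>mean_square a n m C u\<bar> \<le> K * real m ^ (card u - 1) / real b ^ (2 * a * m)"
proof -
  from kern_coeff_bound[OF a] obtain D where D: "D > 0" and D_all: "\<forall>n k \<tau>. \<tau> \<in> {0..1} \<longrightarrow> b ^ n \<ge> 2 * a \<longrightarrow> (\<forall>i\<in>{1..n}. k i < b) \<longrightarrow>
     norm (kern_coeff a n \<tau> k) \<le> D / real b ^ (2 * mu a n k) \<and>
     ((\<forall>i\<in>{1..n}. k i = 0) \<longrightarrow> norm (kern_coeff a n \<tau> k) \<le> D / real (b ^ n))"
    by (elim exE conjE)
  from dual_sum_bound[OF a u, of t] obtain K where K: "K > 0" and K_all: "\<forall>\<beta> m s n C. \<beta> \<ge> 2 * a \<longrightarrow> m \<ge> 1 \<longrightarrow> u \<subseteq> {1..s} \<longrightarrow> net_rows b \<beta> t m s n C \<longrightarrow>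
     (\<Sum>k\<in>nonzero_dual n m C u. \<Prod>j\<in>u. 1 / real b ^ (2 * mu a n (k j))) \<le> K * real m ^ (card u - 1) / real b ^ (2 * a * m)"
    by (elim exE conjE)
  have main: "\<bar>mean_square a n m C u\<bar> \<le> D ^ card u * (K + 1) * real m ^ (card u - 1) / real b ^ (2 * a * m)"
    if \<beta>: "\<beta> \<ge> 2 * a" and m: "m \<ge> 1" and n: "n \<ge> \<beta> * m" and us: "u \<subseteq> {1..s}" and net: "net_rows b \<beta> t m s n C" for \<beta> m s n C
  proof -
    have n_ge: "n \<ge> 2 * a * m" using mult_le_mono1[OF \<beta>, of m] n by (rule order_trans)
    have "2 * a \<le> 2 * a * m" using m by simp
    then have "2 * a \<le> n" using n_ge by (rule order_trans)
    also have "n < 2 ^ n" by (rule less_exp)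
    also have "(2::nat) ^ n \<le> b ^ n" using b_ge_2 by (rule power_mono) simp
    finally have size: "b ^ n \<ge> 2 * a" by simp
    have coeff: "norm (shift_coeff a n k) \<le> D * (1 / real b ^ (2 * mu a n k))" if "k \<in> digits n" for k
    proof (rule shift_coeff_bound)
      fix \<tau> :: real assume "\<tau> \<in> {0..<1}"
      then have "\<tau> \<in> {0..1}" by simp
      moreover have "\<forall>i\<in>{1..n}. k i < b" using digits_less[OF that] by blast
      ultimately have "norm (kern_coeff a n \<tau> k) \<le> D / real b ^ (2 * mu a n k) \<and>
         ((\<forall>i\<in>{1..n}. k i = 0) \<longrightarrow> norm (kern_coeff a n \<tau> k) \<le> D / real (b ^ n))"
        by (intro D_all[THEN spec, THEN spec, THEN spec, THEN mp, THEN mp, THEN mp] size)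
      then show "norm (kern_coeff a n \<tau> k) \<le> D * (1 / real b ^ (2 * mu a n k))"
        by (simp only: times_divide_eq_right mult_1_right)
    qed
    have coeff0: "norm (shift_coeff a n k) \<le> D * (1 / real (b ^ n))" if "k \<in> digits n" "\<forall>i\<in>{1..n}. k i = 0" for k
    proof (rule shift_coeff_bound)
      fix \<tau> :: real assume "\<tau> \<in> {0..<1}"
      then have "\<tau> \<in> {0..1}" by simp
      moreover have "\<forall>i\<in>{1..n}. k i < b" using digits_less[OF that(1)] by blast
      ultimately have "norm (kern_coeff a n \<tau> k) \<le> D / real b ^ (2 * mu a n k) \<and>
         ((\<forall>i\<in>{1..n}. k i = 0) \<longrightarrow> norm (kern_coeff a n \<tau> k) \<le> D / real (b ^ n))"
        by (intro D_all[THEN spec, THEN spec, THEN spec, THEN mp, THEN mp, THEN mp] size)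
      then show "norm (kern_coeff a n \<tau> k) \<le> D * (1 / real (b ^ n))"
        using that(2) by (simp only: times_divide_eq_right mult_1_right simp_thms)
    qed
    define Z where "Z = dual n m C u - nonzero_dual n m C u"
    have fin: "finite (dual n m C u)" using u by (simp add: finite_dual)
    have dig: "k j \<in> digits n" if "k \<in> dual n m C u" "j \<in> u" for k j
      using that by (auto simp: dual_def)
    have Z_sub: "Z \<subseteq> {\<lambda>j\<in>u. \<lambda>i\<in>{1..n}. 0}"
    proof
      fix k assume k: "k \<in> Z"
      then have zero: "\<And>j i. j \<in> u \<Longrightarrow> i \<in> {1..n} \<Longrightarrow> k j i = 0" and kd: "k \<in> dual n m C u"
        by (auto simp: Z_def nonzero_dual_def)
      have "k = (\<lambda>j\<in>u. \<lambda>i\<in>{1..n}. 0)"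
      proof (rule extensionalityI[of _ u])
        show "k \<in> extensional u" using kd by (auto simp: dual_def PiE_def)
        fix j assume j: "j \<in> u"
        have "k j \<in> extensional {1..n}" using dig[OF kd j] by (simp add: digits_def PiE_def)
        then have "k j = (\<lambda>i\<in>{1..n}. 0)"
          by (rule extensionalityI[of _ "{1..n}"]) (use zero[OF j] in auto)
        then show "k j = (\<lambda>j\<in>u. \<lambda>i\<in>{1..n}. 0) j" using j by simp
      qed simp
      then show "k \<in> {\<lambda>j\<in>u. \<lambda>i\<in>{1..n}. 0}" by simp
    qed
    have "card u \<noteq> 0" using u by simp
    have "\<bar>mean_square a n m C u\<bar> \<le> (\<Sum>k\<in>dual n m C u. \<Prod>j\<in>u. norm (shift_coeff a n (k j)))"
      by (rule mean_square_le_dual_sum[OF u(1)])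
    also have "\<dots> = (\<Sum>k\<in>Z. \<Prod>j\<in>u. norm (shift_coeff a n (k j))) + (\<Sum>k\<in>nonzero_dual n m C u. \<Prod>j\<in>u. norm (shift_coeff a n (k j)))"
      unfolding Z_def using fin by (intro sum.subset_diff) (auto simp: nonzero_dual_def)
    also have "\<dots> \<le> D ^ card u * (1 / real b ^ (2 * a * m)) + D ^ card u * (K * real m ^ (card u - 1) / real b ^ (2 * a * m))"
    proof (rule add_mono)
      have "(\<Sum>k\<in>Z. \<Prod>j\<in>u. norm (shift_coeff a n (k j))) \<le> (\<Sum>k\<in>Z. D ^ card u * (1 / real b ^ (2 * a * m)))"
      proof (rule sum_mono)
        fix k assume k: "k \<in> Z"
        have "(\<Prod>j\<in>u. norm (shift_coeff a n (k j))) \<le> (\<Prod>j\<in>u. D * (1 / real (b ^ n)))"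
        proof (intro prod_mono conjI coeff0)
          fix j assume "j \<in> u"
          then show "k j \<in> digits n" "\<forall>i\<in>{1..n}. k j i = 0" using k dig by (auto simp: Z_def nonzero_dual_def)
        qed simp
        also have "\<dots> = D ^ card u * (1 / real (b ^ n)) ^ card u" by (simp add: power_mult_distrib[symmetric])
        also have "\<dots> \<le> D ^ card u * (1 / real b ^ (2 * a * m))"
        proof (rule mult_left_mono)
          have "1 / real (b ^ n) \<le> 1" using b_pos by simp
          then have "(1 / real (b ^ n)) ^ card u \<le> (1 / real (b ^ n)) ^ 1"
            using \<open>card u \<noteq> 0\<close> by (intro power_decreasing) auto
          also have "\<dots> \<le> 1 / real b ^ (2 * a * m)"
            using b_ge_2 n_ge by (simp add: divide_left_mono power_increasing)
          finally show "(1 / real (b ^ n)) ^ card u \<le> 1 / real b ^ (2 * a * m)" .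
        qed (use D in simp)
        finally show "(\<Prod>j\<in>u. norm (shift_coeff a n (k j))) \<le> D ^ card u * (1 / real b ^ (2 * a * m))" .
      qed
      also have "\<dots> \<le> 1 * (D ^ card u * (1 / real b ^ (2 * a * m)))"
      proof -
        have "card Z \<le> 1" using card_mono[OF _ Z_sub] by simp
        then have "real (card Z) \<le> 1" by simp
        then show ?thesis using D unfolding sum_constant by (intro mult_right_mono) auto
      qed
      finally show "(\<Sum>k\<in>Z. \<Prod>j\<in>u. norm (shift_coeff a n (k j))) \<le> D ^ card u * (1 / real b ^ (2 * a * m))" by simp
    next
      have "(\<Sum>k\<in>nonzero_dual n m C u. \<Prod>j\<in>u. norm (shift_coeff a n (k j)))
         \<le> (\<Sum>k\<in>nonzero_dual n m C u. \<Prod>j\<in>u. D * (1 / real b ^ (2 * mu a n (k j))))"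
        using dig by (intro sum_mono prod_mono conjI coeff) (auto simp: nonzero_dual_def)
      also have "\<dots> = D ^ card u * (\<Sum>k\<in>nonzero_dual n m C u. \<Prod>j\<in>u. 1 / real b ^ (2 * mu a n (k j)))"
        by (simp only: prod.distrib prod_constant sum_distrib_left)
      also have "\<dots> \<le> D ^ card u * (K * real m ^ (card u - 1) / real b ^ (2 * a * m))"
        using D by (intro mult_left_mono K_all[rule_format, OF \<beta> m us net]) auto
      finally show "(\<Sum>k\<in>nonzero_dual n m C u. \<Prod>j\<in>u. norm (shift_coeff a n (k j)))
         \<le> D ^ card u * (K * real m ^ (card u - 1) / real b ^ (2 * a * m))" .
    qed
    also have "\<dots> \<le> D ^ card u * (real m ^ (card u - 1) / real b ^ (2 * a * m)) + D ^ card u * (K * real m ^ (card u - 1) / real b ^ (2 * a * m))"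
      using D m by (intro add_right_mono mult_left_mono divide_right_mono one_le_power) auto
    also have "\<dots> = D ^ card u * (K + 1) * real m ^ (card u - 1) / real b ^ (2 * a * m)"
    proof -
      have "A * (x / y) + A * (K * x / y) = A * (K + 1) * x / y" for A x y :: real
        by (simp add: distrib_left distrib_right add_divide_distrib)
      then show ?thesis .
    qed
    finally show ?thesis .
  qed
  have "D ^ card u * (K + 1) > 0" using D K by simp
  then show ?thesis by (intro exI[of _ "D ^ card u * (K + 1)"] conjI allI impI main)
qed

end

lemma ennreal_sqrt_le:
  assumes "x \<le> ennreal r" "r \<ge> 0"
  shows "ennreal_sqrt x \<le> ennreal (sqrt r)"
proof -
  have "x \<noteq> top" using assms(1) by (auto simp: top_unique)
  moreover have "enn2real x \<le> r" using assms by (rule enn2real_leI[rotated])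
  ultimately show ?thesis by (simp add: ennreal_sqrt_def ennreal_leI)
qed

context digit_base
begin

definition shifted_point :: "nat \<Rightarrow> nat \<Rightarrow> nat \<Rightarrow> (nat \<Rightarrow> nat \<Rightarrow> nat \<Rightarrow> nat) \<Rightarrow> (nat \<Rightarrow> real) \<Rightarrow> nat \<Rightarrow> (nat \<Rightarrow> real)" where
  "shifted_point n m s C \<sigma> h = (\<lambda>j\<in>{1..s}. digital_add b (real (net_num n m C h j) / real (b ^ n)) (\<sigma> j))"

lemma shifted_point_in_cube: "\<sigma> \<in> cube s \<Longrightarrow> shifted_point n m s C \<sigma> h \<in> cube s"
  using digital_add_in_unit[where n = n] b_pos
  by (simp add: shifted_point_def cube_def PiE_iff del: atLeastLessThan_iff of_nat_power)

lemma digital_shift_net: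
  "digital_shift b s (digital_net b n m s C) \<sigma> = image_mset (shifted_point n m s C \<sigma>) (mset_set {0..<b ^ m})"
  unfolding digital_shift_def digital_net_def multiset.map_comp
  by (rule image_mset_cong) (auto simp: shifted_point_def net_point_eq intro!: restrict_ext)

lemma qmc_shifted_net:
  "qmc (digital_shift b s (digital_net b n m s C) \<sigma>) f = (\<Sum>h<b ^ m. f (shifted_point n m s C \<sigma> h)) / real (b ^ m)"
  unfolding digital_shift_net qmc_def
  by (simp add: multiset.map_comp o_def sum_unfold_sum_mset[symmetric] lessThan_atLeast0)

definition square_error :: "nat \<Rightarrow> nat \<Rightarrow> nat \<Rightarrow> nat \<Rightarrow> (nat \<Rightarrow> nat \<Rightarrow> nat \<Rightarrow> nat) \<Rightarrow> (nat set \<Rightarrow> real) \<Rightarrow> (nat \<Rightarrow> real) \<Rightarrow> real" where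
  "square_error a n m s C \<gamma> \<sigma> = (\<Sum>u\<in>Pow {1..s} - {{}}. \<gamma> u * ((\<Sum>h<b ^ m. \<Sum>h'<b ^ m.
      \<Prod>j\<in>u. kern a (shifted_point n m s C \<sigma> h j) (shifted_point n m s C \<sigma> h' j)) / (real (b ^ m))\<^sup>2))"

text \<open>The coordinates of the shift are independent, so the integral factors; the coordinates
  outside \<open>u\<close> contribute a factor 1.\<close>

lemma integral_shifted_kern:
  assumes u: "u \<subseteq> {1..s}"
  shows "integrable (cube_measure s) (\<lambda>\<sigma>. \<Prod>j\<in>u. kern a (shifted_point n m s C \<sigma> h j) (shifted_point n m s C \<sigma> h' j))"
    and "(\<integral>\<sigma>. (\<Prod>j\<in>u. kern a (shifted_point n m s C \<sigma> h j) (shifted_point n m s C \<sigma> h' j)) \<partial>cube_measure s)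
      = (\<Prod>j\<in>u. kern_shift a n (net_num n m C h j) (net_num n m C h' j))"
proof -
  define G where "G j \<sigma> = (if j \<in> u then kern a (digital_add b (real (net_num n m C h j) / real (b ^ n)) \<sigma>)
     (digital_add b (real (net_num n m C h' j) / real (b ^ n)) \<sigma>) else 1)" for j \<sigma>
  have G_eq: "(\<Prod>j\<in>u. kern a (shifted_point n m s C \<sigma> h j) (shifted_point n m s C \<sigma> h' j)) = (\<Prod>j\<in>{1..s}. G j (\<sigma> j))" for \<sigma>
    by (rule prod.mono_neutral_cong_left) (use u in \<open>auto simp: G_def shifted_point_def\<close>)
  have G_int: "integrable unit_measure (G j)" for j
  proof (cases "j \<in> u")
    case True
    then have G: "G j = (\<lambda>\<sigma>. kern a (digital_add b (real (net_num n m C h j) / real (b ^ n)) \<sigma>)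
     (digital_add b (real (net_num n m C h' j) / real (b ^ n)) \<sigma>))" by (simp add: G_def[abs_def])
    obtain B where "\<forall>\<sigma>\<in>{0..<1}. \<bar>G j \<sigma>\<bar> \<le> B"
      unfolding G using integral_kern_digital_add(2)[OF net_num_less net_num_less] by blast
    moreover have "G j \<in> borel_measurable unit_measure"
      unfolding G by (rule integral_kern_digital_add(1)[OF net_num_less net_num_less])
    ultimately show ?thesis by (intro integrable_unit[where B = B]) auto
  next
    case False
    then have "G j = (\<lambda>_. 1)" by (simp add: G_def[abs_def])
    then show ?thesis by (simp add: integrable_unit[where B = 1])
  qed
  show "integrable (cube_measure s) (\<lambda>\<sigma>. \<Prod>j\<in>u. kern a (shifted_point n m s C \<sigma> h j) (shifted_point n m s C \<sigma> h' j))"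
    unfolding G_eq by (rule integrable_cube_prod[OF G_int])
  have "(\<integral>\<sigma>. (\<Prod>j\<in>u. kern a (shifted_point n m s C \<sigma> h j) (shifted_point n m s C \<sigma> h' j)) \<partial>cube_measure s)
     = (\<Prod>j\<in>{1..s}. integral\<^sup>L unit_measure (G j))"
    unfolding G_eq by (rule integral_cube_prod[OF G_int])
  also have "\<dots> = (\<Prod>j\<in>{1..s}. if j \<in> u then kern_shift a n (net_num n m C h j) (net_num n m C h' j) else 1)"
    using integral_kern_digital_add(3)[OF net_num_less net_num_less] unit.prob_space
    by (intro prod.cong refl) (simp add: G_def[abs_def] del: of_nat_power)
  also have "\<dots> = (\<Prod>j\<in>u. kern_shift a n (net_num n m C h j) (net_num n m C h' j))"
    by (rule prod.mono_neutral_cong_right) (use u in auto)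
  finally show "(\<integral>\<sigma>. (\<Prod>j\<in>u. kern a (shifted_point n m s C \<sigma> h j) (shifted_point n m s C \<sigma> h' j)) \<partial>cube_measure s)
      = (\<Prod>j\<in>u. kern_shift a n (net_num n m C h j) (net_num n m C h' j))" .
qed

lemma integral_square_error:
  "integrable (cube_measure s) (square_error a n m s C \<gamma>)"
  "integral\<^sup>L (cube_measure s) (square_error a n m s C \<gamma>) = (\<Sum>u\<in>Pow {1..s} - {{}}. \<gamma> u * mean_square a n m C u)"
proof -
  define F where "F u h h' \<sigma> = (\<Prod>j\<in>u. kern a (shifted_point n m s C \<sigma> h j) (shifted_point n m s C \<sigma> h' j))" for u h h' \<sigma>
  have E: "square_error a n m s C \<gamma> = (\<lambda>\<sigma>. \<Sum>u\<in>Pow {1..s} - {{}}. \<gamma> u * ((\<Sum>h<b ^ m. \<Sum>h'<b ^ m. F u h h' \<sigma>) / (real (b ^ m))\<^sup>2))"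
    by (simp add: square_error_def F_def fun_eq_iff)
  have int1: "integrable (cube_measure s) (F u h h')" if "u \<in> Pow {1..s} - {{}}" for u h h'
    unfolding F_def[abs_def] using that by (intro integral_shifted_kern) auto
  have int2: "integrable (cube_measure s) (\<lambda>\<sigma>. \<Sum>h<b ^ m. \<Sum>h'<b ^ m. F u h h' \<sigma>)" if "u \<in> Pow {1..s} - {{}}" for u
    using int1[OF that] by (intro Bochner_Integration.integrable_sum) auto
  have int3: "integrable (cube_measure s) (\<lambda>\<sigma>. \<gamma> u * ((\<Sum>h<b ^ m. \<Sum>h'<b ^ m. F u h h' \<sigma>) / (real (b ^ m))\<^sup>2))" if "u \<in> Pow {1..s} - {{}}" for u
    using int2[OF that] by (intro integrable_mult_right integrable_divide) auto
  show "integrable (cube_measure s) (square_error a n m s C \<gamma>)"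
    unfolding E by (intro Bochner_Integration.integrable_sum int3)
  have "integral\<^sup>L (cube_measure s) (square_error a n m s C \<gamma>)
     = (\<Sum>u\<in>Pow {1..s} - {{}}. \<integral>\<sigma>. \<gamma> u * ((\<Sum>h<b ^ m. \<Sum>h'<b ^ m. F u h h' \<sigma>) / (real (b ^ m))\<^sup>2) \<partial>cube_measure s)"
    unfolding E by (intro Bochner_Integration.integral_sum int3)
  also have "\<dots> = (\<Sum>u\<in>Pow {1..s} - {{}}. \<gamma> u * mean_square a n m C u)"
  proof (rule sum.cong[OF refl])
    fix u assume u: "u \<in> Pow {1..s} - {{}}"
    have "(\<integral>\<sigma>. (\<Sum>h<b ^ m. \<Sum>h'<b ^ m. F u h h' \<sigma>) \<partial>cube_measure s) = (\<Sum>h<b ^ m. \<integral>\<sigma>. (\<Sum>h'<b ^ m. F u h h' \<sigma>) \<partial>cube_measure s)"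
      using int1[OF u] by (intro Bochner_Integration.integral_sum Bochner_Integration.integrable_sum) auto
    also have "\<dots> = (\<Sum>h<b ^ m. \<Sum>h'<b ^ m. \<integral>\<sigma>. F u h h' \<sigma> \<partial>cube_measure s)"
      using int1[OF u] by (intro sum.cong refl Bochner_Integration.integral_sum) auto
    also have "\<dots> = (\<Sum>h<b ^ m. \<Sum>h'<b ^ m. \<Prod>j\<in>u. kern_shift a n (net_num n m C h j) (net_num n m C h' j))"
      unfolding F_def using u by (intro sum.cong refl integral_shifted_kern) auto
    finally show "(\<integral>\<sigma>. \<gamma> u * ((\<Sum>h<b ^ m. \<Sum>h'<b ^ m. F u h h' \<sigma>) / (real (b ^ m))\<^sup>2) \<partial>cube_measure s) = \<gamma> u * mean_square a n m C u"
      unfolding mean_square_def by simp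
  qed
  finally show "integral\<^sup>L (cube_measure s) (square_error a n m s C \<gamma>) = (\<Sum>u\<in>Pow {1..s} - {{}}. \<gamma> u * mean_square a n m C u)" .
qed

text \<open>The bound on the squared error does not depend on \<open>f\<close>, so the supremum over
  the unit ball is taken before integrating over the shift.\<close>

lemma rms_error_le:
  assumes rkhs: "rkhs (cube s) (sobolev_kernel a s \<gamma>) H ip" and a: "a \<ge> 1"
  shows "rms_wor_error b s H (\<lambda>f. sqrt (ip f f)) (digital_net b n m s C)
    \<le> ennreal (sqrt (\<Sum>u\<in>Pow {1..s} - {{}}. \<gamma> u * mean_square a n m C u))"
    and "0 \<le> (\<Sum>u\<in>Pow {1..s} - {{}}. \<gamma> u * mean_square a n m C u)"
proof -
  interpret rkhs "cube s" "sobolev_kernel a s \<gamma>" H ip by (rule rkhs)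
  define P where "P = digital_net b n m s C"
  define E where "E = square_error a n m s C \<gamma>"
  have error: "(qmc (digital_shift b s P \<sigma>) f - integral\<^sup>L (cube_measure s) f)\<^sup>2 \<le> E \<sigma>"
    if "\<sigma> \<in> cube s" "f \<in> H" "ip f f \<le> 1" for \<sigma> f
    unfolding P_def E_def qmc_shifted_net square_error_def
  proof (rule sobolev_worst_case[where p = "shifted_point n m s C \<sigma>" and N = "b ^ m" and H = H and ip = ip and f = f])
    show "b ^ m > 0" using b_pos by simp
    show "shifted_point n m s C \<sigma> h \<in> cube s" for h by (rule shifted_point_in_cube[OF that(1)])
  qed (fact rkhs a that)+
  \<comment> \<open>The zero function lies in the unit ball, so \<open>E \<sigma>\<close> dominates
    a square.\<close>
  have E_nonneg: "0 \<le> E \<sigma>" if "\<sigma> \<in> cube s" for \<sigma>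
  proof -
    have "ip (\<lambda>x\<in>cube s. 0) (\<lambda>x\<in>cube s. 0) \<le> 1" by (subst ip_zero[OF zero]) simp
    then show ?thesis by (rule order_trans[OF zero_le_power2 error[OF that zero]])
  qed
  have wor: "(wor_error s H (\<lambda>f. sqrt (ip f f)) (digital_shift b s P \<sigma>))\<^sup>2 \<le> ennreal (E \<sigma>)" if \<sigma>: "\<sigma> \<in> cube s" for \<sigma>
  proof -
    have "wor_error s H (\<lambda>f. sqrt (ip f f)) (digital_shift b s P \<sigma>) \<le> ennreal (sqrt (E \<sigma>))"
      unfolding wor_error_def
    proof (rule SUP_least)
      fix f assume "f \<in> {f \<in> H. sqrt (ip f f) \<le> 1}"
      then have "(qmc (digital_shift b s P \<sigma>) f - integral\<^sup>L (cube_measure s) f)\<^sup>2 \<le> E \<sigma>"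
        using \<sigma> by (intro error) auto
      from real_sqrt_le_mono[OF this]
      show "ennreal \<bar>qmc (digital_shift b s P \<sigma>) f - integral\<^sup>L (cube_measure s) f\<bar> \<le> ennreal (sqrt (E \<sigma>))"
        by (intro ennreal_leI) simp
    qed
    then have "(wor_error s H (\<lambda>f. sqrt (ip f f)) (digital_shift b s P \<sigma>))\<^sup>2 \<le> (ennreal (sqrt (E \<sigma>)))\<^sup>2"
      by (intro power_mono) auto
    also have "\<dots> = ennreal (E \<sigma>)"
      using E_nonneg[OF \<sigma>] by (simp add: ennreal_power)
    finally show ?thesis .
  qed
  have "(\<integral>\<^sup>+ \<sigma>. (wor_error s H (\<lambda>f. sqrt (ip f f)) (digital_shift b s P \<sigma>))\<^sup>2 \<partial>cube_measure s) \<le> (\<integral>\<^sup>+ \<sigma>. ennreal (E \<sigma>) \<partial>cube_measure s)"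
    by (rule nn_integral_mono) (use wor in \<open>simp add: space_cube_measure\<close>)
  also have "\<dots> = ennreal (integral\<^sup>L (cube_measure s) E)"
    using E_nonneg unfolding E_def by (intro nn_integral_eq_integral integral_square_error AE_I2) (simp add: space_cube_measure)
  finally have le: "(\<integral>\<^sup>+ \<sigma>. (wor_error s H (\<lambda>f. sqrt (ip f f)) (digital_shift b s P \<sigma>))\<^sup>2 \<partial>cube_measure s) \<le> ennreal (integral\<^sup>L (cube_measure s) E)" .
  have nonneg: "0 \<le> integral\<^sup>L (cube_measure s) E"
    using E_nonneg by (intro integral_nonneg_AE AE_I2) (simp add: space_cube_measure)
  show "rms_wor_error b s H (\<lambda>f. sqrt (ip f f)) (digital_net b n m s C)
    \<le> ennreal (sqrt (\<Sum>u\<in>Pow {1..s} - {{}}. \<gamma> u * mean_square a n m C u))"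
    using ennreal_sqrt_le[OF le nonneg] unfolding rms_wor_error_def P_def E_def integral_square_error .
  show "0 \<le> (\<Sum>u\<in>Pow {1..s} - {{}}. \<gamma> u * mean_square a n m C u)"
    using nonneg unfolding E_def integral_square_error .
qed

end

lemma sqrt_sum_squares_le:
  fixes w :: "'i \<Rightarrow> real"
  assumes "\<And>i. i \<in> I \<Longrightarrow> w i \<ge> 0" "S \<le> (\<Sum>i\<in>I. (w i)\<^sup>2)"
  shows "sqrt S \<le> (\<Sum>i\<in>I. w i)"
proof -
  have "sqrt S \<le> L2_set w I" unfolding L2_set_def using assms(2) by (rule real_sqrt_le_mono)
  also have "\<dots> \<le> (\<Sum>i\<in>I. w i)" using assms(1) by (rule L2_set_le_sum)
  finally show ?thesis .
qed

theorem theorem1: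
  fixes b :: nat
  assumes "prime b"
  shows "\<exists>C :: nat \<Rightarrow> nat \<Rightarrow> nat \<Rightarrow> nat set \<Rightarrow> real.
    (\<forall>\<alpha> \<beta> t u. C \<alpha> \<beta> t u > 0) \<and>
    (\<forall>(s::nat) (\<alpha>::nat) (\<beta>::nat) (m::nat) (t::nat)
        (P :: (nat \<Rightarrow> real) multiset) (\<gamma> :: nat set \<Rightarrow> real)
        (H :: ((nat \<Rightarrow> real) \<Rightarrow> real) set)
        (ip :: ((nat \<Rightarrow> real) \<Rightarrow> real) \<Rightarrow> ((nat \<Rightarrow> real) \<Rightarrow> real) \<Rightarrow> real).
      s \<ge> 1 \<and> m \<ge> 1 \<and> \<alpha> \<ge> 2 \<and> \<beta> \<ge> 2 * \<alpha> \<and> t \<le> \<beta> * m \<and>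
      order_digital_net \<beta> b t m s P \<and>
      (\<forall>u. u \<subseteq> {1..s} \<longrightarrow> \<gamma> u \<ge> 0) \<and>
      rkhs (cube s) (sobolev_kernel \<alpha> s \<gamma>) H ip
      \<longrightarrow>
      rms_wor_error b s H (\<lambda>f. sqrt (ip f f)) P
        \<le> ennreal (1 / real (size P) ^ \<alpha> *
             (\<Sum>u\<in>Pow {1..s} - {{}}.
                sqrt (\<gamma> u) * C \<alpha> \<beta> t u *
                ln (real (size P)) powr ((real (card u) - 1) / 2))))"
proof -
  interpret digit_base b using prime_ge_2_nat[OF assms] by unfold_locales
  define bound where "bound a t u K \<longleftrightarrow> (\<forall>\<beta> m s n C. \<beta> \<ge> 2 * a \<longrightarrow> m \<ge> 1 \<longrightarrow> n \<ge> \<beta> * m \<longrightarrow> u \<subseteq> {1..s} \<longrightarrow> net_rows b \<beta> t m s n C \<longrightarrow>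
     \<bar>mean_square a n m C u\<bar> \<le> K * real m ^ (card u - 1) / real b ^ (2 * a * m))" for a t u K
  \<comment> \<open>One constant for each triple \<open>(a, t, u)\<close>, chosen before
    \<open>\<beta>\<close>, \<open>m\<close>, \<open>s\<close>, \<open>n\<close> and the matrices.
    Where the bound says nothing any positive number serves, because the constants have to be
    positive for all arguments.\<close>
  have "\<forall>q. \<exists>K>0. case q of (a, t, u) \<Rightarrow> a \<ge> 1 \<longrightarrow> finite u \<longrightarrow> u \<noteq> {} \<longrightarrow> bound a t u K"
  proof
    fix q :: "nat \<times> nat \<times> nat set"
    obtain a t u where q: "q = (a, t, u)" by (cases q)
    show "\<exists>K>0. case q of (a, t, u) \<Rightarrow> a \<ge> 1 \<longrightarrow> finite u \<longrightarrow> u \<noteq> {} \<longrightarrow> bound a t u K"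
    proof (cases "a \<ge> 1 \<and> finite u \<and> u \<noteq> {}")
      case True
      then have "\<exists>K>0. bound a t u K"
        unfolding bound_def by (intro mean_square_bound) auto
      then show ?thesis unfolding q by auto
    next
      case False
      then show ?thesis unfolding q by (intro exI[of _ 1]) auto
    qed
  qed
  from choice[OF this] obtain K where K_all: "\<forall>q. K q > 0 \<and> (case q of (a, t, u) \<Rightarrow> a \<ge> 1 \<longrightarrow> finite u \<longrightarrow> u \<noteq> {} \<longrightarrow> bound a t u (K q))" ..
  have K_pos: "K q > 0" for q using K_all by blast
  have K: "bound a t u (K (a, t, u))" if "a \<ge> 1" "finite u" "u \<noteq> {}" for a t u
    using K_all[THEN spec, of "(a, t, u)"] that by simp
  have ln_b: "ln (real b) > 0" using b_ge_2 by simp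
  \<comment> \<open>The square root passes from the mean square to the error, and the power of
    \<open>ln b\<close> converts \<open>m\<close> into \<open>ln N = m * ln b\<close>.\<close>
  define C where "C a \<beta> t u = sqrt (K (a, t, u)) / ln (real b) powr ((real (card u) - 1) / 2)" for a \<beta> t :: nat and u
  have C_pos: "C a \<beta> t u > 0" for a \<beta> t u
    unfolding C_def using K_pos ln_b by (intro divide_pos_pos) auto
  show ?thesis
  proof (intro exI[of _ C] conjI allI impI C_pos)
    fix s \<alpha> \<beta> m t :: nat and P :: "(nat \<Rightarrow> real) multiset" and \<gamma> :: "nat set \<Rightarrow> real"
      and H :: "((nat \<Rightarrow> real) \<Rightarrow> real) set" and ip :: "((nat \<Rightarrow> real) \<Rightarrow> real) \<Rightarrow> ((nat \<Rightarrow> real) \<Rightarrow> real) \<Rightarrow> real"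
    assume asm: "s \<ge> 1 \<and> m \<ge> 1 \<and> \<alpha> \<ge> 2 \<and> \<beta> \<ge> 2 * \<alpha> \<and> t \<le> \<beta> * m \<and>
      order_digital_net \<beta> b t m s P \<and>
      (\<forall>u. u \<subseteq> {1..s} \<longrightarrow> \<gamma> u \<ge> 0) \<and>
      rkhs (cube s) (sobolev_kernel \<alpha> s \<gamma>) H ip"
    then have m: "m \<ge> 1" and \<alpha>: "\<alpha> \<ge> 1" and \<beta>: "\<beta> \<ge> 2 * \<alpha>" and rkhs: "rkhs (cube s) (sobolev_kernel \<alpha> s \<gamma>) H ip"
      and \<gamma>: "\<And>u. u \<subseteq> {1..s} \<Longrightarrow> \<gamma> u \<ge> 0" and net: "order_digital_net \<beta> b t m s P" by auto
    from net obtain n Cm where n: "n \<ge> \<beta> * m" and P: "P = digital_net b n m s Cm" and rows: "net_rows b \<beta> t m s n Cm"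
      unfolding order_digital_net_def net_rows_def[symmetric] by blast
    have size: "size P = b ^ m" by (simp add: P digital_net_def)
    define w where "w u = 1 / real (b ^ m) ^ \<alpha> * (sqrt (\<gamma> u) * C \<alpha> \<beta> t u * ln (real (b ^ m)) powr ((real (card u) - 1) / 2))" for u
    have w_nonneg: "w u \<ge> 0" if "u \<in> Pow {1..s} - {{}}" for u
      unfolding w_def using that \<gamma> C_pos[of \<alpha> \<beta> t u] by (intro mult_nonneg_nonneg) auto
    have u_term: "\<gamma> u * mean_square \<alpha> n m Cm u \<le> (w u)\<^sup>2" if u: "u \<in> Pow {1..s} - {{}}" for u
    proof -
      have fin: "finite u" "u \<noteq> {}" "u \<subseteq> {1..s}" using u finite_subset by auto
      define e where "e = (real (card u) - 1) / 2"
      have card: "real (card u) - 1 = real (card u - 1)" using fin by (simp add: Suc_leI card_gt_0_iff)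
      have "w u = sqrt (\<gamma> u) * sqrt (K (\<alpha>, t, u)) * real m powr e / real b ^ (m * \<alpha>)"
      proof -
        have "ln (real (b ^ m)) = real m * ln (real b)" using b_pos by (simp add: ln_realpow)
        then have "ln (real (b ^ m)) powr e = real m powr e * ln (real b) powr e"
          using ln_b by (simp add: powr_mult)
        then show ?thesis
          using ln_b by (simp add: w_def C_def e_def[symmetric] power_mult)
      qed
      then have "(w u)\<^sup>2 = \<gamma> u * K (\<alpha>, t, u) * (real m powr e)\<^sup>2 / real b ^ (2 * \<alpha> * m)"
        using \<gamma>[OF fin(3)] K_pos[of "(\<alpha>, t, u)"]
        by (simp add: power_mult_distrib power_divide power_mult[symmetric] mult_ac)
      moreover have "(real m powr e)\<^sup>2 = real m ^ (card u - 1)"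
      proof -
        have "(real m powr e)\<^sup>2 = real m powr (e + e)" by (simp only: powr_add power2_eq_square)
        also have "e + e = real (card u - 1)" unfolding e_def card by (rule field_sum_of_halves)
        finally show ?thesis using m by (simp add: powr_realpow)
      qed
      ultimately have w2: "(w u)\<^sup>2 = \<gamma> u * (K (\<alpha>, t, u) * real m ^ (card u - 1) / real b ^ (2 * \<alpha> * m))"
        by (simp only: mult.assoc times_divide_eq_right)
      have "\<bar>mean_square \<alpha> n m Cm u\<bar> \<le> K (\<alpha>, t, u) * real m ^ (card u - 1) / real b ^ (2 * \<alpha> * m)"
        using K[OF \<alpha> fin(1,2), of t, unfolded bound_def, THEN spec, of \<beta>, THEN spec, of m, THEN spec, of s,
          THEN spec, of n, THEN spec, of Cm] \<beta> m n fin(3) rows by simp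
      then show ?thesis unfolding w2 by (intro mult_left_mono \<gamma>[OF fin(3)]) simp
    qed
    have "rms_wor_error b s H (\<lambda>f. sqrt (ip f f)) P \<le> ennreal (sqrt (\<Sum>u\<in>Pow {1..s} - {{}}. \<gamma> u * mean_square \<alpha> n m Cm u))"
      unfolding P by (rule rms_error_le(1)[OF rkhs \<alpha>])
    \<comment> \<open>The Euclidean norm is at most the sum of the entries, which separates the sets
      \<open>u\<close>.\<close>
    also have "\<dots> \<le> ennreal (\<Sum>u\<in>Pow {1..s} - {{}}. w u)"
      by (intro ennreal_leI sqrt_sum_squares_le w_nonneg sum_mono u_term)
    also have "(\<Sum>u\<in>Pow {1..s} - {{}}. w u) = 1 / real (size P) ^ \<alpha> *
             (\<Sum>u\<in>Pow {1..s} - {{}}. sqrt (\<gamma> u) * C \<alpha> \<beta> t u * ln (real (size P)) powr ((real (card u) - 1) / 2))"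
      unfolding w_def size sum_distrib_left ..
    finally show "rms_wor_error b s H (\<lambda>f. sqrt (ip f f)) P
        \<le> ennreal (1 / real (size P) ^ \<alpha> *
             (\<Sum>u\<in>Pow {1..s} - {{}}. sqrt (\<gamma> u) * C \<alpha> \<beta> t u * ln (real (size P)) powr ((real (card u) - 1) / 2)))" .
  qed
qed

end
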